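(* Expand $$X(t)=t^{\overline n}+X_1t^{\overline n-1}+\dots+X_{\overline n},\qquad Y(t)=t^{\underline n}+Y_1t^{\underline n-1}+\dots+Y_{\underline n}.$$ Then $X_1,\dots,X_{\overline n},Y_1,\dots,Y_{\underline n}$ are pairwise commuting difference operators.
   Context: Let $k$ be a field of characteristic zero, $n\ge1$, and $r\in k$ not a negative rational number. Put $\underline n=\lfloor n/2\rfloor$, $\overline n=\lceil n/2\rceil$. Let $z_1,\dots,z_n$ be variables, $\epsilon_i$ the $i$-th standard basis vector of $k^n$ and $(T_if)(z)=f(z-\epsilon_i)$. A difference operator here is a finite linear combination, with coefficients in $k(z_1,\dots,z_n)$ multiplied on the left, of products of the shifts $T_i$. Write $x_i=z_{2i-1}$, $T_{x,i}=T_{2i-1}$ ($1\le i\le\overline n$) and $y_i=z_{2i}$, $T_{y,i}=T_{2i}$ ($1\le i\le\underline n$); $t$ is an indeterminate. Let $$\mathfrak X(t)=\begin{pmatrix}\big[(x_i+t)(x_i+r)^{\overline n-j}-x_i^{\overline n+1-j}T_{x,i}\big]_{i\le\overline n,\,j\le\overline n}&\big[-x_i^{\overline n-j}T_{x,i}\big]_{i\le\overline n,\,j\le\underline n}\\ \big[(y_i+r)^{\underline n+1-j}-y_i^{\underline n+1-j}T_{y,i}\big]_{i\le\underline n,\,j\le\overline n}&\big[(y_i+r)^{\underline n-j}\big]_{i\le\underline n,\,j\le\underline n}\end{pmatrix},$$ $$\mathfrak Y(t)=\begin{pmatrix}\big[(x_i+r)^{\overline n-j}\big]_{i\le\overline n,\,j\le\overline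 n}&\big[(x_i+r)^{\overline n-j}-x_i^{\overline n-j}T_{x,i}\big]_{i\le\overline n,\,j\le\underline n}\\ \big[-y_i^{\underline n+1-j}T_{y,i}\big]_{i\le\underline n,\,j\le\overline n}&\big[(y_i+t)(y_i+r)^{\underline n-j}-y_i^{\underline n+1-j}T_{y,i}\big]_{i\le\underline n,\,j\le\underline n}\end{pmatrix}$$ (row index $i$, column index $j$, both starting at $1$ in each block). Entries in different rows commute, so determinants are well defined. Let $\varphi(z)=\prod_{1\le i<j\le n,\ j-i\text{ even}}(z_i-z_j)$ and $X(t)=\varphi(z)^{-1}\det\mathfrak X(t)$, $Y(t)=\varphi(z)^{-1}\det\mathfrak Y(t)$. *)

theory Defs
  imports
    Complex_Main
    "HOL-Library.Poly_Mapping"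
    "HOL-Computational_Algebra.Fraction_Field"
    "HOL-Combinatorics.Permutations"
begin

section \<open>Rational functions\<close>

text \<open>
  The variables are \<open>z\<^sub>v\<close> for all \<open>v :: nat\<close>, so that the number \<open>n\<close> of variables can be a term;
  \<open>k(z\<^sub>1, \<dots>, z\<^sub>n)\<close> is the subfield \<open>ratfuns n\<close> of the field \<open>'k ratfun\<close>.
\<close>

type_synonym 'k mpoly = "(nat \<Rightarrow>\<^sub>0 nat) \<Rightarrow>\<^sub>0 'k"
type_synonym 'k ratfun = "'k mpoly fract"

definition pconst :: "'k::field_char_0 \<Rightarrow> 'k mpoly" where
  "pconst a = Poly_Mapping.single 0 a"

definition pvar :: "nat \<Rightarrow> 'k::field_char_0 mpoly" where
  "pvar v = Poly_Mapping.single (Poly_Mapping.single v 1) 1"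

definition rconst :: "'k::field_char_0 \<Rightarrow> 'k ratfun" where
  "rconst a = Fract (pconst a) 1"

definition zvar :: "nat \<Rightarrow> 'k::field_char_0 ratfun" where
  "zvar v = Fract (pvar v) 1"

definition mpolys :: "nat \<Rightarrow> 'k::field_char_0 mpoly set" where
  "mpolys n = {p. \<forall>m \<in> Poly_Mapping.keys p. Poly_Mapping.keys m \<subseteq> {1..n}}"

definition ratfuns :: "nat \<Rightarrow> 'k::field_char_0 ratfun set" where
  "ratfuns n = {Fract p q | p q. p \<in> mpolys n \<and> q \<in> mpolys n \<and> q \<noteq> 0}"

section \<open>Shifts of the variables\<close>

definition mon_subst :: "(nat \<Rightarrow> 'k::field_char_0 mpoly) \<Rightarrow> (nat \<Rightarrow>\<^sub>0 nat) \<Rightarrow> 'k mpoly" where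
  "mon_subst s m = (\<Prod>v\<in>Poly_Mapping.keys m. s v ^ Poly_Mapping.lookup m v)"

definition psubst :: "(nat \<Rightarrow> 'k::field_char_0 mpoly) \<Rightarrow> 'k mpoly \<Rightarrow> 'k mpoly" where
  "psubst s p =
     (\<Sum>m\<in>Poly_Mapping.keys p. pconst (Poly_Mapping.lookup p m) * mon_subst s m)"

text \<open>\<open>f(z) \<mapsto> f(z + c \<epsilon>\<^sub>i)\<close>; the inverse of the shift with \<open>c = -1\<close> is used to extend it to
  quotients.\<close>

definition pshift :: "'k::field_char_0 \<Rightarrow> nat \<Rightarrow> 'k mpoly \<Rightarrow> 'k mpoly" where
  "pshift c i = psubst (\<lambda>v. if v = i then pvar v + pconst c else pvar v)"

lemma pconst_simps:
  "pconst 0 = 0" "pconst 1 = 1" "pconst (a + b) = pconst a + pconst b"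
  "pconst (a * b) = pconst a * pconst b"
  by (simp_all add: pconst_def single_add mult_single)

lemma mon_subst_superset:
  assumes "finite A" "Poly_Mapping.keys m \<subseteq> A"
  shows "mon_subst s m = (\<Prod>v\<in>A. s v ^ Poly_Mapping.lookup m v)"
  unfolding mon_subst_def using assms
  by (intro prod.mono_neutral_left) (auto simp: in_keys_iff)

lemma mon_subst_add: "mon_subst s (m + m') = mon_subst s m * mon_subst s m'"
proof -
  let ?A = "Poly_Mapping.keys m \<union> Poly_Mapping.keys m'"
  have "Poly_Mapping.keys (m + m') \<subseteq> ?A" by (rule Poly_Mapping.keys_add)
  then show ?thesis
    by (simp add: mon_subst_superset[of ?A] lookup_add power_add prod.distrib)
qed

lemma psubst_superset:
  assumes "finite A" "Poly_Mapping.keys p \<subseteq> A"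
  shows "psubst s p = (\<Sum>m\<in>A. pconst (Poly_Mapping.lookup p m) * mon_subst s m)"
  unfolding psubst_def using assms
  by (intro sum.mono_neutral_left) (auto simp: in_keys_iff pconst_simps)

lemma psubst_add: "psubst s (p + q) = psubst s p + psubst s q"
proof -
  let ?A = "Poly_Mapping.keys p \<union> Poly_Mapping.keys q"
  have "Poly_Mapping.keys (p + q) \<subseteq> ?A" by (rule Poly_Mapping.keys_add)
  then show ?thesis
    by (simp add: psubst_superset[of ?A] lookup_add pconst_simps distrib_right sum.distrib)
qed

lemma psubst_0: "psubst s 0 = 0"
  by (simp add: psubst_def)

lemma psubst_sum: "psubst s (sum f A) = (\<Sum>x\<in>A. psubst s (f x))"
  by (induction A rule: infinite_finite_induct) (simp_all add: psubst_0 psubst_add)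

lemma psubst_single: "psubst s (Poly_Mapping.single m a) = pconst a * mon_subst s m"
  by (simp add: psubst_superset[of "{m}"])

lemma mpoly_sum_singles:
  "p = (\<Sum>m\<in>Poly_Mapping.keys p. Poly_Mapping.single m (Poly_Mapping.lookup p m))"
  for p :: "'k::field_char_0 mpoly"
  by (rule poly_mapping_eqI)
    (auto simp: lookup_sum lookup_single when_def in_keys_iff sum.delta)

lemma psubst_mult: "psubst s (p * q) = psubst s p * psubst s q"
proof -
  have "p * q = (\<Sum>m\<in>Poly_Mapping.keys p. \<Sum>m'\<in>Poly_Mapping.keys q.
      Poly_Mapping.single (m + m') (Poly_Mapping.lookup p m * Poly_Mapping.lookup q m'))"
    by (subst mpoly_sum_singles[of p], subst mpoly_sum_singles[of q])
      (simp add: sum_product mult_single)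
  then show ?thesis
    by (simp add: psubst_sum psubst_single)
      (simp add: psubst_def sum_product pconst_simps mon_subst_add ac_simps)
qed

lemma psubst_pconst: "psubst s (pconst a) = pconst a"
  by (simp add: pconst_def psubst_single mon_subst_def)

lemma psubst_pvar: "psubst s (pvar v) = s v"
  by (simp add: pvar_def psubst_single mon_subst_def pconst_simps)

lemma psubst_power: "psubst s (p ^ e) = psubst s p ^ e"
  by (induction e) (simp_all add: psubst_mult psubst_pconst[of s 1, unfolded pconst_simps])

lemma psubst_prod: "psubst s (prod f A) = (\<Prod>x\<in>A. psubst s (f x))"
  by (induction A rule: infinite_finite_induct)
    (simp_all add: psubst_mult psubst_pconst[of s 1, unfolded pconst_simps])

lemma psubst_psubst: "psubst s (psubst s' p) = psubst (\<lambda>v. psubst s (s' v)) p"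
  by (simp add: psubst_def[of s'] psubst_def[of "\<lambda>v. psubst s (s' v)"] mon_subst_def
      psubst_sum psubst_mult psubst_pconst psubst_prod psubst_power)

lemma pvar_power: "pvar v ^ e = Poly_Mapping.single (Poly_Mapping.single v e) 1"
  by (induction e) (simp_all add: pvar_def mult_single single_add[symmetric])

lemma mon_subst_pvar: "mon_subst pvar m = Poly_Mapping.single m 1"
proof -
  have "(\<Prod>v\<in>A. pvar v ^ Poly_Mapping.lookup m v) =
      Poly_Mapping.single (\<Sum>v\<in>A. Poly_Mapping.single v (Poly_Mapping.lookup m v)) (1::'a)"
    if "finite A" for A
    using that by (induction A) (simp_all add: pvar_power mult_single)
  moreover have "m = (\<Sum>v\<in>Poly_Mapping.keys m. Poly_Mapping.single v (Poly_Mapping.lookup m v))"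
    by (rule poly_mapping_eqI)
      (auto simp: lookup_sum lookup_single when_def in_keys_iff sum.delta)
  ultimately show ?thesis by (simp add: mon_subst_def)
qed

lemma psubst_pvar_id: "psubst pvar p = p"
  by (subst (2) mpoly_sum_singles)
    (simp add: psubst_def mon_subst_pvar pconst_def mult_single)

lemma pshift_inverse: "pshift (- c) i (pshift c i p) = p"
proof -
  have "(\<lambda>v. psubst (\<lambda>v. if v = i then pvar v + pconst (- c) else pvar v)
      (if v = i then pvar v + pconst c else pvar v)) = pvar"
    by (auto simp: fun_eq_iff psubst_add psubst_pvar psubst_pconst add.assoc
        pconst_simps(1) simp flip: pconst_simps(3))
  then show ?thesis by (simp add: pshift_def psubst_psubst psubst_pvar_id)
qed

lemma pshift_mult: "pshift c i (p * q) = pshift c i p * pshift c i q"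
  by (simp add: pshift_def psubst_mult)

lemma pshift_eq_0_iff: "pshift c i p = 0 \<longleftrightarrow> p = 0"
  using pshift_inverse[of c i p] by (auto simp: pshift_def psubst_0)

lemma pshift_pconst: "pshift c i (pconst a) = pconst a"
  by (simp add: pshift_def psubst_pconst)

lemma pshift_0: "pshift c i 0 = 0" and pshift_1: "pshift c i 1 = 1"
  using pshift_pconst[of c i 0] pshift_pconst[of c i 1] by (simp_all add: pconst_simps)

lift_definition shift :: "nat \<Rightarrow> 'k::field_char_0 ratfun \<Rightarrow> 'k ratfun"
  is "\<lambda>i (p, q). (pshift (- 1) i p, pshift (- 1) i q)"
  by (auto simp: pshift_eq_0_iff simp flip: pshift_mult)

lemma shift_Fract: "shift i (Fract p q) = Fract (pshift (- 1) i p) (pshift (- 1) i q)"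
  by transfer (auto simp: pshift_eq_0_iff pshift_0 pshift_1)

lemma shift_add: "shift i (f + g) = shift i f + shift i g"
  by (cases f; cases g) (simp add: shift_Fract pshift_eq_0_iff,
      simp add: pshift_def psubst_add psubst_mult)

lemma shift_mult: "shift i (f * g) = shift i f * shift i g"
  by (cases f; cases g) (simp add: shift_Fract pshift_mult)

lemma shift_rconst: "shift i (rconst a) = rconst a"
  by (simp add: rconst_def shift_Fract pshift_pconst pshift_1)

lemma shift_zvar: "shift i (zvar v) = (if v = i then zvar v - 1 else zvar v)"
proof -
  have "pconst (- 1) = - (1 :: 'a mpoly)"
    by (simp add: pconst_def single_uminus)
  then show ?thesis
    by (simp add: zvar_def shift_Fract pshift_def psubst_pvar One_fract_def
        psubst_pconst[of _ 1, unfolded pconst_simps])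
qed

section \<open>Operators on rational functions\<close>

text \<open>The ring of additive endomorphisms, with composition as multiplication.\<close>

typedef (overloaded) 'a endo = "{f :: 'a::field \<Rightarrow> 'a. \<forall>x y. f (x + y) = f x + f y}"
  morphisms app_endo Abs_endo
  by (rule exI[of _ id]) simp

setup_lifting type_definition_endo

instantiation endo :: (field) ring_1
begin

lift_definition zero_endo :: "'a endo" is "\<lambda>_. 0" by simp
lift_definition one_endo :: "'a endo" is "\<lambda>x. x" by simp
lift_definition plus_endo :: "'a endo \<Rightarrow> 'a endo \<Rightarrow> 'a endo" is "\<lambda>f g x. f x + g x"
  by (simp add: algebra_simps)
lift_definition uminus_endo :: "'a endo \<Rightarrow> 'a endo" is "\<lambda>f x. - f x"
  by simp
lift_definition minus_endo :: "'a endo \<Rightarrow> 'a endo \<Rightarrow> 'a endo" is "\<lambda>f g x. f x - g x"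
  by (simp add: algebra_simps)
lift_definition times_endo :: "'a endo \<Rightarrow> 'a endo \<Rightarrow> 'a endo" is "\<lambda>f g x. f (g x)"
  by simp

instance
proof
  show "(0 :: 'a endo) \<noteq> 1" by transfer (metis zero_neq_one)
qed (transfer; simp add: fun_eq_iff algebra_simps)+

end

type_synonym 'k oper = "'k ratfun endo"

lift_definition mult_op :: "'a::field \<Rightarrow> 'a endo" is "\<lambda>f g. f * g"
  by (simp add: algebra_simps)

definition T :: "nat \<Rightarrow> 'k::field_char_0 oper" where
  "T i = Abs_endo (shift i)"

lemma app_T: "app_endo (T i) = shift i"
  by (simp add: T_def Abs_endo_inverse shift_add)

lemma T_mult_op: "T i * mult_op f = mult_op (shift i f) * T i"
  by (simp add: app_endo_inject[symmetric] fun_eq_iff times_endo.rep_eq mult_op.rep_eq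
      app_T shift_mult)

text \<open>
  The operators act on all of \<open>'k ratfun\<close>, but those of \<open>n\<close> variables have coefficients in
  \<open>k(z\<^sub>1, \<dots>, z\<^sub>n)\<close> and involve only the first \<open>n\<close> shifts, so they are the same formal
  combinations as the operators on \<open>k(z\<^sub>1, \<dots>, z\<^sub>n)\<close>: distinct products of shifts are
  distinct automorphisms of either field, hence linearly independent over it.
  A word \<open>[i\<^sub>1, \<dots>, i\<^sub>l]\<close> over \<open>{1..n}\<close> stands for the product of the shifts \<open>T i\<^sub>1, \<dots>, T i\<^sub>l\<close>.
\<close>

definition difference_operator :: "nat \<Rightarrow> 'k::field_char_0 oper \<Rightarrow> bool" where
  "difference_operator n D \<longleftrightarrow>
     (\<exists>W c. finite W \<and> W \<subseteq> lists {1..n} \<and> (\<forall>w\<in>W. c w \<in> ratfuns n) \<and>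
        D = (\<Sum>w\<in>W. mult_op (c w) * prod_list (map T w)))"

section \<open>Polynomials in a central indeterminate \<open>t\<close>\<close>

text \<open>
  The library type \<open>poly\<close> has a multiplication only over commutative coefficients, so
  polynomials in \<open>t\<close> are finitely supported maps from exponents to coefficients, with the
  convolution product (which makes \<open>t\<close> commute with the coefficients).
\<close>

type_synonym 'a tpoly = "nat \<Rightarrow>\<^sub>0 'a"

abbreviation tconst :: "'a::ring_1 \<Rightarrow> 'a tpoly" where
  "tconst a \<equiv> Poly_Mapping.single 0 a"

abbreviation tvar :: "'a::ring_1 tpoly" where
  "tvar \<equiv> Poly_Mapping.single 1 1"

text \<open>
  The factors of each summand are multiplied in the order of their rows; if entries in
  different rows commute, the order is immaterial.
\<close>

definition rowdet :: "nat \<Rightarrow> (nat \<Rightarrow> nat \<Rightarrow> 'a::ring_1) \<Rightarrow> 'a" where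
  "rowdet n A =
     (\<Sum>p | p permutes {1..n}. of_int (sign p) * prod_list (map (\<lambda>i. A i (p i)) [1..<n + 1]))"

section \<open>The two matrices\<close>

definition nlow :: "nat \<Rightarrow> nat" where "nlow n = nat \<lfloor>real n / 2\<rfloor>"
definition nupp :: "nat \<Rightarrow> nat" where "nupp n = nat \<lceil>real n / 2\<rceil>"

definition xvar :: "nat \<Rightarrow> 'k::field_char_0 ratfun" where "xvar i = zvar (2 * i - 1)"
definition yvar :: "nat \<Rightarrow> 'k::field_char_0 ratfun" where "yvar i = zvar (2 * i)"
definition Tx :: "nat \<Rightarrow> 'k::field_char_0 oper" where "Tx i = T (2 * i - 1)"
definition Ty :: "nat \<Rightarrow> 'k::field_char_0 oper" where "Ty i = T (2 * i)"

text \<open>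
  The natural number subtractions in the exponents below never truncate for the indices of the
  respective block, since \<open>nlow n \<le> nupp n \<le> nlow n + 1\<close>.
\<close>

definition X11 :: "'k::field_char_0 \<Rightarrow> nat \<Rightarrow> nat \<Rightarrow> nat \<Rightarrow> 'k oper tpoly" where
  "X11 r n i j =
     (tconst (mult_op (xvar i)) + tvar) * tconst (mult_op ((xvar i + rconst r) ^ (nupp n - j)))
       - tconst (mult_op (xvar i ^ (nupp n + 1 - j)) * Tx i)"

definition X12 :: "'k::field_char_0 \<Rightarrow> nat \<Rightarrow> nat \<Rightarrow> nat \<Rightarrow> 'k oper tpoly" where
  "X12 r n i j = tconst (- (mult_op (xvar i ^ (nupp n - j)) * Tx i))"

definition X21 :: "'k::field_char_0 \<Rightarrow> nat \<Rightarrow> nat \<Rightarrow> nat \<Rightarrow> 'k oper tpoly" where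
  "X21 r n i j =
     tconst (mult_op ((yvar i + rconst r) ^ (nlow n + 1 - j))
       - mult_op (yvar i ^ (nlow n + 1 - j)) * Ty i)"

definition X22 :: "'k::field_char_0 \<Rightarrow> nat \<Rightarrow> nat \<Rightarrow> nat \<Rightarrow> 'k oper tpoly" where
  "X22 r n i j = tconst (mult_op ((yvar i + rconst r) ^ (nlow n - j)))"

definition Y11 :: "'k::field_char_0 \<Rightarrow> nat \<Rightarrow> nat \<Rightarrow> nat \<Rightarrow> 'k oper tpoly" where
  "Y11 r n i j = tconst (mult_op ((xvar i + rconst r) ^ (nupp n - j)))"

definition Y12 :: "'k::field_char_0 \<Rightarrow> nat \<Rightarrow> nat \<Rightarrow> nat \<Rightarrow> 'k oper tpoly" where
  "Y12 r n i j =
     tconst (mult_op ((xvar i + rconst r) ^ (nupp n - j)) - mult_op (xvar i ^ (nupp n - j)) * Tx i)"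

definition Y21 :: "'k::field_char_0 \<Rightarrow> nat \<Rightarrow> nat \<Rightarrow> nat \<Rightarrow> 'k oper tpoly" where
  "Y21 r n i j = tconst (- (mult_op (yvar i ^ (nlow n + 1 - j)) * Ty i))"

definition Y22 :: "'k::field_char_0 \<Rightarrow> nat \<Rightarrow> nat \<Rightarrow> nat \<Rightarrow> 'k oper tpoly" where
  "Y22 r n i j =
     (tconst (mult_op (yvar i)) + tvar) * tconst (mult_op ((yvar i + rconst r) ^ (nlow n - j)))
       - tconst (mult_op (yvar i ^ (nlow n + 1 - j)) * Ty i)"

text \<open>Block matrix whose upper left block has size \<open>N \<times> N\<close>; each block is indexed from 1.\<close>

definition block :: "nat \<Rightarrow> (nat \<Rightarrow> nat \<Rightarrow> 'a) \<Rightarrow> (nat \<Rightarrow> nat \<Rightarrow> 'a) \<Rightarrow> (nat \<Rightarrow> nat \<Rightarrow> 'a) \<Rightarrow>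
    (nat \<Rightarrow> nat \<Rightarrow> 'a) \<Rightarrow> nat \<Rightarrow> nat \<Rightarrow> 'a" where
  "block N A B C D a b =
     (if a \<le> N then (if b \<le> N then A a b else B a (b - N))
      else (if b \<le> N then C (a - N) b else D (a - N) (b - N)))"

definition frakX :: "'k::field_char_0 \<Rightarrow> nat \<Rightarrow> nat \<Rightarrow> nat \<Rightarrow> 'k oper tpoly" where
  "frakX r n = block (nupp n) (X11 r n) (X12 r n) (X21 r n) (X22 r n)"

definition frakY :: "'k::field_char_0 \<Rightarrow> nat \<Rightarrow> nat \<Rightarrow> nat \<Rightarrow> 'k oper tpoly" where
  "frakY r n = block (nupp n) (Y11 r n) (Y12 r n) (Y21 r n) (Y22 r n)"

definition phi :: "nat \<Rightarrow> 'k::field_char_0 ratfun" where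
  "phi n = (\<Prod>(i, j) | 1 \<le> i \<and> i < j \<and> j \<le> n \<and> even (j - i). zvar i - zvar j)"

definition X_t :: "'k::field_char_0 \<Rightarrow> nat \<Rightarrow> 'k oper tpoly" where
  "X_t r n = tconst (mult_op (inverse (phi n))) * rowdet n (frakX r n)"

definition Y_t :: "'k::field_char_0 \<Rightarrow> nat \<Rightarrow> 'k oper tpoly" where
  "Y_t r n = tconst (mult_op (inverse (phi n))) * rowdet n (frakY r n)"

definition X_coeff :: "'k::field_char_0 \<Rightarrow> nat \<Rightarrow> nat \<Rightarrow> 'k oper" where
  "X_coeff r n i = Poly_Mapping.lookup (X_t r n) (nupp n - i)"

definition Y_coeff :: "'k::field_char_0 \<Rightarrow> nat \<Rightarrow> nat \<Rightarrow> 'k oper" where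
  "Y_coeff r n i = Poly_Mapping.lookup (Y_t r n) (nlow n - i)"

end

theory Submission
  imports Defs "Jordan_Normal_Form.Determinant"
begin

text \<open>
  Number the rows of the two matrices by \<open>1, \<dots>, n\<close>, those of the variables \<open>x\<close> first, and
  write \<open>z\<^sub>a\<close> and \<open>T\<^sub>a\<close> for the variable and the shift of row \<open>a\<close>. A row determinant expands
  into a sum over the sets \<open>I\<close> of \<open>moved\<close> rows, those that contribute their shift. The
  coefficient of \<open>\<Prod>\<^bsub>a \<in> I\<^esub> T\<^sub>a\<close> is a determinant over a field. After column operations every
  row of it is a row of powers of one point in one of two blocks of columns, so it is zero or
  a product of two Vandermonde determinants (\<open>ndet_two_block\<close>). Give an \<open>x\<close>-row the charge \<open>1\<close>
  and a \<open>y\<close>-row the charge \<open>-1\<close>. The coefficient survives only if the total charge of \<open>I\<close> is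
  \<open>0\<close>, or also \<open>1\<close> in the case of \<open>X(t)\<close>, and it is then a product over the rows, times a
  factor for every pair of a moved row \<open>a\<close> and an unmoved row \<open>b\<close>: \<open>1 / (z\<^sub>b - z\<^sub>a)\<close> if both
  are of the same kind and \<open>z\<^sub>b - z\<^sub>a + r\<close> otherwise (\<open>ndet_X\<close>, \<open>ndet_Y\<close>).

  In a product of two such operators collect the terms in which the rows of \<open>M\<close> are moved
  twice and those of \<open>K\<close> once. Because the coefficients are products over pairs, everything
  that depends on \<open>M\<close> can be taken out (\<open>op_coeff_mult\<close>), and what is left is a sum over the
  ways to split \<open>K\<close> between the two operators, \<open>split_sum\<close>. So the operators commute once this
  sum of rational functions is symmetric in the two operators, \<open>split_sum_swap\<close>.

  That symmetry is proved by induction on \<open>K\<close>, for all values of the variables that satisfy no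
  nontrivial integral linear relation modulo the integers. Let one \<open>x\<close>-variable and one
  \<open>y\<close>-variable run along a common line \<open>z\<^sub>k + L\<close>, \<open>z\<^sub>l + L\<close> (if all of \<open>K\<close> is of one kind, a
  single variable). The difference of the two sums has simple poles in \<open>L\<close>, where a running
  variable meets some \<open>z\<^sub>b\<close>, \<open>z\<^sub>b + 1\<close> or \<open>z\<^sub>b - 1\<close> of its own kind. At \<open>z\<^sub>b\<close> each sum has no
  pole, since exchanging the roles of the two variables changes the sign of the residue. At
  \<open>z\<^sub>b \<plusminus> 1\<close> the residue is a factor symmetric in the operators times the sum for \<open>K\<close> without
  the two variables that meet, so the residues cancel by the induction hypothesis. And the
  difference tends to zero for \<open>L \<rightarrow> \<infinity>\<close>: the terms in which the running pair is split decay by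
  the bound on the charges, and the others add up to the sum for \<open>K\<close> without the pair, up to a
  factor symmetric in the operators and an error of order \<open>1 / L\<close>; if a single variable runs,
  all terms decay or \<open>K\<close> has just one element. A rational function without poles that vanishes
  at infinity is zero. In the formal proof the denominators are cleared, and the polynomial
  that remains has more roots than its degree allows.

  Finally, commutation for all values of \<open>t\<close> in the infinite field \<open>k\<close> gives commutation of
  the coefficients (\<open>shift_sum_coeffs_commute\<close>).
\<close>

section \<open>A symmetric sum over the splittings of a set of variables\<close>

text \<open>
  A Boolean names the side of a splitting on which an element lies, so that both choices for a
  new element \<open>k\<close> are handled by one formula.
\<close>
definition insert_if :: "bool \<Rightarrow> nat \<Rightarrow> nat set \<Rightarrow> nat set" where
  "insert_if s k I = (if s then insert k I else I)"

lemma sum_Pow_insert: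
  assumes "finite K" "k \<notin> K"
  shows "(\<Sum>I\<in>Pow (insert k K). f I) = (\<Sum>I\<in>Pow K. \<Sum>s\<in>UNIV. f (insert_if s k I))" (is "?l = ?r")
proof -
  have "?l = (\<Sum>I\<in>Pow K. f I) + (\<Sum>I\<in>insert k ` Pow K. f I)"
    using assms by (subst Pow_insert, subst sum.union_disjoint) auto
  also have "(\<Sum>I\<in>insert k ` Pow K. f I) = (\<Sum>I\<in>Pow K. f (insert k I))"
    using assms by (subst sum.reindex) (auto simp: inj_on_def)
  finally show ?thesis by (simp add: sum.distrib insert_if_def UNIV_bool)
qed

lemma sum_bool: "(\<Sum>s\<in>UNIV. f s) = f True + f False"
  by (simp add: UNIV_bool add.commute)

text \<open>
  The variables are of two kinds, told apart by \<open>isx\<close>. Only differences of values of variables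
  enter the factors for pairs, and \<open>r\<close> is the shift between the kinds.
\<close>
locale two_coloured =
  fixes isx :: "nat \<Rightarrow> bool" and r :: "'a::field_char_0"
begin

definition quad :: "'a \<Rightarrow> 'a" where "quad d = d * (1 - d)"

definition unit_charge :: "nat \<Rightarrow> int" where "unit_charge a = (if isx a then 1 else - 1)"

text \<open>
  The factor for a variable \<open>a\<close> moved by the first and a variable \<open>b\<close> moved by the second
  operator, at distance \<open>d = z a - z b\<close>: it is the product of the factor for \<open>a\<close> moved and \<open>b\<close>
  not, and of that for \<open>b\<close> moved and the already shifted \<open>a\<close> not (see \<open>move_factor_cross\<close>
  below). Since \<open>quad\<close> is invariant under \<open>d \<mapsto> 1 - d\<close>, the factor is, too.
\<close>
definition cross :: "nat \<Rightarrow> nat \<Rightarrow> 'a \<Rightarrow> 'a" where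
  "cross a b d = (if isx a = isx b then inverse (quad d) else quad d - quad r)"

definition imbalance :: "nat set \<Rightarrow> nat set \<Rightarrow> int" where
  "imbalance K I = (\<Sum>a\<in>K. if a \<in> I then unit_charge a else - unit_charge a)"

definition cross_prod :: "nat set \<Rightarrow> (nat \<Rightarrow> 'a) \<Rightarrow> nat set \<Rightarrow> 'a" where
  "cross_prod K z I = (\<Prod>a\<in>K. \<Prod>b\<in>K. if a \<in> I \<and> b \<notin> I then cross a b (z a - z b) else 1)"

text \<open>
  An operator type \<open>p\<close> consists of the kind of variable that occurs with \<open>t\<close> in its matrix,
  and of a value for \<open>t\<close>. A variable of that kind contributes \<open>x + t\<close> if the operator does not
  move it.
\<close>
definition keep_factor :: "bool \<times> 'a \<Rightarrow> nat \<Rightarrow> 'a \<Rightarrow> 'a" where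
  "keep_factor p a x = (if isx a = fst p then x + snd p else 1)"

text \<open>
  If the first operator moves \<open>a\<close>, then the second one leaves it fixed but meets its shifted
  value.
\<close>
definition side_factor :: "bool \<times> 'a \<Rightarrow> bool \<times> 'a \<Rightarrow> bool \<Rightarrow> nat \<Rightarrow> 'a \<Rightarrow> 'a" where
  "side_factor p1 p2 s a x = (if s then keep_factor p2 a (x - 1) else keep_factor p1 a x)"

text \<open>
  The operators have terms of charge \<open>0\<close>, and also of charge \<open>1\<close> if they are of the first
  kind. If the sum of the charges of two terms is given, this is a condition on the difference
  \<open>q\<close> of the charges only.
\<close>
definition admissible :: "bool \<times> 'a \<Rightarrow> bool \<times> 'a \<Rightarrow> int \<Rightarrow> bool" where
  "admissible p1 p2 q \<longleftrightarrow> q \<le> of_bool (fst p1) \<and> - q \<le> of_bool (fst p2)"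

definition split_term :: "bool \<times> 'a \<Rightarrow> bool \<times> 'a \<Rightarrow> nat set \<Rightarrow> (nat \<Rightarrow> 'a) \<Rightarrow> nat set \<Rightarrow> 'a" where
  "split_term p1 p2 K z I = (\<Prod>a\<in>K. side_factor p1 p2 (a \<in> I) a (z a)) * cross_prod K z I"

definition split_sum :: "bool \<times> 'a \<Rightarrow> bool \<times> 'a \<Rightarrow> nat set \<Rightarrow> (nat \<Rightarrow> 'a) \<Rightarrow> 'a" where
  "split_sum p1 p2 K z = (\<Sum>I\<in>Pow K. of_bool (admissible p1 p2 (imbalance K I)) *
    split_term p1 p2 K z I)"

definition pair_factor :: "nat \<Rightarrow> bool \<Rightarrow> nat \<Rightarrow> bool \<Rightarrow> 'a \<Rightarrow> 'a" where
  "pair_factor k s c sc d = (if s = sc then 1 else if s then cross k c d else cross c k (- d))"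

text \<open>
  The factor of a pair (\<open>pair_factor\<close>) times \<open>denom_factor\<close>, with the denominator cancelled;
  it is also defined where the factor itself has a pole.
\<close>
definition cleared_factor :: "nat \<Rightarrow> bool \<Rightarrow> nat \<Rightarrow> bool \<Rightarrow> 'a \<Rightarrow> 'a" where
  "cleared_factor k s c sc d =
     (if isx k = isx c then (if s = sc then d * (1 - d) * (1 + d) else if s then 1 + d else d - 1)
      else (if s = sc then 1 else if s then quad d - quad r else quad (- d) - quad r))"

definition denom_factor :: "nat \<Rightarrow> nat \<Rightarrow> 'a \<Rightarrow> 'a" where
  "denom_factor k c d = (if isx k = isx c then d * (1 - d) * (1 + d) else 1)"

definition side_charge :: "nat \<Rightarrow> bool \<Rightarrow> int" where "side_charge k s = (if s then
  unit_charge k else - unit_charge k)"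

lemma imbalance_insert:
  assumes "finite K" "k \<notin> K" "I \<subseteq> K"
  shows "imbalance (insert k K) (insert_if s k I) = imbalance K I + side_charge k s"
proof -
  have "(\<Sum>a\<in>K. if a \<in> insert_if s k I then unit_charge a else - unit_charge a) = imbalance K I"
    unfolding imbalance_def using assms by (intro sum.cong) (auto simp: insert_if_def)
  moreover have "k \<notin> I" using assms by auto
  ultimately show ?thesis using assms by (simp add: imbalance_def insert_if_def side_charge_def)
qed

lemma cross_prod_insert:
  assumes "finite K" "k \<notin> K" "I \<subseteq> K"
  shows "cross_prod (insert k K) z (insert_if s k I) = (\<Prod>c\<in>K. pair_factor k s c (c \<in> I) (z k - z
    c)) * cross_prod K z I"
proof -
  let ?J = "insert_if s k I"
  have k: "k \<notin> I" and J: "\<And>a. a \<in> K \<Longrightarrow> a \<in> ?J \<longleftrightarrow> a \<in> I" "k \<in> ?J \<longleftrightarrow> s"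
    using assms by (auto simp: insert_if_def)
  define h where "h a b = (if a \<in> ?J \<and> b \<notin> ?J then cross a b (z a - z b) else 1)" for a b
  have "cross_prod (insert k K) z ?J = (\<Prod>b\<in>K. h k b) * (\<Prod>a\<in>K. h a k * (\<Prod>b\<in>K. h a b))"
    using assms unfolding cross_prod_def h_def[symmetric] by (simp add: h_def)
  also have "\<dots> = (\<Prod>c\<in>K. h k c * h c k) * (\<Prod>a\<in>K. \<Prod>b\<in>K. h a b)"
    by (simp add: prod.distrib mult_ac)
  also have "(\<Prod>a\<in>K. \<Prod>b\<in>K. h a b) = cross_prod K z I"
    unfolding cross_prod_def by (intro prod.cong refl) (simp add: h_def J)
  also have "(\<Prod>c\<in>K. h k c * h c k) = (\<Prod>c\<in>K. pair_factor k s c (c \<in> I) (z k - z c))"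
    by (intro prod.cong refl) (auto simp: h_def J pair_factor_def)
  finally show ?thesis .
qed

lemma cross_prod_cong: "(\<And>a. a \<in> K \<Longrightarrow> z a = z' a) \<Longrightarrow> cross_prod K z I = cross_prod K z' I"
  unfolding cross_prod_def by (intro prod.cong refl) simp

lemma split_term_cong: "(\<And>a. a \<in> K \<Longrightarrow> z a = z' a) \<Longrightarrow> split_term p1 p2 K z I = split_term p1 p2 K z' I"
  unfolding split_term_def using cross_prod_cong[of K z z' I] by simp

lemma split_term_insert:
  assumes "finite K" "k \<notin> K" "I \<subseteq> K"
  shows "split_term p1 p2 (insert k K) z (insert_if s k I) =
    side_factor p1 p2 s k (z k) * (\<Prod>c\<in>K. pair_factor k s c (c \<in> I) (z k - z c)) *
      split_term p1 p2 K z I"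
proof -
  have "(\<Prod>a\<in>K. side_factor p1 p2 (a \<in> insert_if s k I) a (z a)) =
    (\<Prod>a\<in>K. side_factor p1 p2 (a \<in> I) a (z a))"
  proof (intro prod.cong refl)
    fix a assume "a \<in> K"
    then have "a \<in> insert_if s k I \<longleftrightarrow> a \<in> I" using assms by (auto simp: insert_if_def)
    then show "side_factor p1 p2 (a \<in> insert_if s k I) a (z a) =
      side_factor p1 p2 (a \<in> I) a (z a)" by simp
  qed
  moreover have "k \<in> insert_if s k I \<longleftrightarrow> s" using assms by (auto simp: insert_if_def)
  ultimately show ?thesis
    unfolding split_term_def cross_prod_insert[OF assms] using assms by (simp add: mult_ac)
qed

lemma split_sum_insert:
  assumes "finite K" "k \<notin> K"
  shows "split_sum p1 p2 (insert k K) z = (\<Sum>I\<in>Pow K. \<Sum>s\<in>UNIV. of_bool (admissible p1 p2 (imbalance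
    K I + side_charge k s)) *
     (side_factor p1 p2 s k (z k) * (\<Prod>c\<in>K. pair_factor k s c (c \<in> I) (z k - z c)) *
       split_term p1 p2 K z I))"
  unfolding split_sum_def sum_Pow_insert[OF assms] using assms
  by (intro sum.cong refl) (simp add: imbalance_insert split_term_insert)

text \<open>
  The sum for \<open>insert k K\<close> as a function of the value \<open>x\<close> of \<open>k\<close>, with all denominators that
  contain \<open>x\<close> cleared.
\<close>
definition cleared_sum :: "bool \<times> 'a \<Rightarrow> bool \<times> 'a \<Rightarrow> nat set \<Rightarrow> nat \<Rightarrow> 'a \<Rightarrow> (nat \<Rightarrow> 'a) \<Rightarrow> 'a" where
  "cleared_sum p1 p2 K k x z = (\<Sum>I\<in>Pow K. \<Sum>s\<in>UNIV. of_bool (admissible p1 p2 (imbalance K I +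
    side_charge k s)) *
     (side_factor p1 p2 s k x * (\<Prod>c\<in>K. cleared_factor k s c (c \<in> I) (x - z c)) *
       split_term p1 p2 K z I))"

lemma cleared_factor_pair_factor:
  assumes "denom_factor k c d \<noteq> 0"
  shows "cleared_factor k s c sc d = denom_factor k c d * pair_factor k s c sc d"
proof (cases "isx k = isx c")
  case True
  then have "d \<noteq> 0" "1 - d \<noteq> 0" "1 + d \<noteq> 0" using assms by (auto simp: denom_factor_def)
  then show ?thesis using True
    by (auto simp: cleared_factor_def denom_factor_def pair_factor_def cross_def quad_def
      divide_simps)
qed (auto simp: cleared_factor_def denom_factor_def pair_factor_def cross_def)

lemma cleared_sum_split_sum:
  assumes "finite K" "k \<notin> K" "\<And>c. c \<in> K \<Longrightarrow> denom_factor k c (z k - z c) \<noteq> 0"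
  shows "cleared_sum p1 p2 K k (z k) z = (\<Prod>c\<in>K. denom_factor k c (z k - z c)) *
    split_sum p1 p2 (insert k K) z"
proof -
  have "(\<Prod>c\<in>K. cleared_factor k s c (c \<in> I) (z k - z c)) =
      (\<Prod>c\<in>K. denom_factor k c (z k - z c)) * (\<Prod>c\<in>K. pair_factor k s c (c \<in> I) (z k - z c))" for s I
    unfolding prod.distrib[symmetric] using assms by (intro prod.cong refl
      cleared_factor_pair_factor) auto
  then show ?thesis unfolding cleared_sum_def split_sum_insert[OF assms(1,2)] sum_distrib_left
    by (intro sum.cong refl) (simp add: mult_ac)
qed

lemma cleared_sum_insert:
  assumes "finite K" "b \<notin> K"
  shows "cleared_sum p1 p2 (insert b K) k x z = (\<Sum>I\<in>Pow K. \<Sum>s\<in>UNIV. \<Sum>t\<in>UNIV.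
     of_bool (admissible p1 p2 (imbalance K I + side_charge b t + side_charge k s)) *
       (side_factor p1 p2 s k x * side_factor p1 p2 t b (z b) *
       cleared_factor k s b t (x - z b) *
       (\<Prod>c\<in>K. cleared_factor k s c (c \<in> I) (x - z c) * pair_factor b t c (c \<in> I) (z b - z c)) *
         split_term p1 p2 K z I))"
proof -
  have *: "(\<Prod>c\<in>insert b K. cleared_factor k s c (c \<in> insert_if t b I) (x - z c)) =
    cleared_factor k s b t (x - z b) * (\<Prod>c\<in>K. cleared_factor k s c (c \<in> I) (x - z c))" if "I \<subseteq> K"
      for s t I
  proof -
    have "b \<in> insert_if t b I \<longleftrightarrow> t" "\<And>c. c \<in> K \<Longrightarrow> c \<in> insert_if t b I \<longleftrightarrow> c \<in> I"
      using that assms by (auto simp: insert_if_def)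
    then show ?thesis using assms by simp
  qed
  have "cleared_sum p1 p2 (insert b K) k x z = (\<Sum>I\<in>Pow K. \<Sum>t\<in>UNIV. \<Sum>s\<in>UNIV.
     of_bool (admissible p1 p2 (imbalance K I + side_charge b t + side_charge k s)) *
       (side_factor p1 p2 s k x * side_factor p1 p2 t b (z b) *
       cleared_factor k s b t (x - z b) *
       (\<Prod>c\<in>K. cleared_factor k s c (c \<in> I) (x - z c) * pair_factor b t c (c \<in> I) (z b - z c)) *
         split_term p1 p2 K z I))"
    unfolding cleared_sum_def sum_Pow_insert[OF assms]
  proof (intro sum.cong refl)
    fix I t s assume "I \<in> Pow K"
    then have I: "I \<subseteq> K" by simp
    show "of_bool (admissible p1 p2 (imbalance (insert b K) (insert_if t b I) + side_charge k s)) *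
       (side_factor p1 p2 s k x * (\<Prod>c\<in>insert b K. cleared_factor k s c (c \<in> insert_if t b I) (x -
         z c)) *
        split_term p1 p2 (insert b K) z (insert_if t b I)) =
     of_bool (admissible p1 p2 (imbalance K I + side_charge b t + side_charge k s)) *
       (side_factor p1 p2 s k x * side_factor p1 p2 t b (z b) *
       cleared_factor k s b t (x - z b) *
       (\<Prod>c\<in>K. cleared_factor k s c (c \<in> I) (x - z c) * pair_factor b t c (c \<in> I) (z b - z c)) *
         split_term p1 p2 K z I)"
      unfolding split_term_insert[OF assms I] imbalance_insert[OF assms I] *[OF I]
      by (simp add: prod.distrib mult_ac)
  qed
  also have "\<dots> = (\<Sum>I\<in>Pow K. \<Sum>s\<in>UNIV. \<Sum>t\<in>UNIV.
     of_bool (admissible p1 p2 (imbalance K I + side_charge b t + side_charge k s)) *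
       (side_factor p1 p2 s k x * side_factor p1 p2 t b (z b) *
       cleared_factor k s b t (x - z b) *
       (\<Prod>c\<in>K. cleared_factor k s c (c \<in> I) (x - z c) * pair_factor b t c (c \<in> I) (z b - z c)) *
         split_term p1 p2 K z I))"
    by (intro sum.cong refl sum.swap)
  finally show ?thesis .
qed

text \<open>
  When \<open>k\<close> meets \<open>b\<close>, it does not matter for a third variable \<open>c\<close> which of the two is moved by
  the first operator.
\<close>
lemma cleared_factor_pair_factor_0:
  assumes "isx k = isx b" "isx b = isx c \<Longrightarrow> d \<noteq> 0 \<and> 1 - d \<noteq> 0 \<and> 1 + d \<noteq> 0"
  shows "cleared_factor k True c sc d * pair_factor b False c sc d =
    cleared_factor k False c sc d * pair_factor b True c sc d"
  using assms
  by (auto simp: cleared_factor_def pair_factor_def cross_def quad_def divide_simps) (auto simp: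
    algebra_simps)?

text \<open>
  When \<open>k\<close> and \<open>b\<close> on different sides have distance \<open>1\<close>, the factors of a third variable \<open>c\<close>
  do not depend on the side on which \<open>c\<close> lies, by the invariance of \<open>quad\<close> under \<open>d \<mapsto> 1 - d\<close>.
  So the sum over the sides of the other variables is not disturbed.
\<close>
lemma cleared_factor_pair_factor_1:
  assumes "isx k = isx b" "isx b = isx c \<Longrightarrow> d \<noteq> 0 \<and> 1 - d \<noteq> 0 \<and> 1 + d \<noteq> 0"
  shows "cleared_factor k True c sc (d + 1) * pair_factor b False c sc d =
    cleared_factor k True c False (d + 1)"
  using assms
  by (auto simp: cleared_factor_def pair_factor_def cross_def quad_def divide_simps) (auto simp:
    algebra_simps)?

lemma cleared_factor_pair_factor_m1:
  assumes "isx k = isx b" "isx b = isx c \<Longrightarrow> d \<noteq> 0 \<and> 1 - d \<noteq> 0 \<and> 1 + d \<noteq> 0"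
  shows "cleared_factor k False c sc (d - 1) * pair_factor b True c sc d =
    cleared_factor k False c True (d - 1)"
  using assms
  by (auto simp: cleared_factor_def pair_factor_def cross_def quad_def divide_simps) (auto simp:
    algebra_simps)?

lemma cleared_factor_self:
  assumes "isx k = isx b"
  shows "cleared_factor k True b True d = d * (1 - d) * (1 + d)"
    "cleared_factor k False b False d = d * (1 - d) * (1 + d)"
    "cleared_factor k True b False d = 1 + d" "cleared_factor k False b True d = d - 1"
  using assms by (simp_all add: cleared_factor_def)

text \<open>
  The terms in which \<open>k\<close> and \<open>b\<close> lie on the same side carry the factor \<open>z k - z b = 0\<close>; the
  others cancel in pairs under the exchange of \<open>k\<close> and \<open>b\<close>.
\<close>
lemma cleared_sum_at_0:
  assumes fin: "finite K" "b \<notin> K" and kb: "isx k = isx b"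
    and gen: "\<And>c. c \<in> K \<Longrightarrow> isx b = isx c \<Longrightarrow>
      z b - z c \<noteq> 0 \<and> 1 - (z b - z c) \<noteq> 0 \<and> 1 + (z b - z c) \<noteq> 0"
  shows "cleared_sum p1 p2 (insert b K) k (z b) z = 0"
proof -
  have p: "(\<Prod>c\<in>K. cleared_factor k True c (c \<in> I) (z b - z c) *
    pair_factor b False c (c \<in> I) (z b - z c)) =
     (\<Prod>c\<in>K. cleared_factor k False c (c \<in> I) (z b - z c) *
       pair_factor b True c (c \<in> I) (z b - z c))" for I
    using kb gen by (intro prod.cong refl cleared_factor_pair_factor_0) auto
  have w: "side_factor p1 p2 s k x = side_factor p1 p2 s b x" and sg: "side_charge k s =
    side_charge b s" for s x
    using kb by (auto simp: side_factor_def keep_factor_def side_charge_def unit_charge_def)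
  show ?thesis unfolding cleared_sum_insert[OF fin] sum_bool p w sg
    by (rule sum.neutral) (simp add: cleared_factor_self[OF kb] algebra_simps)
qed

text \<open>
  Only the terms survive in which \<open>k\<close> is moved by the first and \<open>b\<close> by the second operator.
  The second operator meets \<open>k\<close> at \<open>z b\<close>, so that the factors of \<open>k\<close> and \<open>b\<close> become symmetric
  in the operators.
\<close>
lemma cleared_sum_at_1:
  assumes fin: "finite K" "b \<notin> K" and kb: "isx k = isx b"
    and gen: "\<And>c. c \<in> K \<Longrightarrow> isx b = isx c \<Longrightarrow>
      z b - z c \<noteq> 0 \<and> 1 - (z b - z c) \<noteq> 0 \<and> 1 + (z b - z c) \<noteq> 0"
  shows "cleared_sum p1 p2 (insert b K) k (z b + 1) z = 2 * keep_factor p1 b (z b) *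
    keep_factor p2 b (z b) *
    (\<Prod>c\<in>K. cleared_factor k True c False (z b + 1 - z c)) * split_sum p1 p2 K z"
proof -
  have p: "(\<Prod>c\<in>K. cleared_factor k True c (c \<in> I) (z b + 1 - z c) *
    pair_factor b False c (c \<in> I) (z b - z c)) =
     (\<Prod>c\<in>K. cleared_factor k True c False (z b + 1 - z c))" for I
  proof (intro prod.cong refl)
    fix c assume "c \<in> K"
    then show "cleared_factor k True c (c \<in> I) (z b + 1 - z c) *
      pair_factor b False c (c \<in> I) (z b - z c) =
      cleared_factor k True c False (z b + 1 - z c)"
      using cleared_factor_pair_factor_1[OF kb, of c "z b - z c" "c \<in> I"] gen[of c] by (simp add:
        algebra_simps)
  qed
  have w: "side_factor p1 p2 True k (z b + 1) = keep_factor p2 b (z b)"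
    "side_factor p1 p2 False b (z b) = keep_factor p1 b (z b)"
    and sg: "side_charge k s = side_charge b s" for s
    using kb by (auto simp: side_factor_def keep_factor_def side_charge_def unit_charge_def)
  show ?thesis unfolding cleared_sum_insert[OF fin] split_sum_def sum_distrib_left sum_bool p w sg
    by (intro sum.cong refl) (simp add: cleared_factor_self[OF kb] side_charge_def)
qed

lemma cleared_sum_at_m1:
  assumes fin: "finite K" "b \<notin> K" and kb: "isx k = isx b"
    and gen: "\<And>c. c \<in> K \<Longrightarrow> isx b = isx c \<Longrightarrow>
      z b - z c \<noteq> 0 \<and> 1 - (z b - z c) \<noteq> 0 \<and> 1 + (z b - z c) \<noteq> 0"
  shows "cleared_sum p1 p2 (insert b K) k (z b - 1) z = - 2 * keep_factor p1 b (z b - 1) *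
    keep_factor p2 b (z b - 1) *
    (\<Prod>c\<in>K. cleared_factor k False c True (z b - 1 - z c)) * split_sum p1 p2 K z"
proof -
  have p: "(\<Prod>c\<in>K. cleared_factor k False c (c \<in> I) (z b - 1 - z c) *
    pair_factor b True c (c \<in> I) (z b - z c)) =
     (\<Prod>c\<in>K. cleared_factor k False c True (z b - 1 - z c))" for I
  proof (intro prod.cong refl)
    fix c assume "c \<in> K"
    then show "cleared_factor k False c (c \<in> I) (z b - 1 - z c) *
      pair_factor b True c (c \<in> I) (z b - z c) =
      cleared_factor k False c True (z b - 1 - z c)"
      using cleared_factor_pair_factor_m1[OF kb, of c "z b - z c" "c \<in> I"] gen[of c] by (simp add:
        algebra_simps)
  qed
  have w: "side_factor p1 p2 False k (z b - 1) = keep_factor p1 b (z b - 1)"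
    "side_factor p1 p2 True b (z b) = keep_factor p2 b (z b - 1)"
    and sg: "side_charge k s = side_charge b s" for s
    using kb by (auto simp: side_factor_def keep_factor_def side_charge_def unit_charge_def)
  show ?thesis unfolding cleared_sum_insert[OF fin] split_sum_def sum_distrib_left sum_bool p w sg
    by (intro sum.cong refl) (simp add: cleared_factor_self[OF kb] side_charge_def)
qed

lemma cleared_sum_swap_at_pole:
  assumes fin: "finite K" "b \<notin> K" and kb: "isx k = isx b"
    and gen: "\<And>c. c \<in> K \<Longrightarrow> isx b = isx c \<Longrightarrow> z b - z c \<notin> \<int>"
    and IH: "split_sum p1 p2 K z = split_sum p2 p1 K z"
    and x: "x \<in> {z b, z b + 1, z b - 1}"
  shows "cleared_sum p1 p2 (insert b K) k x z = cleared_sum p2 p1 (insert b K) k x z"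
proof -
  have gen': "z b - z c \<noteq> 0 \<and> 1 - (z b - z c) \<noteq> 0 \<and> 1 + (z b - z c) \<noteq> 0"
    if "c \<in> K" "isx b = isx c" for c
    using gen[OF that] Ints_0 Ints_1 Ints_minus[OF Ints_1]
    by (metis add.commute add_diff_cancel_left' diff_0_right eq_iff_diff_eq_0 eq_neg_iff_add_eq_0)
  have "cleared_sum p p' (insert b K) k (z b) z = 0" for p p'
    by (rule cleared_sum_at_0[OF fin kb]) (rule gen')
  note R0 = this
  have R1: "cleared_sum p p' (insert b K) k (z b + 1) z = 2 * keep_factor p b (z b) *
    keep_factor p' b (z b) *
    (\<Prod>c\<in>K. cleared_factor k True c False (z b + 1 - z c)) * split_sum p p' K z" for p p'
    by (rule cleared_sum_at_1[OF fin kb]) (rule gen')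
  have Rm: "cleared_sum p p' (insert b K) k (z b - 1) z = - 2 * keep_factor p b (z b - 1) *
    keep_factor p' b (z b - 1) *
    (\<Prod>c\<in>K. cleared_factor k False c True (z b - 1 - z c)) * split_sum p p' K z" for p p'
    by (rule cleared_sum_at_m1[OF fin kb]) (rule gen')
  from x consider "x = z b" | "x = z b + 1" | "x = z b - 1" by auto
  then show ?thesis
  proof cases
    case 1 show ?thesis unfolding 1 R0 ..
  next
    case 2 show ?thesis unfolding 2 R1 IH by (simp only: mult_ac)
  next
    case 3 show ?thesis unfolding 3 Rm IH by (simp only: mult_ac)
  qed
qed

end

section \<open>Symmetry of the sum, by counting roots\<close>

text \<open>
  The two highest possible coefficients of a polynomial whose degree is at most \<open>m\<close>. The shift
  by \<open>pCons 0\<close> lets the second one be \<open>0\<close> if \<open>m = 0\<close>.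
\<close>
definition top_coeffs :: "'a::comm_ring_1 poly \<Rightarrow> nat \<Rightarrow> 'a \<Rightarrow> 'a \<Rightarrow> bool" where
  "top_coeffs p m a b \<longleftrightarrow> degree p \<le> m \<and> coeff p m = a \<and> coeff (pCons 0 p) m = b"

lemma coeff_mult_top:
  fixes p q :: "'a::comm_ring_1 poly"
  assumes "degree p \<le> m" "degree q \<le> n"
  shows "coeff (p * q) (m + n) = coeff p m * coeff q n"
proof -
  have "coeff (p * q) (m + n) = (\<Sum>i\<in>{m}. coeff p i * coeff q (m + n - i))"
    unfolding coeff_mult
  proof (rule sum.mono_neutral_right)
    show "\<forall>i\<in>{..m + n} - {m}. coeff p i * coeff q (m + n - i) = 0"
    proof
      fix i assume "i \<in> {..m + n} - {m}"
      then have "i > m \<or> m + n - i > n" by auto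
      then show "coeff p i * coeff q (m + n - i) = 0"
        using assms by (auto simp: coeff_eq_0)
    qed
  qed auto
  then show ?thesis by simp
qed

lemma coeff_mult_next:
  fixes p q :: "'a::comm_ring_1 poly"
  assumes "degree p \<le> Suc m" "degree q \<le> Suc n"
  shows "coeff (p * q) (Suc (m + n)) = coeff p (Suc m) * coeff q n + coeff p m * coeff q (Suc n)"
proof -
  have "coeff (p * q) (Suc (m + n)) = (\<Sum>i\<in>{m, Suc m}. coeff p i * coeff q (Suc (m + n) - i))"
    unfolding coeff_mult
  proof (rule sum.mono_neutral_right)
    show "\<forall>i\<in>{..Suc (m + n)} - {m, Suc m}. coeff p i * coeff q (Suc (m + n) - i) = 0"
    proof
      fix i assume "i \<in> {..Suc (m + n)} - {m, Suc m}"
      then have "i > Suc m \<or> Suc (m + n) - i > Suc n" by auto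
      then show "coeff p i * coeff q (Suc (m + n) - i) = 0"
        using assms by (auto simp: coeff_eq_0)
    qed
  qed auto
  then show ?thesis by (simp add: Suc_diff_le)
qed

text \<open>
  The two highest coefficients multiply like dual numbers.
\<close>
lemma top_coeffs_mult:
  assumes "top_coeffs p m a b" "top_coeffs q n c d"
  shows "top_coeffs (p * q) (m + n) (a * c) (a * d + b * c)"
proof -
  have d: "degree p \<le> m" "degree q \<le> n" and co: "coeff p m = a" "coeff q n = c"
    "coeff (pCons 0 p) m = b" "coeff (pCons 0 q) n = d"
    using assms by (auto simp: top_coeffs_def)
  have "coeff (pCons 0 (p * q)) (m + n) = a * d + b * c"
  proof (cases m)
    case 0
    then obtain u where "p = [:u:]" using d by (metis le_zero_eq degree_eq_zeroE)
    then have "p = [:a:]" using co 0 by simp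
    then show ?thesis using co 0 by (cases n) auto
  next
    case m: (Suc m')
    show ?thesis
    proof (cases n)
      case 0
      then obtain u where "q = [:u:]" using d by (metis le_zero_eq degree_eq_zeroE)
      then have "q = [:c:]" using co 0 by simp
      then show ?thesis using co m 0 by (auto simp: mult.commute)
    next
      case (Suc n')
      then show ?thesis using coeff_mult_next[of p m' q n'] d co m by simp
    qed
  qed
  moreover have "degree (p * q) \<le> m + n"
    using d degree_mult_le[of p q] by linarith
  ultimately show ?thesis using coeff_mult_top[OF d] co by (simp add: top_coeffs_def)
qed

lemma top_coeffs_prod_cubics:
  assumes "finite A" "\<And>c. c \<in> A \<Longrightarrow> top_coeffs (F c) 3 (- 1) (- B c)"
  shows "top_coeffs (\<Prod>c\<in>A. F c) (3 * card A) ((- 1) ^ card A) ((- 1) ^ card A * (\<Sum>c\<in>A. B c))"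
  using assms
proof (induction A)
  case empty
  show ?case by (simp add: top_coeffs_def)
next
  case (insert x A)
  from top_coeffs_mult[OF insert.prems[of x] insert.IH] insert show ?case
    by (simp add: algebra_simps)
qed

lemma top_coeffs_cubic_explicit:
  "top_coeffs [:a, b, c, d:] 3 d c"
proof -
  have "degree [:a, b, c, d:] \<le> 3"
    by (rule degree_le) (auto simp: coeff_pCons split: nat.splits)
  then show ?thesis by (simp add: top_coeffs_def numeral_3_eq_3)
qed

text \<open>
  Genericity that is kept when a variable is moved to a value such as \<open>z b + x - z k + z l\<close>
  with an integer \<open>x\<close>, as happens at the poles.
\<close>
definition int_indep :: "nat set \<Rightarrow> (nat \<Rightarrow> 'a::field_char_0) \<Rightarrow> bool" where
  "int_indep K z \<longleftrightarrow> (\<forall>m :: nat \<Rightarrow> int. (\<Sum>a\<in>K. of_int (m a) * z a) \<in> \<int> \<longrightarrow> (\<forall>a\<in>K. m a = 0))"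

lemma int_indepD: "int_indep K z \<Longrightarrow> (\<Sum>a\<in>K. of_int (m a) * z a) \<in> \<int> \<Longrightarrow> a \<in> K \<Longrightarrow> m a = 0"
  by (auto simp: int_indep_def)

lemma int_indep_subset:
  assumes "int_indep K z" "K' \<subseteq> K" "finite K"
  shows "int_indep K' z"
  unfolding int_indep_def
proof (intro allI impI ballI)
  fix m :: "nat \<Rightarrow> int" and a assume m: "(\<Sum>a\<in>K'. of_int (m a) * z a) \<in> \<int>" and a: "a \<in> K'"
  have "(\<Sum>a\<in>K. of_int (if a \<in> K' then m a else 0) * z a) = (\<Sum>a\<in>K'. of_int (m a) * z a)"
    using assms by (intro sum.mono_neutral_cong_right) auto
  then show "m a = 0" using int_indepD[OF assms(1), of "\<lambda>a. if a \<in> K' then m a else 0" a] m a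
    assms(2) by auto
qed

lemma sum_single:
  assumes "finite K" "b \<in> K"
  shows "(\<Sum>a\<in>K. of_int (of_bool (a = b)) * z a) = (z b :: 'a::field_char_0)"
proof -
  have "(\<Sum>a\<in>K. of_int (of_bool (a = b)) * z a) = (\<Sum>a\<in>K. if b = a then z a else 0)"
    by (intro sum.cong) auto
  then show ?thesis using assms by simp
qed

lemma int_indep_diff4:
  assumes "int_indep K z" "finite K" "b \<in> K" "c \<in> K" "k \<in> K" "l \<in> K" "b \<noteq> c" "b \<noteq> k"
  shows "z b - z c - z k + z l \<notin> \<int>"
proof
  assume *: "z b - z c - z k + z l \<in> \<int>"
  define m :: "nat \<Rightarrow> int" where
    "m a = of_bool (a = b) - of_bool (a = c) - of_bool (a = k) + of_bool (a = l)" for a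
  have "(\<Sum>a\<in>K. of_int (m a) * z a) = z b - z c - z k + z l"
    unfolding m_def of_int_diff of_int_add left_diff_distrib distrib_right sum_subtractf sum.distrib
    using assms by (simp only: sum_single)
  then have "m b = 0" using int_indepD[OF assms(1)] * assms by auto
  then show False using assms by (cases "b = l") (auto simp: m_def)
qed

lemma int_indep_diff:
  assumes "int_indep K z" "finite K" "b \<in> K" "c \<in> K" "b \<noteq> c"
  shows "z b - z c \<notin> \<int>"
  using int_indep_diff4[of K z b c c c] assms by simp

context two_coloured
begin

definition keep_factor_poly :: "bool \<times> 'a \<Rightarrow> nat \<Rightarrow> 'a \<Rightarrow> 'a poly" where
  "keep_factor_poly p a x = (if isx a = fst p then [:x + snd p, 1:] else 1)"

definition side_factor_poly :: "bool \<times> 'a \<Rightarrow> bool \<times> 'a \<Rightarrow> bool \<Rightarrow> nat \<Rightarrow> 'a \<Rightarrow> 'a poly" where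
  "side_factor_poly p1 p2 s a x = (if s then keep_factor_poly p2 a (x - 1) else keep_factor_poly
    p1 a x)"

definition quad_poly :: "'a poly \<Rightarrow> 'a poly" where "quad_poly d = d * (1 - d)"

definition cleared_factor_poly :: "nat \<Rightarrow> bool \<Rightarrow> nat \<Rightarrow> bool \<Rightarrow> 'a \<Rightarrow> 'a poly" where
  "cleared_factor_poly k s c sc x = (let d = [:x, 1:] in
     (if isx k = isx c then (if s = sc then d * (1 - d) * (1 + d) else if s then 1 + d else d - 1)
      else (if s = sc then 1 else if s then quad_poly d - [:quad r:] else quad_poly (- d) - [:quad
        r:])))"

lemma poly_side_factor_poly: "poly (side_factor_poly p1 p2 s a x) y = side_factor p1 p2 s a (y + x)"
  by (simp add: side_factor_poly_def side_factor_def keep_factor_poly_def keep_factor_def add_ac)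

lemma poly_cleared_factor_poly: "poly (cleared_factor_poly k s c sc x) y =
  cleared_factor k s c sc (y + x)"
  by (simp add: cleared_factor_poly_def cleared_factor_def Let_def quad_poly_def quad_def
    algebra_simps)

lemma denom_factor_nonzero:
  assumes "isx k = isx c \<Longrightarrow> d \<notin> \<int>"
  shows "denom_factor k c d \<noteq> 0"
proof (cases "isx k = isx c")
  case True
  then have "d \<notin> \<int>" using assms by simp
  then have "d \<noteq> 0" "d \<noteq> 1" "d \<noteq> - 1"
    using Ints_0 Ints_1 Ints_minus[OF Ints_1] by metis+
  then have "d \<noteq> 0" "1 - d \<noteq> 0" "1 + d \<noteq> 0" by (auto simp: eq_neg_iff_add_eq_0 add.commute)
  then show ?thesis by (simp add: denom_factor_def)
qed (simp add: denom_factor_def)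

lemma poly_eq_0_by_roots:
  fixes P :: "'a poly"
  assumes "\<And>i. i \<ge> D \<Longrightarrow> coeff P i = 0" "finite A" "card A = D" "\<And>x. x \<in> A \<Longrightarrow> poly P x = 0"
  shows "P = 0"
proof (rule ccontr)
  assume P: "P \<noteq> 0"
  have "card A \<le> card {x. poly P x = 0}"
    using assms P by (intro card_mono) (auto simp: poly_roots_finite)
  also have "\<dots> \<le> degree P" using P by (rule card_poly_roots_bound)
  also have "\<dots> < D" using P assms(1)[of "degree P"] by (meson leading_coeff_0_iff not_le)
  finally show False using assms(3) by simp
qed

lemma degree_side_factor_poly: "degree (side_factor_poly p1 p2 s a x) \<le> of_bool (isx a =
  fst (if s then p2 else p1))"
  by (simp add: side_factor_poly_def keep_factor_poly_def)

lemma cleared_factor_poly_explicit: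
  shows cleared_factor_poly_1: "isx k = isx c \<Longrightarrow> s = sc \<Longrightarrow>
      cleared_factor_poly k s c sc x = [:x - x^3, 1 - 3 * x^2, - 3 * x, - 1:]"
    and cleared_factor_poly_2: "isx k = isx c \<Longrightarrow> s \<noteq> sc \<Longrightarrow>
      cleared_factor_poly k s c sc x = [:(if s then x + 1 else x - 1), 1:]"
    and cleared_factor_poly_3: "isx k \<noteq> isx c \<Longrightarrow> s \<noteq> sc \<Longrightarrow> cleared_factor_poly k s c sc x =
      (if s then [:x - x^2 - quad r, 1 - 2 * x, - 1:] else [:- x - x^2 - quad r, - 1 - 2 * x, -
        1:])"
    and cleared_factor_poly_4: "isx k \<noteq> isx c \<Longrightarrow> s = sc \<Longrightarrow> cleared_factor_poly k s c sc x = 1"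
  by (simp_all add: cleared_factor_poly_def Let_def one_pCons quad_poly_def algebra_simps
    power3_eq_cube power2_eq_square)

lemma degree_cleared_factor_poly: "degree (cleared_factor_poly k s c sc x) \<le>
   (if isx k = isx c then (if s = sc then 3 else 1) else (if s = sc then 0 else 2))"
proof -
  have d: "degree [:a, b, c, d:] \<le> 3" "degree [:a, b, c:] \<le> 2" for a b c d :: 'a
    by (rule degree_le; auto simp: coeff_pCons split: nat.splits)+
  show ?thesis using d by (cases "isx k = isx c"; cases "s =
    sc") (auto simp: cleared_factor_poly_1 cleared_factor_poly_2 cleared_factor_poly_3
    cleared_factor_poly_4)
qed

definition cleared_sum_poly where
  "cleared_sum_poly p1 p2 K k z = (\<Sum>I\<in>Pow K. \<Sum>s\<in>UNIV. smult (of_bool (admissible p1 p2 (imbalance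
    K I + side_charge k s)) * split_term p1 p2 K z I)
     (side_factor_poly p1 p2 s k 0 * (\<Prod>c\<in>K. cleared_factor_poly k s c (c \<in> I) (- z c))))"

lemma poly_cleared_sum_poly: "poly (cleared_sum_poly p1 p2 K k z) x = cleared_sum p1 p2 K k x z"
  unfolding cleared_sum_poly_def cleared_sum_def poly_sum
  by (intro sum.cong refl) (simp add: poly_side_factor_poly poly_cleared_factor_poly poly_prod
    mult_ac)

text \<open>
  Every variable on the other side than \<open>k\<close> lowers the degree by \<open>2\<close>, and the bound on the
  charges puts one there.
\<close>
lemma coeff_cleared_sum_one_type:
  assumes fin: "finite K" and ne: "K \<noteq> {}" and mono: "\<And>c. c \<in> K \<Longrightarrow> isx c = isx k"
    and i: "i \<ge> 3 * card K"
  shows "coeff (cleared_sum_poly p1 p2 K k z) i = 0"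
proof -
  have "of_bool (admissible p1 p2 (imbalance K I + side_charge k s)) * 
     coeff (side_factor_poly p1 p2 s k 0 * (\<Prod>c\<in>K. cleared_factor_poly k s c (c \<in> I) (- z c))) i =
       0" if I: "I \<subseteq> K" for I s
  proof (cases "admissible p1 p2 (imbalance K I + side_charge k s)")
    case True
    \<comment> \<open>the variables on the other side than \<open>k\<close>\<close>
    define A where "A = (if s then K - I else I)"
    have finI: "finite I" using I fin by (rule finite_subset)
    have cA: "card A \<le> card K" "A \<subseteq> K" "finite A"
      using fin I finI by (auto simp: A_def card_mono)
    have kk: "unit_charge c = unit_charge k" if "c \<in> K" for c using mono[OF that] by (simp add:
      unit_charge_def)
    have "imbalance K I = (\<Sum>a\<in>K. (if a \<in> A then - 1 else 1) * side_charge k s)"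
      unfolding imbalance_def side_charge_def A_def using I by (intro sum.cong refl) (auto simp: kk)
    also have "\<dots> = (\<Sum>a\<in>K. if a \<in> A then - 1 else 1) * side_charge k s"
      by (simp add: sum_distrib_right)
    also have "(\<Sum>a\<in>K. if a \<in> A then - 1 else 1) = (int (card K) - 2 * int (card A))"
    proof -
      have "(\<Sum>a\<in>K. if a \<in> A then - 1 else 1 :: int) = (\<Sum>a\<in>K. 1 - 2 * (if a \<in> A then 1 else 0))"
        by (intro sum.cong) auto
      also have "\<dots> = int (card K) - 2 * int (card (K \<inter> A))"
        using fin by (simp add: sum_subtractf sum_distrib_left[symmetric] sum.If_cases)
      also have "K \<inter> A = A" using cA by auto
      finally show ?thesis .
    qed
    finally have im: "imbalance K I + side_charge k s = (int (card K) - 2 * int (card A) + 1) *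
      side_charge k s"
      by (simp add: algebra_simps)
    have "card A \<noteq> 0"
    proof
      assume "card A = 0"
      then have "\<bar>imbalance K I + side_charge k s\<bar> = int (card K) + 1"
        using im by (auto simp: side_charge_def unit_charge_def abs_mult)
      moreover have "card K \<ge> 1" using fin ne by (metis One_nat_def Suc_leI card_gt_0_iff)
      moreover have "\<bar>imbalance K I + side_charge k s\<bar> \<le> 1"
        using True by (cases "fst p1"; cases "fst p2") (auto simp: admissible_def)
      ultimately show False by linarith
    qed
    have "degree (\<Prod>c\<in>K. cleared_factor_poly k s c (c \<in> I) (- z c)) \<le> (\<Sum>c\<in>K. degree
      (cleared_factor_poly k s c (c \<in> I) (- z c)))"
      using degree_prod_sum_le[OF fin] by (simp add: o_def)
    also have "\<dots> \<le> (\<Sum>c\<in>K. if c \<in> A then 1 else 3)"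
    proof (rule sum_mono)
      fix c assume c: "c \<in> K"
      then have "(s = (c \<in> I)) = (c \<notin> A)" by (auto simp: A_def)
      then show "degree (cleared_factor_poly k s c (c \<in> I) (- z c)) \<le> (if c \<in> A then 1 else 3)"
        using degree_cleared_factor_poly[of k s c "c \<in> I" "- z c"] mono[OF c] by auto
    qed
    finally have d: "degree (\<Prod>c\<in>K. cleared_factor_poly k s c (c \<in> I) (- z c)) \<le> (\<Sum>c\<in>K. if c \<in> A
      then 1 else 3)" .
    have "(\<Sum>c\<in>K. if c \<in> A then 1 else 3 :: nat) + 2 * card A = 3 * card K"
    proof -
      have "(\<Sum>c\<in>K. if c \<in> A then 1 else 3 :: nat) + (\<Sum>c\<in>K. if c \<in> A then 2 else 0) = (\<Sum>c\<in>K. 3)"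
        unfolding sum.distrib[symmetric] by (intro sum.cong) auto
      moreover have "(\<Sum>c\<in>K. if c \<in> A then 2 else 0 :: nat) = 2 * card (K \<inter> A)"
        using fin by (simp add: sum.If_cases)
      moreover have "K \<inter> A = A" using cA by auto
      ultimately show ?thesis by simp
    qed
    moreover have "degree (side_factor_poly p1 p2 s k 0) \<le> 1"
      by (rule order.trans[OF degree_side_factor_poly]) auto
    ultimately have "degree (side_factor_poly p1 p2 s k 0 *
      (\<Prod>c\<in>K. cleared_factor_poly k s c (c \<in> I) (- z c))) < i"
      using d degree_mult_le[of "side_factor_poly p1 p2 s k 0" "\<Prod>c\<in>K. cleared_factor_poly k s c (c
        \<in> I) (- z c)"] i \<open>card A \<noteq> 0\<close>
      by linarith
    then show ?thesis by (simp add: coeff_eq_0)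
  qed simp
  then show ?thesis unfolding cleared_sum_poly_def coeff_sum
    by (intro sum.neutral ballI) (auto simp: mult_ac)
qed

text \<open>
  Shifts of different values by \<open>0\<close>, \<open>1\<close>, \<open>-1\<close> do not coincide.
\<close>
lemma card_poles:
  assumes "finite K" and inj: "\<And>b c. b \<in> K \<Longrightarrow> c \<in> K \<Longrightarrow> b \<noteq> c \<Longrightarrow> f b - f c \<notin> \<int>"
  shows "card ((\<lambda>(b, x). f b + x) ` (K \<times> {0, 1, - 1 :: 'a})) = 3 * card K"
proof -
  have "inj_on (\<lambda>(b, x). f b + x) (K \<times> {0, 1, - 1 :: 'a})"
  proof (rule inj_onI; clarify)
    fix b x c y assume b: "b \<in> K" "c \<in> K" and x: "x \<in> {0, 1, - 1}" "y \<in> {0, 1, - 1 :: 'a}"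
      and eq: "f b + x = f c + y"
    have "x \<in> \<int>" "y \<in> \<int>" using x by auto
    then have "y - x \<in> \<int>" by simp
    moreover have "f b - f c = y - x" using eq by (simp add: algebra_simps)
    ultimately have "b = c" using inj[OF b] by metis
    then show "b = c \<and> x = y" using eq by simp
  qed
  then show ?thesis using assms by (simp add: card_image card_cartesian_product)
qed

lemma split_sum_swap_one_type:
  assumes fin: "finite K" "k \<notin> K" and ne: "K \<noteq> {}" and mono: "\<And>c. c \<in> K \<Longrightarrow> isx c = isx k"
    and gen: "int_indep (insert k K) z"
    and IH: "\<And>b. b \<in> K \<Longrightarrow> split_sum p1 p2 (K - {b}) z = split_sum p2 p1 (K - {b}) z"
  shows "split_sum p1 p2 (insert k K) z = split_sum p2 p1 (insert k K) z"
proof -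
  have dK: "z b - z c \<notin> \<int>" if "b \<in> insert k K" "c \<in> insert k K" "b \<noteq> c" for b c
    using int_indep_diff[OF gen] fin that by auto
  \<comment> \<open>of degree less than \<open>3 * card K\<close>, with \<open>3 * card K\<close> roots\<close>
  have "cleared_sum_poly p1 p2 K k z - cleared_sum_poly p2 p1 K k z = 0"
  proof (rule poly_eq_0_by_roots)
    show "coeff (cleared_sum_poly p1 p2 K k z - cleared_sum_poly p2 p1 K k z) i = 0" if "i \<ge> 3 *
      card K" for i
      using that coeff_cleared_sum_one_type[OF fin(1) ne mono] by simp
    show "card ((\<lambda>(b, x). z b + x) ` (K \<times> {0, 1, - 1 :: 'a})) = 3 * card K"
      using fin dK by (intro card_poles) auto
    show "poly (cleared_sum_poly p1 p2 K k z - cleared_sum_poly p2 p1 K k z) y = 0"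
      if "y \<in> (\<lambda>(b, x). z b + x) ` (K \<times> {0, 1, - 1 :: 'a})" for y
    proof -
      from that obtain b x where b: "b \<in> K" and y: "y \<in> {z b, z b + 1, z b - 1}" by auto
      have "cleared_sum p1 p2 (insert b (K - {b})) k y z =
        cleared_sum p2 p1 (insert b (K - {b})) k y z"
        using fin b y dK by (intro cleared_sum_swap_at_pole IH) (auto simp: mono)
      then show ?thesis using b by (simp add: poly_cleared_sum_poly insert_absorb)
    qed
  qed (use fin in auto)
  then have "cleared_sum p1 p2 K k (z k) z = cleared_sum p2 p1 K k (z k) z"
    by (metis poly_cleared_sum_poly eq_iff_diff_eq_0)
  moreover have q: "denom_factor k c (z k - z c) \<noteq> 0" if "c \<in> K" for c
    using dK fin that by (intro denom_factor_nonzero) auto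
  ultimately show ?thesis using fin by (auto simp: cleared_sum_split_sum)
qed

end

context two_coloured
begin

text \<open>
  The two running variables are \<open>z k + L\<close> and \<open>z l + L\<close>, and these are polynomials in \<open>L\<close>; the
  sides of \<open>k\<close> and \<open>l\<close> are \<open>s\<close> and \<open>t\<close>.
\<close>
definition pair_term_poly where
  "pair_term_poly p1 p2 K k l z I s t = side_factor_poly p1 p2 s k (z k) *
    side_factor_poly p1 p2 t l (z l) *
     (\<Prod>c\<in>K. cleared_factor_poly k s c (c \<in> I) (z k - z c) *
       cleared_factor_poly l t c (c \<in> I) (z l - z c))"

definition pair_sum_poly where
  "pair_sum_poly p1 p2 K k l z = (\<Sum>I\<in>Pow K. \<Sum>s\<in>UNIV. \<Sum>t\<in>UNIV.
     smult (of_bool (admissible p1 p2 (imbalance K I + side_charge l t + side_charge k s)) *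
       pair_factor k s l t (z k - z l) * split_term p1 p2 K z I)
       (pair_term_poly p1 p2 K k l z I s t))"

lemma pair_sum_poly_commute: "pair_sum_poly p1 p2 K k l z = pair_sum_poly p1 p2 K l k z"
  unfolding pair_sum_poly_def
proof (rule sum.cong[OF refl])
  fix I
  have f: "pair_factor k s l t (z k - z l) = pair_factor l t k s (z l - z k)" for s t
    by (auto simp: pair_factor_def)
  have G: "pair_term_poly p1 p2 K k l z I s t = pair_term_poly p1 p2 K l k z I t s" for s t
    unfolding pair_term_poly_def by (simp only: mult_ac)
  show "(\<Sum>s\<in>UNIV. \<Sum>t\<in>UNIV. smult (of_bool (admissible p1 p2 (imbalance K I + side_charge l t +
    side_charge k s)) *
      pair_factor k s l t (z k - z l) * split_term p1 p2 K z I) (pair_term_poly p1 p2 K k l z I s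
        t)) =
    (\<Sum>s\<in>UNIV. \<Sum>t\<in>UNIV. smult (of_bool (admissible p1 p2 (imbalance K I + side_charge k t +
      side_charge l s)) *
      pair_factor l s k t (z l - z k) * split_term p1 p2 K z I) (pair_term_poly p1 p2 K l k z I s
        t))"
    by (subst sum.swap) (simp only: f G add_ac)
qed

lemma poly_pair_sum_poly:
  assumes fin: "finite K" and kl: "k \<notin> K" "l \<notin> K" "k \<noteq> l" "isx k \<noteq> isx l"
    and q: "\<And>c. c \<in> K \<Longrightarrow> denom_factor l c (y + z l - z c) \<noteq> 0"
  shows "poly (pair_sum_poly p1 p2 K k l z) y =
    (\<Prod>c\<in>K. denom_factor l c (y + z l - z c)) * cleared_sum p1 p2 (insert l K) k (y + z k) (z(l :=
      y + z l))"
proof -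
  let ?z = "z(l := y + z l)"
  have z: "?z c = z c" and "c \<noteq> l" if "c \<in> K" for c using that kl by auto
  have T: "split_term p1 p2 K ?z I = split_term p1 p2 K z I"
    for I by (rule split_term_cong) (rule z)
  have m: "cleared_factor k s l t (y + z k - (y + z l)) = pair_factor k s l t (z k - z l)" for s t
    using cleared_factor_pair_factor[of k l "z k - z l" s t] kl by (simp add: denom_factor_def)
  have P: "poly (\<Prod>c\<in>K. cleared_factor_poly k s c (c \<in> I) (z k - z c) *
    cleared_factor_poly l t c (c \<in> I) (z l - z c)) y =
     (\<Prod>c\<in>K. denom_factor l c (y + z l - z c)) *
       (\<Prod>c\<in>K. cleared_factor k s c (c \<in> I) (y + z k - ?z c) *
         pair_factor l t c (c \<in> I) (?z l - ?z c))" for I s t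
    unfolding poly_prod prod.distrib[symmetric]
  proof (intro prod.cong refl)
    fix c assume c: "c \<in> K"
    show "poly (cleared_factor_poly k s c (c \<in> I) (z k - z c) *
      cleared_factor_poly l t c (c \<in> I) (z l - z c)) y =
      denom_factor l c (y + z l - z c) * (cleared_factor k s c (c \<in> I) (y + z k - ?z c) *
        pair_factor l t c (c \<in> I) (?z l - ?z c))"
      using cleared_factor_pair_factor[OF q[OF c], of t "c \<in> I"] z[OF c] by (simp del:
        fun_upd_apply add: poly_cleared_factor_poly add_diff_eq fun_upd_same)
  qed
  show ?thesis
    unfolding pair_sum_poly_def cleared_sum_insert[OF fin kl(2)] poly_sum sum_distrib_left
      pair_term_poly_def
    by (intro sum.cong refl) (simp only: poly_smult poly_mult P m T poly_side_factor_poly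
      fun_upd_same mult_ac)
qed

text \<open>
  Each other variable \<open>c\<close> contributes a cubic polynomial in \<open>L\<close> if \<open>k\<close> and \<open>l\<close> lie on the same
  side. Its second coefficient depends on the side of \<open>c\<close> only through its charge; these
  corrections add up to the total charge of one side, and those for the two choices of a
  common side of \<open>k\<close> and \<open>l\<close> to the total charge of all other variables.
\<close>
lemma top_coeffs_pair_cubic:
  assumes "isx k" "\<not> isx l"
  shows "top_coeffs (cleared_factor_poly k s c sc (u - w) *
    cleared_factor_poly l s c sc (v - w)) 3 (- 1)
    (- (3 * ((if isx c then u else v) - w) - (if s = sc then 0 else 2 * of_int (unit_charge c) *
      (u - v))))"
proof -
  let ?p = "cleared_factor_poly k s c sc (u - w)" and ?q = "cleared_factor_poly l s c sc (v - w)"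
  have "degree (?p * ?q) \<le> 3"
    using degree_mult_le[of ?p ?q] degree_cleared_factor_poly[of k s c sc "u - w"]
      degree_cleared_factor_poly[of l s c sc "v - w"] assms
    by (auto split: if_splits)
  then show ?thesis unfolding top_coeffs_def
    by (cases s; cases sc; cases "isx c")
       (use assms in \<open>simp_all add: cleared_factor_poly_1 cleared_factor_poly_2
         cleared_factor_poly_3 cleared_factor_poly_4 unit_charge_def numeral_3_eq_3\<close>)
qed

lemma top_coeffs_same_side:
  assumes "finite K" "isx k" "\<not> isx l"
  shows "top_coeffs (pair_term_poly p1 p2 K k l z I s s) (1 + 3 *
    card K) ((- 1) ^ card K) ((- 1) ^ card K *
    ((\<Sum>c\<in>K. 3 * ((if isx c then z k else z l) - z c) -
        (if s = (c \<in> I) then 0 else 2 * of_int (unit_charge c) * (z k - z l))) +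
     (snd (if s then p2 else p1) + (if fst (if s then p2 else p1) then z k else z l) - of_bool s)))"
    (is "top_coeffs _ _ _ (?sg * (?B + ?E))")
proof -
  have 1: "top_coeffs (side_factor_poly p1 p2 s k (z k) * side_factor_poly p1 p2 s l (z l)) 1 1 ?E"
    using assms by (auto simp: side_factor_poly_def keep_factor_poly_def top_coeffs_def)
  have 2: "top_coeffs (\<Prod>c\<in>K. cleared_factor_poly k s c (c \<in> I) (z k - z c) *
    cleared_factor_poly l s c (c \<in> I) (z l - z c)) (3 * card K)
     ((- 1) ^ card K) ((- 1) ^ card K * ?B)"
    by (rule top_coeffs_prod_cubics[OF assms(1)]) (rule top_coeffs_pair_cubic[OF assms(2,3)])
  show ?thesis using top_coeffs_mult[OF 1 2] unfolding pair_term_poly_def by (simp add: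
    algebra_simps)
qed

text \<open>
  If \<open>k\<close> and \<open>l\<close> lie on different sides, the degree depends on the imbalance of the charges of
  the other variables, which is shifted by \<open>2\<close> against the one that is bounded.
\<close>
lemma coeff_opposite_sides:
  assumes "finite K" "isx k" "\<not> isx l" "s \<noteq> t" "I \<subseteq> K" "i \<ge> 3 * card K"
    and al: "admissible p1 p2 (imbalance K I + side_charge l t + side_charge k s)"
  shows "coeff (pair_term_poly p1 p2 K k l z I s t) i = 0"
proof -
  define D where "D c = (if ((c \<in> I) = isx c) = s then 5 else 1 :: nat)" for c
  define h :: int where "h = (if s then 1 else - 1)"
  have "degree (\<Prod>c\<in>K. cleared_factor_poly k s c (c \<in> I) (z k - z c) *
    cleared_factor_poly l t c (c \<in> I) (z l - z c)) \<le>
     (\<Sum>c\<in>K. degree (cleared_factor_poly k s c (c \<in> I) (z k - z c) *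
       cleared_factor_poly l t c (c \<in> I) (z l - z c)))"
    using degree_prod_sum_le[OF assms(1)] by (simp add: o_def)
  also have "\<dots> \<le> (\<Sum>c\<in>K. D c)"
  proof (rule sum_mono)
    fix c
    show "degree (cleared_factor_poly k s c (c \<in> I) (z k - z c) *
      cleared_factor_poly l t c (c \<in> I) (z l - z c)) \<le> D c"
      using degree_mult_le[of "cleared_factor_poly k s c (c \<in> I) (z k - z c)" "cleared_factor_poly
        l t c (c \<in> I) (z l - z c)"]
        degree_cleared_factor_poly[of k s c "c \<in> I" "z k - z c"] degree_cleared_factor_poly[of l t
          c "c \<in> I" "z l - z c"] assms(2-4)
      unfolding D_def by (cases s; cases "isx c"; cases "c \<in> I") auto
  qed
  finally have 1: "degree (\<Prod>c\<in>K. cleared_factor_poly k s c (c \<in> I) (z k - z c) *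
    cleared_factor_poly l t c (c \<in> I) (z l - z c))
    \<le> (\<Sum>c\<in>K. D c)" .
  have "int (\<Sum>c\<in>K. D c) = (\<Sum>c\<in>K. 3 + 2 * h * (if c \<in> I then unit_charge c else - unit_charge c))"
    unfolding of_nat_sum by (intro sum.cong refl) (auto simp: D_def h_def unit_charge_def)
  also have "\<dots> = 3 * int (card K) + 2 * h * imbalance K I"
    unfolding imbalance_def by (simp add: sum.distrib sum_distrib_left)
  finally have 2: "int (\<Sum>c\<in>K. D c) = 3 * int (card K) + 2 * h * imbalance K I" .
  have "degree (pair_term_poly p1 p2 K k l z I s t) \<le>
    of_bool (isx k = fst (if s then p2 else p1)) + of_bool (isx l = fst (if t then p2 else p1)) +
      (\<Sum>c\<in>K. D c)"
    unfolding pair_term_poly_def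
    by (intro order.trans[OF degree_mult_le] add_mono degree_side_factor_poly 1)
  also have "\<dots> < 3 * card K"
  proof -
    have "int (of_bool (isx k = fst (if s then p2 else p1)) + of_bool (isx l = fst (if t then
      p2 else p1)) + (\<Sum>c\<in>K. D c))
      < int (3 * card K)"
      unfolding of_nat_add 2 using al assms(2-4)
      by (cases s; cases "fst p1"; cases "fst p2") (auto simp: admissible_def side_charge_def
        unit_charge_def h_def)
    then show ?thesis by linarith
  qed
  finally show ?thesis using assms(6) by (simp add: coeff_eq_0)
qed

end

context two_coloured
begin
text \<open>
  The expansion at infinity up to the second order. Both top coefficients are the sum for the
  remaining variables times an expression symmetric in the two operators.
\<close>
lemma coeff_pair_sum_poly:
  assumes "finite K" "isx k" "\<not> isx l" "i \<ge> 3 * card K"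
  shows "coeff (pair_sum_poly p1 p2 K k l z) i = split_sum p1 p2 K z *
    (if i = 3 * card K then (- 1) ^ card K *
       ((\<Sum>c\<in>K. 6 * ((if isx c then z k else z l) - z c) - 2 * of_int (unit_charge c) * (z k - z l))
         + (snd p1 + snd p2 + (if fst p1 then z k else z l) + (if fst p2 then z k else z l) - 1))
     else if i = Suc (3 * card K) then 2 * (- 1) ^ card K else 0)" (is "_ = _ * ?C")
proof -
  have *: "(\<Sum>s\<in>UNIV. \<Sum>t\<in>UNIV. coeff (smult (of_bool (admissible p1 p2 (imbalance K I +
    side_charge l t + side_charge k s)) * pair_factor k s l t (z k - z l) * split_term p1 p2 K z I)
       (pair_term_poly p1 p2 K k l z I s t)) i) = of_bool (admissible p1 p2 (imbalance K I)) *
         split_term p1 p2 K z I * ?C" if I: "I \<in> Pow K" for I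
  proof -
    let ?B = "\<lambda>s. \<Sum>c\<in>K. 3 * ((if isx c then z k else z l) - z c) -
        (if s = (c \<in> I) then 0 else 2 * of_int (unit_charge c) * (z k - z l))"
    have mixed: "of_bool (admissible p1 p2 (imbalance K I + side_charge l t + side_charge k s)) *
      coeff (pair_term_poly p1 p2 K k l z I s t) i = 0"
      if "s \<noteq> t" for s t
      using coeff_opposite_sides[OF assms(1-3) that _ assms(4)] I by auto
    have B: "?B True + ?B False =
      (\<Sum>c\<in>K. 6 * ((if isx c then z k else z l) - z c) - 2 * of_int (unit_charge c) * (z k - z l))"
      unfolding sum.distrib[symmetric] by (intro sum.cong refl) auto
    have t2D: "coeff p i = (if i = n then b else if i = Suc n then a else 0)"
      if "top_coeffs p (1 + n) a b" "i \<ge> n" for p :: "'a poly" and n a b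
      using that by (auto simp: top_coeffs_def coeff_eq_0)
    have combine: "(if X then S * (a + ea) else if Y then S else 0) +
        (if X then S * (b + eb) else if Y then S else 0) =
        (if X then S * (ab + ee) else if Y then 2 * S else 0)"
      if "a + b = ab" "ea + eb = ee" for X Y and S a b ab ea eb ee :: 'a
      unfolding that[symmetric] by (simp add: algebra_simps)
    have "coeff (pair_term_poly p1 p2 K k l z I True True) i +
      coeff (pair_term_poly p1 p2 K k l z I False False) i = ?C"
      unfolding t2D[OF top_coeffs_same_side[OF assms(1-3)] assms(4)]
      by (rule combine[OF B]) simp
    note tot = this
    have tt: "coeff (smult (of_bool (admissible p1 p2 (imbalance K I + side_charge l s +
      side_charge k s)) * pair_factor k s l s (z k - z l) *
        split_term p1 p2 K z I) (pair_term_poly p1 p2 K k l z I s s)) i =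
      of_bool (admissible p1 p2 (imbalance K I)) * split_term p1 p2 K z I *
        coeff (pair_term_poly p1 p2 K k l z I s s) i" for s
    proof -
      have "imbalance K I + side_charge l s + side_charge k s = imbalance K I"
        using assms by (simp add: side_charge_def unit_charge_def)
      then show ?thesis by (simp only: coeff_smult pair_factor_def simp_thms if_True mult_1_right)
    qed
    have tf: "coeff (smult (of_bool (admissible p1 p2 (imbalance K I + side_charge l t +
      side_charge k s)) * pair_factor k s l t (z k - z l) *
        split_term p1 p2 K z I) (pair_term_poly p1 p2 K k l z I s t)) i = 0" if "s \<noteq> t" for s t
      using mixed[OF that] by auto
    have tf': "True \<noteq> False" "False \<noteq> True" by simp_all
    show ?thesis
      by (simp only: sum_bool tt tf[OF tf'(1)] tf[OF tf'(2)] add_0_left add_0_right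
          distrib_left[symmetric] tot)
  qed
  show ?thesis unfolding pair_sum_poly_def split_sum_def coeff_sum sum_distrib_right
    by (intro sum.cong refl *)
qed

end
context two_coloured
begin
lemma int_indep_move:
  assumes gen: "int_indep (insert k (insert l K)) z" and K: "finite K" "k \<notin> K" "l \<notin> K" "k \<noteq> l"
    "b \<in> K"
    and x: "x \<in> \<int>"
  shows "int_indep (insert l (K - {b})) (z(l := z b + x - z k + z l))"
  unfolding int_indep_def
proof (intro allI impI)
  fix m :: "nat \<Rightarrow> int"
  let ?z = "z(l := z b + x - z k + z l)"
  assume m: "(\<Sum>a\<in>insert l (K - {b}). of_int (m a) * ?z a) \<in> \<int>"
  \<comment> \<open>the relation between the moved values, rewritten in the original ones\<close>
  define m' where "m' a = (if a = b then m l else if a = k then - m l else m a)" for a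
  have b: "b \<noteq> k" "b \<noteq> l" using K by auto
  have eq: "(\<Sum>a\<in>K - {b}. of_int (m a) * ?z a) = (\<Sum>a\<in>K - {b}. of_int (m' a) * z a)"
    using K by (intro sum.cong refl) (auto simp: m'_def)
  have "(\<Sum>a\<in>insert k (insert l K). of_int (m' a) * z a) =
      of_int (m l) * (z b - z k + z l) + (\<Sum>a\<in>K - {b}. of_int (m' a) * z a)"
    using K b by (simp add: sum.remove[of K b] m'_def algebra_simps)
  also have "\<dots> = (\<Sum>a\<in>insert l (K - {b}). of_int (m a) * ?z a) - of_int (m l) * x"
  proof -
    have "(\<Sum>a\<in>insert l (K - {b}). of_int (m a) * ?z a) =
        of_int (m l) * ?z l + (\<Sum>a\<in>K - {b}. of_int (m a) * ?z a)"
      using K by (intro sum.insert) auto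
    then show ?thesis unfolding eq by (simp add: algebra_simps)
  qed
  also have "\<dots> \<in> \<int>" using m x by auto
  finally have m0: "m' a = 0" if "a \<in> insert k (insert l K)" for a
    using int_indepD[OF gen] that by blast
  have "m l = 0" using m0[of k] b by (simp add: m'_def)
  moreover have "m a = 0" if "a \<in> K - {b}" for a
  proof -
    have "a \<noteq> b" "a \<noteq> k" using that K by auto
    then show ?thesis using m0[of a] that by (simp add: m'_def)
  qed
  ultimately show "\<forall>a\<in>insert l (K - {b}). m a = 0" by blast
qed

text \<open>
  At a pole for \<open>k\<close> the other running variable \<open>l\<close> has a definite value, and the one-variable
  result \<open>cleared_sum_swap_at_pole\<close> applies to \<open>k\<close>, with \<open>l\<close> among the fixed variables.
\<close>
lemma pair_sum_swap_at_pole: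
  assumes gen: "int_indep (insert k (insert l K)) z"
    and K: "finite K" "k \<notin> K" "l \<notin> K" "k \<noteq> l" "b \<in> K" "isx k \<noteq> isx l" "isx b = isx k"
    and x: "x \<in> {0, 1, - 1}"
    and IH: "\<And>z. int_indep (insert l (K - {b})) z \<Longrightarrow>
       split_sum p1 p2 (insert l (K - {b})) z = split_sum p2 p1 (insert l (K - {b})) z"
  shows "poly (pair_sum_poly p1 p2 K k l z) (z b + x - z k) =
    poly (pair_sum_poly p2 p1 K k l z) (z b + x - z k)"
proof -
  let ?y = "z b + x - z k"
  let ?z = "z(l := ?y + z l)"
  have xZ: "x \<in> \<int>" using x by auto
  have q: "denom_factor l c (?y + z l - z c) \<noteq> 0" if c: "c \<in> K" for c
  proof (rule denom_factor_nonzero)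
    assume "isx l = isx c"
    then have "b \<noteq> c" using K by auto
    then have "z b - z c - z k + z l \<notin> \<int>"
      using K c by (intro int_indep_diff4[OF gen]) auto
    moreover have "?y + z l - z c = (z b - z c - z k + z l) + x" by simp
    ultimately show "?y + z l - z c \<notin> \<int>" using Ints_diff[OF _ xZ] by (metis add_diff_cancel)
  qed
  have ins: "insert l K = insert b (insert l (K - {b}))" using K by auto
  have "cleared_sum p1 p2 (insert l K) k (?y + z k) ?z = cleared_sum p2 p1 (insert l K) k (?y +
    z k) ?z"
    unfolding ins
  proof (rule cleared_sum_swap_at_pole)
    show "split_sum p1 p2 (insert l (K - {b})) ?z = split_sum p2 p1 (insert l (K - {b})) ?z"
      using int_indep_move[OF gen K(1-5) xZ] by (intro IH) simp
    show "?y + z k \<in> {?z b, ?z b + 1, ?z b - 1}" using x K by auto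
    show "?z b - ?z c \<notin> \<int>" if "c \<in> insert l (K - {b})" "isx b = isx c" for c
      using int_indep_diff[OF gen, of b c] that K by auto
  qed (use K in auto)
  moreover have "poly (pair_sum_poly a a' K k l z) ?y =
    (\<Prod>c\<in>K. denom_factor l c (?y + z l - z c)) * cleared_sum a a' (insert l K) k (?y + z k) ?z"
      for a a'
    by (rule poly_pair_sum_poly[OF K(1-4) K(6)]) (rule q)
  ultimately show ?thesis by simp
qed

lemma split_sum_swap_two_types:
  assumes gen: "int_indep (insert k (insert l K)) z"
    and K: "finite K" "k \<notin> K" "l \<notin> K" and kl: "isx k" "\<not> isx l"
    and IH: "\<And>K' z'. finite K' \<Longrightarrow> card K' < card K + 2 \<Longrightarrow> int_indep K' z' \<Longrightarrow> split_sum p1 p2 K' z' =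
      split_sum p2 p1 K' z'"
  shows "split_sum p1 p2 (insert k (insert l K)) z = split_sum p2 p1 (insert k (insert l K)) z"
proof -
  let ?K = "insert k (insert l K)"
  have ne: "k \<noteq> l" using kl by auto
  \<comment> \<open>the running variable of the kind of \<open>b\<close> meets \<open>b\<close> at \<open>L = f b\<close>\<close>
  define f where "f b = z b - z (if isx b then k else l)" for b
  have "pair_sum_poly p1 p2 K k l z - pair_sum_poly p2 p1 K k l z = 0"
  proof (rule poly_eq_0_by_roots)
    have "int_indep K z" using gen K by (intro int_indep_subset[OF gen]) auto
    then have P: "split_sum p1 p2 K z = split_sum p2 p1 K z" using K by (intro IH) auto
    show "coeff (pair_sum_poly p1 p2 K k l z - pair_sum_poly p2 p1 K k l z) i = 0" if "i \<ge> 3 *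
      card K" for i
      unfolding coeff_diff coeff_pair_sum_poly[OF K(1) kl that] P by (simp add: algebra_simps)
    show "card ((\<lambda>(b, x). f b + x) ` (K \<times> {0, 1, - 1 :: 'a})) = 3 * card K"
    proof (rule card_poles[OF K(1)])
      fix b c assume "b \<in> K" "c \<in> K" "b \<noteq> c"
      then have "z b - z c - z (if isx b then k else l) + z (if isx c then k else l) \<notin> \<int>"
        using K by (intro int_indep_diff4[OF gen]) auto
      then show "f b - f c \<notin> \<int>" by (simp add: f_def algebra_simps)
    qed
    show "poly (pair_sum_poly p1 p2 K k l z - pair_sum_poly p2 p1 K k l z) y = 0"
      if "y \<in> (\<lambda>(b, x). f b + x) ` (K \<times> {0, 1, - 1 :: 'a})" for y
    proof -
      from that obtain b x where b: "b \<in> K" and x: "x \<in> {0, 1, - 1}" and y: "y = f b + x"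
        by (auto simp del: insert_iff)
      have c: "card (insert m (K - {b})) < card K + 2" for m
        using card_insert_le_m1[of "card K + 1" "K - {b}" m] card_Diff1_le[of K b] by simp
      show ?thesis
      proof (cases "isx b")
        case True
        have "poly (pair_sum_poly p1 p2 K k l z) (z b + x - z k) =
          poly (pair_sum_poly p2 p1 K k l z) (z b + x - z k)"
          using K kl ne b x c True by (intro pair_sum_swap_at_pole[OF gen] IH) auto
        then show ?thesis using True by (simp add: y f_def algebra_simps)
      next
        case False
        have gen': "int_indep (insert l (insert k K)) z" using gen by (simp add: insert_commute)
        have "poly (pair_sum_poly p1 p2 K l k z) (z b + x - z l) =
          poly (pair_sum_poly p2 p1 K l k z) (z b + x - z l)"
          using K kl ne b x c False by (intro pair_sum_swap_at_pole[OF gen'] IH) auto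
        then show ?thesis using False by (simp add: y f_def algebra_simps pair_sum_poly_commute[of
          _ _ _ l k])
      qed
    qed
  qed (use K in auto)
  then have eq: "poly (pair_sum_poly p1 p2 K k l z) 0 = poly (pair_sum_poly p2 p1 K k l z) 0"
    by simp
  have d: "z b - z c \<notin> \<int>" if "b \<in> ?K" "c \<in> ?K" "b \<noteq> c" for b c
    using int_indep_diff[OF gen] K that by auto
  have ql: "denom_factor l c (0 + z l - z c) \<noteq> 0" if "c \<in> K" for c
    using d K that by (intro denom_factor_nonzero) auto
  have qk: "denom_factor k c (z k - z c) \<noteq> 0" if "c \<in> insert l K" for c
    using d K ne that by (intro denom_factor_nonzero) auto
  have "poly (pair_sum_poly p p' K k l z) 0 = (\<Prod>c\<in>K. denom_factor l c (0 + z l - z c)) *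
      ((\<Prod>c\<in>insert l K. denom_factor k c (z k - z c)) * split_sum p p' ?K z)" for p p'
    using poly_pair_sum_poly[OF K(1,2,3) ne _ ql, of p p'] cleared_sum_split_sum[of "insert l K" k
      z p p'] K kl ne qk
    by (simp add: fun_upd_idem)
  moreover have "(\<Prod>c\<in>K. denom_factor l c (0 + z l - z c)) \<noteq> 0"
    "(\<Prod>c\<in>insert l K. denom_factor k c (z k - z c)) \<noteq> 0"
    using K ql qk by (auto simp del: prod.insert)
  ultimately show ?thesis using eq by simp
qed

theorem split_sum_swap:
  assumes "finite K" "int_indep K z"
  shows "split_sum p1 p2 K z = split_sum p2 p1 K z"
  using assms
proof (induction "card K" arbitrary: K z rule: less_induct)
  case less
  show ?case
  proof (cases "\<exists>k\<in>K. \<exists>l\<in>K. isx k \<and> \<not> isx l")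
    case True
    then obtain k l where kl: "k \<in> K" "l \<in> K" "isx k" "\<not> isx l" by blast
    then have ne: "k \<noteq> l" by auto
    define K0 where "K0 = K - {k, l}"
    have K: "K = insert k (insert l K0)" "finite K0" "k \<notin> K0" "l \<notin> K0"
      using kl less.prems by (auto simp: K0_def)
    have cK: "card K = card K0 + 2" unfolding K(1) using K(2-4) ne by simp
    show ?thesis unfolding K(1)
    proof (rule split_sum_swap_two_types[OF _ K(2-4) kl(3,4)])
      show "int_indep (insert k (insert l K0)) z" using less.prems(2) unfolding K(1) .
      show "split_sum p1 p2 K' z' = split_sum p2 p1 K' z'"
        if "finite K'" "card K' < card K0 + 2" "int_indep K' z'" for K' z'
        by (rule less.hyps) (use that cK in auto)
    qed
  next
    case False
    show ?thesis
    proof (cases "K = {}")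
      case True
      then show ?thesis by (simp add: split_sum_def imbalance_def split_term_def cross_prod_def
        admissible_def)
    next
      case ne: False
      then obtain k where k: "k \<in> K" by blast
      define K0 where "K0 = K - {k}"
      have K: "K = insert k K0" "finite K0" "k \<notin> K0"
        using k less.prems by (auto simp: K0_def)
      show ?thesis
      proof (cases "K0 = {}")
        case True
        then have K1: "K = {k}" using K(1) by simp
        show ?thesis unfolding K1
          by (simp add: split_sum_insert sum_bool) (auto simp: imbalance_def split_term_def
            cross_prod_def admissible_def side_charge_def unit_charge_def side_factor_def
            keep_factor_def)
      next
        case ne: False
        have cK: "card K = Suc (card K0)" unfolding K(1) using K(2,3) by simp
        show ?thesis unfolding K(1)
        proof (rule split_sum_swap_one_type[OF K(2,3) ne])
          show "int_indep (insert k K0) z" using less.prems(2) unfolding K(1) .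
          show "isx c = isx k" if "c \<in> K0" for c
            using False k that unfolding K0_def by blast
          show "split_sum p1 p2 (K0 - {b}) z = split_sum p2 p1 (K0 - {b}) z" if b: "b \<in> K0" for b
          proof (rule less.hyps)
            show "card (K0 - {b}) < card K" using cK card_Diff1_le[of K0 b] by simp
            show "int_indep (K0 - {b}) z"
              by (rule int_indep_subset[OF less.prems(2)]) (use less.prems in \<open>auto simp: K0_def\<close>)
          qed (use K in simp)
        qed
      qed
    qed
  qed
qed

end

section \<open>Coefficients of products of two operators\<close>

context two_coloured
begin

definition charge :: "nat set \<Rightarrow> int" where "charge I = (\<Sum>a\<in>I. unit_charge a)"

definition move_factor :: "nat \<Rightarrow> nat \<Rightarrow> 'a \<Rightarrow> 'a" where
  "move_factor a b d = (if isx a = isx b then inverse (- d) else r - d)"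

text \<open>
  The coefficient of \<open>\<Prod>\<^bsub>a \<in> I\<^esub> T\<^sub>a\<close> in an operator of type \<open>p\<close>. The weights \<open>w\<close> of the moved
  variables and the sign \<open>\<epsilon>\<close> of the terms of charge \<open>1\<close> stay arbitrary, since they contribute
  the same to both orders of a product.
\<close>
definition op_coeff :: "(nat \<Rightarrow> 'a \<Rightarrow> 'a) \<Rightarrow> 'a \<Rightarrow> nat set \<Rightarrow> bool \<times> 'a \<Rightarrow> nat set \<Rightarrow> (nat \<Rightarrow> 'a) \<Rightarrow> 'a"
  where
  "op_coeff w \<epsilon> V p I z = of_bool (0 \<le> charge I \<and> charge I \<le> of_bool (fst p)) * \<epsilon> ^ nat (charge I) *
     (\<Prod>a\<in>V. if a \<in> I then w a (z a) else keep_factor p a (z a)) *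
     (\<Prod>(a, b)\<in>V \<times> V. if a \<in> I \<and> b \<notin> I then move_factor a b (z a - z b) else 1)"

text \<open>
  The part of a coefficient of a product that does not depend on the splitting: \<open>M\<close> is moved
  by both operators, \<open>K\<close> by exactly one. A variable of \<open>M\<close> meets each variable of \<open>K\<close> once as
  a moved one, and in both cases at the same distance.
\<close>
definition overlap_factor :: "(nat \<Rightarrow> 'a \<Rightarrow> 'a) \<Rightarrow> 'a \<Rightarrow> nat set \<Rightarrow> bool \<times> 'a \<Rightarrow> bool \<times> 'a \<Rightarrow> nat set \<Rightarrow>
  nat set \<Rightarrow> (nat \<Rightarrow> 'a) \<Rightarrow> 'a" where
  "overlap_factor w \<epsilon> V p1 p2 M K z =
     of_bool (0 \<le> 2 * charge M + charge K \<and> 2 * charge M + charge K \<le> of_bool (fst p1) +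
       of_bool (fst p2)) *
     \<epsilon> ^ nat (2 * charge M + charge K) *
     (\<Prod>a\<in>V. if a \<in> M then w a (z a) * w a (z a - 1) else if a \<in> K then w a (z a)
        else keep_factor p1 a (z a) * keep_factor p2 a (z a)) *
     (\<Prod>(a, b)\<in>V \<times> V. if a \<in> M \<and> b \<in> K then move_factor a b (z a - z b)
        else if a \<in> M \<and> b \<notin> M then move_factor a b (z a - z b) * move_factor a b (z a - z b - 1)
        else if a \<in> K \<and> b \<notin> K \<and> b \<notin> M then move_factor a b (z a - z b) else 1)"

lemma overlap_factor_commute: "overlap_factor w \<epsilon> V p1 p2 M K z = overlap_factor w \<epsilon> V p2 p1 M K z"
  unfolding overlap_factor_def by (simp only: mult.commute[of "keep_factor p1 _ _"] add.commute[of
    "of_bool (fst p1)"])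

text \<open>
  Transposing the pairs within \<open>K\<close> makes the factors from the first operator for \<open>(a, b)\<close>
  stand next to those from the second one for \<open>(b, a)\<close>.
\<close>
lemma prod_swap_on:
  fixes X :: "nat \<Rightarrow> nat \<Rightarrow> 'b::comm_monoid_mult"
  assumes "K \<subseteq> V"
  shows "(\<Prod>(a, b)\<in>V \<times> V. X a b) = (\<Prod>(a, b)\<in>V \<times> V. if a \<in> K \<and> b \<in> K then X b a else X a b)"
  by (rule prod.reindex_bij_witness[of _ "\<lambda>(a, b). if a \<in> K \<and> b \<in> K then (b, a) else (a, b)"
        "\<lambda>(a, b). if a \<in> K \<and> b \<in> K then (b, a) else (a, b)"])
     (use assms in \<open>auto split: if_splits\<close>)

lemma cross_prod_alt:
  assumes "finite V" "K \<subseteq> V"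
  shows "cross_prod K z I = (\<Prod>(a, b)\<in>V \<times> V. if a \<in> K \<and> b \<in> K \<and> a \<in> I \<and> b \<notin> I then
    cross a b (z a - z b) else 1)"
proof -
  have "cross_prod K z I = (\<Prod>(a, b)\<in>K \<times> K. if a \<in> I \<and> b \<notin> I then cross a b (z a - z b) else 1)"
    unfolding cross_prod_def by (simp add: prod.cartesian_product)
  also have "\<dots> = (\<Prod>(a, b)\<in>V \<times> V. if a \<in> K \<and> b \<in> K \<and> a \<in> I \<and> b \<notin> I then
    cross a b (z a - z b) else 1)"
    using assms by (intro prod.mono_neutral_cong_left) (auto split: if_splits)
  finally show ?thesis .
qed

lemma move_factor_cross: "move_factor a b d * move_factor b a (1 - d) = cross a b d"
proof -
  have "inverse (- d) * inverse (- (1 - d)) = inverse (quad d)"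
    unfolding quad_def inverse_mult_distrib inverse_minus_eq by simp
  then show ?thesis by (auto simp: move_factor_def cross_def) (simp_all add: quad_def algebra_simps)
qed

lemma charge_Un: "finite I \<Longrightarrow> finite J \<Longrightarrow> I \<inter> J = {} \<Longrightarrow> charge (I \<union> J) = charge I + charge J"
  by (simp add: charge_def sum.union_disjoint)

lemma imbalance_charge:
  assumes "finite K" "I \<subseteq> K"
  shows "imbalance K I = charge I - charge (K - I)"
proof -
  have "imbalance K I = (\<Sum>a\<in>K \<inter> {a. a \<in> I}. unit_charge a) + (\<Sum>a\<in>K \<inter> - {a. a \<in> I}. - unit_charge a)"
    unfolding imbalance_def using assms by (intro sum.If_cases)
  also have "K \<inter> {a. a \<in> I} = I" using assms by auto
  also have "K \<inter> - {a. a \<in> I} = K - I" by auto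
  finally show ?thesis by (simp add: charge_def sum_negf)
qed

text \<open>
  The coefficient of one term in a product of two operators. The value of \<open>z\<close> in the second
  factor is shifted by the first operator.
\<close>
lemma op_coeff_mult:
  assumes V: "finite V" "M \<subseteq> V" "K \<subseteq> V" "M \<inter> K = {}" "S \<subseteq> K"
  shows "op_coeff w \<epsilon> V p1 (M \<union> S) z * op_coeff w \<epsilon> V p2 (M \<union> (K - S)) (\<lambda>a. z a - of_bool (a \<in> M \<union>
    S)) =
    overlap_factor w \<epsilon> V p1 p2 M K z * (of_bool (admissible p1 p2 (imbalance K S)) *
      split_term p1 p2 K z S)"
proof -
  define I J where "I = M \<union> S" and "J = M \<union> (K - S)"
  define z' where "z' a = z a - of_bool (a \<in> I)" for a
  have fin: "finite M" "finite K" "finite S"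
    using finite_subset[OF V(2,1)] finite_subset[OF V(3,1)] finite_subset[OF V(5)] by auto
  have chI: "charge I = charge M + charge S" unfolding I_def using fin V by (intro charge_Un) auto
  have chJ: "charge J = charge M + charge (K - S)" unfolding J_def using fin V by (intro
    charge_Un) auto
  have "charge (S \<union> (K - S)) = charge S + charge (K - S)" using fin by (intro charge_Un) auto
  then have chK: "charge K = charge S + charge (K - S)" using V by (simp add: Un_absorb1)
  have im: "imbalance K S = charge I - charge J" using imbalance_charge[OF fin(2) V(5)] chI chJ by
    simp
  have tot: "2 * charge M + charge K = charge I + charge J" using chI chJ chK by simp
  have A: "of_bool (0 \<le> charge I \<and> charge I \<le> of_bool (fst p1)) * \<epsilon> ^ nat (charge I) *
      (of_bool (0 \<le> charge J \<and> charge J \<le> of_bool (fst p2)) * \<epsilon> ^ nat (charge J)) =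
    (of_bool (0 \<le> charge I + charge J \<and> charge I + charge J \<le> of_bool (fst p1) + of_bool (fst p2)) *
       \<epsilon> ^ nat (charge I + charge J)) * of_bool (admissible p1 p2 (charge I - charge J))"
  proof -
    let ?P = "0 \<le> charge I \<and> charge I \<le> of_bool (fst p1)" and ?Q = "0 \<le> charge J \<and>
      charge J \<le> of_bool (fst p2)"
    let ?R = "0 \<le> charge I + charge J \<and> charge I + charge J \<le> of_bool (fst p1) + of_bool (fst p2)"
    have iff: "?P \<and> ?Q \<longleftrightarrow> ?R \<and> admissible p1 p2 (charge I - charge J)"
      by (cases "fst p1"; cases "fst p2") (auto simp: admissible_def)
    show ?thesis
    proof (cases "?P \<and> ?Q")
      case True
      then have "?P" "?Q" "?R" "admissible p1 p2 (charge I - charge J)" using iff by blast+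
      then show ?thesis by (simp add: nat_add_distrib power_add)
    next
      case False
      have z: "of_bool X * u * (of_bool Y * v) = (0 :: 'a)" "of_bool X * u * of_bool Y = (0 :: 'a)"
        if "\<not> (X \<and> Y)" for X Y u v
        using that by auto
      have nR: "\<not> (?R \<and> admissible p1 p2 (charge I - charge J))" using False iff by blast
      show ?thesis unfolding z(1)[OF False] z(2)[OF nR] ..
    qed
  qed
  have B: "(\<Prod>a\<in>V. if a \<in> I then w a (z a) else keep_factor p1 a (z a)) *
      (\<Prod>a\<in>V. if a \<in> J then w a (z' a) else keep_factor p2 a (z' a)) =
    (\<Prod>a\<in>V. if a \<in> M then w a (z a) * w a (z a - 1) else if a \<in> K then w a (z a)
        else keep_factor p1 a (z a) * keep_factor p2 a (z a)) *
          (\<Prod>a\<in>K. side_factor p1 p2 (a \<in> S) a (z a))"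
  proof -
    have W: "(\<Prod>a\<in>K. side_factor p1 p2 (a \<in> S) a (z a)) = (\<Prod>a\<in>V. if a \<in> K then
      side_factor p1 p2 (a \<in> S) a (z a) else 1)"
      using V by (intro prod.mono_neutral_cong_left) auto
    show ?thesis unfolding W prod.distrib[symmetric]
      using V by (intro prod.cong refl) (auto simp: I_def J_def z'_def side_factor_def)
  qed
  have C: "(\<Prod>(a, b)\<in>V \<times> V. if a \<in> I \<and> b \<notin> I then move_factor a b (z a - z b) else 1) *
      (\<Prod>(a, b)\<in>V \<times> V. if a \<in> J \<and> b \<notin> J then move_factor a b (z' a - z' b) else 1) =
    (\<Prod>(a, b)\<in>V \<times> V. if a \<in> M \<and> b \<in> K then move_factor a b (z a - z b)
        else if a \<in> M \<and> b \<notin> M then move_factor a b (z a - z b) * move_factor a b (z a - z b - 1)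
        else if a \<in> K \<and> b \<notin> K \<and> b \<notin> M then move_factor a b (z a - z b) else 1) * cross_prod K z S"
    unfolding cross_prod_alt[OF V(1,3)]
    unfolding prod_swap_on[OF V(3), of "\<lambda>a b. if a \<in> J \<and> b \<notin> J then move_factor a b (z' a - z' b)
      else 1"]
    unfolding prod.distrib[symmetric]
  proof (intro prod.cong refl, clarify)
    fix a b
    have om: "move_factor a b (z a - z b) * move_factor b a (z b - (z a - 1)) =
      cross a b (z a - z b)"
      using move_factor_cross[of a b "z a - z b"] by (simp add: algebra_simps)
    have d: "z a - 1 - (z b - 1) = z a - z b" "z a - 1 - z b = z a - z b - 1" by simp_all
    have "a \<in> M \<Longrightarrow> a \<notin> K \<and> a \<notin> S" "a \<in> S \<Longrightarrow> a \<in> K \<and> a \<notin> M"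
      "b \<in> M \<Longrightarrow> b \<notin> K \<and> b \<notin> S" "b \<in> S \<Longrightarrow> b \<in> K \<and> b \<notin> M" using V by auto
    then show "(if a \<in> I \<and> b \<notin> I then move_factor a b (z a - z b) else 1) *
       (if a \<in> K \<and> b \<in> K then if b \<in> J \<and> a \<notin> J then move_factor b a (z' b - z' a) else 1
        else if a \<in> J \<and> b \<notin> J then move_factor a b (z' a - z' b) else 1) =
       (if a \<in> M \<and> b \<in> K then move_factor a b (z a - z b)
        else if a \<in> M \<and> b \<notin> M then move_factor a b (z a - z b) * move_factor a b (z a - z b - 1)
        else if a \<in> K \<and> b \<notin> K \<and> b \<notin> M then move_factor a b (z a - z b) else 1) *
       (if a \<in> K \<and> b \<in> K \<and> a \<in> S \<and> b \<notin> S then cross a b (z a - z b) else 1)"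
      by (cases "a \<in> M"; cases "a \<in> S"; cases "a \<in> K"; cases "b \<in> M"; cases "b \<in> S"; cases "b \<in> K")
         (simp_all add: I_def J_def z'_def om d)
  qed
  have "op_coeff w \<epsilon> V p1 I z * op_coeff w \<epsilon> V p2 J z' =
    (of_bool (0 \<le> charge I \<and> charge I \<le> of_bool (fst p1)) * \<epsilon> ^ nat (charge I) *
      (of_bool (0 \<le> charge J \<and> charge J \<le> of_bool (fst p2)) * \<epsilon> ^ nat (charge J))) *
    ((\<Prod>a\<in>V. if a \<in> I then w a (z a) else keep_factor p1 a (z a)) *
      (\<Prod>a\<in>V. if a \<in> J then w a (z' a) else keep_factor p2 a (z' a))) *
    ((\<Prod>(a, b)\<in>V \<times> V. if a \<in> I \<and> b \<notin> I then move_factor a b (z a - z b) else 1) *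
      (\<Prod>(a, b)\<in>V \<times> V. if a \<in> J \<and> b \<notin> J then move_factor a b (z' a - z' b) else 1))"
    unfolding op_coeff_def by (simp only: mult_ac)
  also have "\<dots> = overlap_factor w \<epsilon> V p1 p2 M K z * (of_bool (admissible p1 p2 (imbalance K S)) *
    split_term p1 p2 K z S)"
    unfolding A B C overlap_factor_def split_term_def tot im by (simp only: mult_ac)
  finally show ?thesis unfolding I_def J_def z'_def .
qed

lemma sum_op_coeff_mult:
  assumes "finite V" "M \<subseteq> V" "K \<subseteq> V" "M \<inter> K = {}" "int_indep K z"
  shows "(\<Sum>S\<in>Pow K. op_coeff w \<epsilon> V p1 (M \<union> S) z *
        op_coeff w \<epsilon> V p2 (M \<union> (K - S)) (\<lambda>a. z a - of_bool (a \<in> M \<union> S))) =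
    (\<Sum>S\<in>Pow K. op_coeff w \<epsilon> V p2 (M \<union> S) z *
        op_coeff w \<epsilon> V p1 (M \<union> (K - S)) (\<lambda>a. z a - of_bool (a \<in> M \<union> S)))" (is "?l p1 p2 = ?l p2 p1")
proof -
  have "?l p p' = overlap_factor w \<epsilon> V p p' M K z * split_sum p p' K z" for p p'
    unfolding split_sum_def sum_distrib_left by (intro sum.cong refl op_coeff_mult assms(1-4)) auto
  then show ?thesis
    using split_sum_swap[OF finite_subset[OF assms(3,1)] assms(5),
      of p1 p2] overlap_factor_commute[of w \<epsilon> V p1 p2] by simp
qed

end

section \<open>Determinants with two blocks of powers\<close>

definition ndet :: "nat \<Rightarrow> (nat \<Rightarrow> nat \<Rightarrow> 'a::comm_ring_1) \<Rightarrow> 'a" where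
  "ndet n f = det (mat n n (\<lambda>(i, j). f i j))"

lemma ndet_Leibniz: "ndet n f = (\<Sum>p | p permutes {0..<n}. signof p * (\<Prod>i = 0..<n. f i (p i)))"
proof -
  have "ndet n f = (\<Sum>p | p permutes {0..<n}. signof p *
      (\<Prod>i = 0..<n. mat n n (\<lambda>(i, j). f i j) $$ (i, p i)))"
    unfolding ndet_def by (rule det_def') simp
  also have "\<dots> = (\<Sum>p | p permutes {0..<n}. signof p * (\<Prod>i = 0..<n. f i (p i)))"
    by (intro sum.cong refl arg_cong2[of _ _ _ _ "(*)"] prod.cong)
       (use permutes_in_image in fastforce)
  finally show ?thesis .
qed

lemma ndet_cong: "(\<And>i j. i < n \<Longrightarrow> j < n \<Longrightarrow> f i j = h i j) \<Longrightarrow> ndet n f = ndet n h"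
  unfolding ndet_def by (intro arg_cong[of _ _ det] eq_matI) auto

lemma ndet_row_scale: "ndet n (\<lambda>i j. s i * f i j) = (\<Prod>i<n. s i) * ndet n f"
  unfolding ndet_Leibniz sum_distrib_left
  by (intro sum.cong refl) (simp add: prod.distrib lessThan_atLeast0 mult_ac)

lemma ndet_col_permute:
  assumes p: "p permutes {0..<n}"
  shows "ndet n (\<lambda>i j. f i (p j)) = signof p * ndet n f"
proof -
  have pp: "permutation p" using p by (auto simp: permutation_permutes)
  have "signof p * ndet n f = (\<Sum>q | q permutes {0..<n}. signof p * (signof q * (\<Prod>i =
    0..<n. f i (q i))))"
    unfolding ndet_Leibniz by (simp add: sum_distrib_left)
  also have "\<dots> = (\<Sum>q | q permutes {0..<n}. signof p * (signof (p \<circ> q) * (\<Prod>i =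
    0..<n. f i ((p \<circ> q) i))))"
    by (rule setum_permutations_compose_left[OF p])
  also have "\<dots> = (\<Sum>q | q permutes {0..<n}. signof q * (\<Prod>i = 0..<n. f i (p (q i))))"
  proof (intro sum.cong refl)
    fix q assume "q \<in> {q. q permutes {0..<n}}"
    then have "permutation q" by (auto simp: permutation_permutes)
    then have "sign (p \<circ> q) = sign p * sign q" using pp by (simp add: sign_compose)
    then have "signof p * (signof (p \<circ> q) :: 'a) = signof q"
      by (simp flip: of_int_mult add: mult.assoc[symmetric] sign_idempotent)
    then show "signof p * (signof (p \<circ> q) * (\<Prod>i = 0..<n. f i ((p \<circ> q) i))) =
       signof q * (\<Prod>i = 0..<n. f i (p (q i)))"
      by (simp add: mult.assoc[symmetric])
  qed
  finally show ?thesis unfolding ndet_Leibniz by simp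
qed

text \<open>
  Several columns may be changed at once if each added column lies on the same side of the
  changed one, because the matrix of the operation is then unitriangular.
\<close>
lemma ndet_col_op:
  assumes src: "\<And>j. j < n \<Longrightarrow> P j \<Longrightarrow> src j < n"
    and tri: "(\<forall>j<n. P j \<longrightarrow> j < src j) \<or> (\<forall>j<n. P j \<longrightarrow> src j < j)"
  shows "ndet n (\<lambda>i j. f i j + (if P j then c * f i (src j) else 0)) = ndet n f"
proof -
  define U where "U = mat n n (\<lambda>(k, j). of_bool (k = j) + (if P j \<and> k = src j then c else 0))"
  have U: "U \<in> carrier_mat n n" by (simp add: U_def)
  have "mat n n (\<lambda>(i, j). f i j + (if P j then c * f i (src j) else 0)) = mat n n (\<lambda>(i,
    j). f i j) * U"
  proof (intro eq_matI)
    fix i j assume "i < dim_row (mat n n (\<lambda>(i, j). f i j) * U)" "j < dim_col (mat n n (\<lambda>(i,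
      j). f i j) * U)"
    then have ij: "i < n" "j < n" by (auto simp: U_def)
    have "(mat n n (\<lambda>(i, j). f i j) * U) $$ (i, j) = (\<Sum>k = 0..<n. f i k * U $$ (k, j))"
      using ij U by (simp add: scalar_prod_def)
    also have "\<dots> = (\<Sum>k = 0..<n. (if k = j then f i k else 0) + (if k = src j then (if P j then c *
      f i k else 0) else 0))"
      using ij by (intro sum.cong) (auto simp: U_def algebra_simps)
    also have "\<dots> = f i j + (if P j then c * f i (src j) else 0)"
      using ij src by (auto simp: sum.distrib)
    finally show "mat n n (\<lambda>(i, j). f i j + (if P j then c * f i (src j) else 0)) $$ (i, j) =
      (mat n n (\<lambda>(i, j). f i j) * U) $$ (i, j)" using ij by simp
  qed (auto simp: U_def)
  moreover have "det U = 1"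
  proof -
    have d: "prod_list (diag_mat U) = 1"
    proof -
      have "U $$ (i, i) = 1" if "i < n" for i using tri that by (auto simp: U_def)
      then show ?thesis using U by (simp add: prod_list_diag_prod)
    qed
    from tri show ?thesis
    proof
      assume "\<forall>j<n. P j \<longrightarrow> j < src j"
      then have "U $$ (i, j) = 0" if "i < j" "j < n" for i j using that by (auto simp: U_def)
      then show ?thesis using det_lower_triangular[OF _ U] d by simp
    next
      assume "\<forall>j<n. P j \<longrightarrow> src j < j"
      then have "U $$ (i, j) = 0" if "j < i" "i < n" for i j
      proof -
        have "j < n" using that by simp
        then have "\<not> (P j \<and> i = src j)" using \<open>\<forall>j<n. P j \<longrightarrow> src j < j\<close> that by (metis less_asym)
        then show ?thesis using that by (auto simp: U_def)
      qed
      then have "upper_triangular U" using U by (intro upper_triangularI) auto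
      then show ?thesis using det_upper_triangular[OF _ U] d by simp
    qed
  qed
  ultimately show ?thesis unfolding ndet_def using U by (simp add: det_mult[of _ n])
qed

lemma ndet_first_col_add:
  assumes "n > 0"
  shows "ndet n (\<lambda>i j. if j = 0 then a i + b i else f i j) =
    ndet n (\<lambda>i j. if j = 0 then a i else f i j) + ndet n (\<lambda>i j. if j = 0 then b i else f i j)"
proof -
  let ?A = "\<lambda>a. mat n n (\<lambda>(i, j). if j = 0 then a i else f i j)"
  have c: "cofactor (?A a) i 0 = cofactor (?A b) i 0" for a b i
    unfolding cofactor_def mat_delete_def
    by (intro arg_cong2[of _ _ _ _ "(*)"] refl arg_cong[of _ _ det] eq_matI) auto
  have "ndet n (\<lambda>i j. if j = 0 then a i else f i j) = (\<Sum>i<n. a i * cofactor (?A (\<lambda>_. 0)) i 0)" for a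
    unfolding ndet_def using laplace_expansion_column[of "?A a" n 0] assms c[of a _ "\<lambda>_. 0"] by simp
  then show ?thesis by (simp add: algebra_simps sum.distrib)
qed

lemma ndet_first_row_unit:
  assumes "m \<le> n" "\<And>j. j \<le> n \<Longrightarrow> f 0 j = of_bool (j = m)"
  shows "ndet (Suc n) f = (- 1) ^ m * ndet n (\<lambda>i j. f (Suc i) (if j < m then j else Suc j))"
proof -
  let ?A = "mat (Suc n) (Suc n) (\<lambda>(i, j). f i j)"
  have "ndet (Suc n) f = (\<Sum>j<Suc n. ?A $$ (0, j) * cofactor ?A 0 j)"
    unfolding ndet_def by (rule laplace_expansion_row) auto
  also have "\<dots> = (\<Sum>j<Suc n. if j = m then cofactor ?A 0 j else 0)"
    using assms by (intro sum.cong refl) auto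
  also have "\<dots> = cofactor ?A 0 m" using assms by (simp del: sum.lessThan_Suc)
  also have "\<dots> = (- 1) ^ m * ndet n (\<lambda>i j. f (Suc i) (if j < m then j else Suc j))"
    unfolding cofactor_def mat_delete_def ndet_def
    using assms(1) by (intro arg_cong2[of _ _ _ _ "(*)"] arg_cong[of _ _ det] eq_matI) auto
  finally show ?thesis .
qed

lemma ndet_first_row_zero:
  assumes "n > 0" "\<And>j. j < n \<Longrightarrow> f 0 j = 0"
  shows "ndet n f = 0"
proof -
  have "ndet n f = (\<Sum>j<n. mat n n (\<lambda>(i, j). f i j) $$ (0, j) * cofactor (mat n n (\<lambda>(i,
    j). f i j)) 0 j)"
    unfolding ndet_def by (rule laplace_expansion_row) (use assms in auto)
  then show ?thesis using assms by simp
qed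

lemma poly_ndet: "poly (ndet n F) t = ndet n (\<lambda>i j. poly (F i j) t)"
  unfolding ndet_Leibniz by (simp only: poly_sum poly_mult poly_prod poly_of_int)

text \<open>
  A row of \<open>upper\<close> type (\<open>ty i\<close>) has the powers \<open>u\<^bsup>m - 1\<^esup>, \<dots>, 1\<close> of its point in the first \<open>m\<close>
  columns, the others the powers \<open>u\<^bsup>n - m - 1\<^esup>, \<dots>, 1\<close> in the remaining columns.
\<close>
definition two_block :: "nat \<Rightarrow> nat \<Rightarrow> (nat \<Rightarrow> bool) \<Rightarrow> (nat \<Rightarrow> 'a::comm_ring_1) \<Rightarrow> nat \<Rightarrow> nat \<Rightarrow> 'a" where
  "two_block m n ty u i j =
     (if ty i then (if j < m then u i ^ (m - 1 - j) else 0) else (if j < m then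
       0 else u i ^ (n - 1 - j)))"

definition two_block_diff :: "(nat \<Rightarrow> bool) \<Rightarrow> (nat \<Rightarrow> 'a::comm_ring_1) \<Rightarrow> nat \<Rightarrow> nat \<Rightarrow> 'a" where
  "two_block_diff ty u a b = (if ty a = ty b then u a - u b else if ty a then 1 else - 1)"

lemma prod_pairs_Suc:
  "(\<Prod>b<Suc n. \<Prod>a<b. F a b) = (\<Prod>b<n. F 0 (Suc b)) * (\<Prod>b<n. \<Prod>a<b. F (Suc a) (Suc b))"
  by (simp add: prod.lessThan_Suc_shift prod.distrib del: prod.lessThan_Suc)

lemma card_types_Suc:
  "card {i. i < Suc n \<and> ty i} = of_bool (ty 0) + card {i. i < n \<and> ty (Suc i)}"
proof -
  have "{i. i < Suc n \<and> ty i} = (if ty 0 then {0} else {}) \<union> Suc ` {i. i < n \<and> ty (Suc i)}"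
    by (auto simp: image_iff less_Suc_eq_0_disj)
  then show ?thesis by (simp add: card_insert_if card_image)
qed

text \<open>
  If the numbers of rows fit, this is up to a permutation of the rows a block diagonal matrix
  of two Vandermonde matrices. With \<open>two_block_diff\<close> as factor for two rows in their order,
  the sign of that permutation is included: a row of the second type before one of the first
  type is an inversion. The induction is Vandermonde's: reduce the block of the first row by
  the point of this row and expand along the row.
\<close>
lemma ndet_two_block:
  fixes u :: "nat \<Rightarrow> 'a::comm_ring_1"
  assumes "m \<le> n"
  shows "ndet n (two_block m n ty u) =
    (if card {i. i < n \<and> ty i} = m then \<Prod>b<n. \<Prod>a<b. two_block_diff ty u a b else 0)"
  using assms
proof (induction n arbitrary: m ty u)
  case 0
  then show ?case by (simp add: ndet_def)
next
  case (Suc n)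
  note IH = Suc.IH
  have vvS: "two_block_diff ty u (Suc a) (Suc b) = two_block_diff (\<lambda>i. ty (Suc i)) (\<lambda>i. u (Suc i))
    a b" for a b
    by (simp add: two_block_diff_def)
  show ?case
  proof (cases "ty 0")
    case ty: True
    show ?thesis
    proof (cases m)
      case 0
      have "ndet (Suc n) (two_block m (Suc n) ty u) = 0"
        by (rule ndet_first_row_zero) (simp_all add: two_block_def ty 0)
      then show ?thesis using 0 ty by (simp add: card_types_Suc)
    next
      case m: (Suc l)
      define s where "s i = (if ty (Suc i) then u (Suc i) - u 0 else 1)" for i
      have l: "l \<le> n" using Suc.prems m by simp
      let ?g = "\<lambda>i j. two_block m (Suc n) ty u i j + (if j < l then - u 0 *
        two_block m (Suc n) ty u i (Suc j) else 0)"
      have "ndet (Suc n) (two_block m (Suc n) ty u) = ndet (Suc n) ?g"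
        by (rule ndet_col_op[symmetric]) (use l in auto)
      also have "\<dots> = (- 1) ^ l * ndet n (\<lambda>i j. ?g (Suc i) (if j < l then j else Suc j))"
      proof (rule ndet_first_row_unit[OF l])
        fix j assume "j \<le> n"
        show "?g 0 j = of_bool (j = l)"
        proof (cases "j < l")
          case True
          then have "l - j = Suc (l - Suc j)" by simp
          then show ?thesis using True by (simp add: two_block_def ty m)
        qed (simp add: two_block_def ty m)
      qed
      also have "ndet n (\<lambda>i j. ?g (Suc i) (if j < l then j else Suc j)) =
        ndet n (\<lambda>i j. s i * two_block l n (\<lambda>i. ty (Suc i)) (\<lambda>i. u (Suc i)) i j)"
      proof (rule ndet_cong)
        fix i j assume "i < n" "j < n"
        show "?g (Suc i) (if j < l then j else Suc j) = s i *
          two_block l n (\<lambda>i. ty (Suc i)) (\<lambda>i. u (Suc i)) i j"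
        proof (cases "j < l")
          case True
          then have "l - j = Suc (l - Suc j)" by simp
          then show ?thesis using True by (simp add: two_block_def s_def m algebra_simps)
        qed (simp add: two_block_def s_def m)
      qed
      also have "\<dots> = (\<Prod>i<n. s i) * ndet n (two_block l n (\<lambda>i. ty (Suc i)) (\<lambda>i. u (Suc i)))"
        by (rule ndet_row_scale)
      finally have dt: "ndet (Suc n) (two_block m (Suc n) ty u) = (- 1) ^ l * (\<Prod>i<n. s i) *
        ndet n (two_block l n (\<lambda>i. ty (Suc i)) (\<lambda>i. u (Suc i)))" by (simp add: mult.assoc)
      have sg: "(\<Prod>b<n. two_block_diff ty u 0 (Suc b)) = (- 1) ^ card {i. i < n \<and> ty (Suc i)} *
        (\<Prod>i<n. s i)"
      proof -
        have "(\<Prod>b<n. two_block_diff ty u 0 (Suc b)) = (\<Prod>b<n. (if ty (Suc b) then - 1 else 1) * s b)"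
          by (intro prod.cong refl) (simp add: two_block_diff_def ty s_def)
        moreover have "(\<Prod>b<n. if ty (Suc b) then - 1 else 1 :: 'a) = (- 1) ^ card {i. i < n \<and>
          ty (Suc i)}"
          by (subst prod.If_cases) (auto intro!: arg_cong[of _ _ card] arg_cong[of _ _ "\<lambda>k. (- 1)
            ^ k"])
        ultimately show ?thesis by (simp add: prod.distrib)
      qed
      show ?thesis unfolding dt IH[OF l] card_types_Suc prod_pairs_Suc sg vvS
        using ty m by (simp add: mult_ac)
    qed
  next
    case ty: False
    show ?thesis
    proof (cases "m = Suc n")
      case True
      have "ndet (Suc n) (two_block m (Suc n) ty u) = 0"
        by (rule ndet_first_row_zero) (simp_all add: two_block_def ty True)
      moreover have "card {i. i < n \<and> ty (Suc i)} \<le> n"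
        using card_mono[of "{..<n}" "{i. i < n \<and> ty (Suc i)}"] by auto
      ultimately show ?thesis using True ty by (simp add: card_types_Suc)
    next
      case False
      then have m: "m \<le> n" using Suc.prems by simp
      define s where "s i = (if ty (Suc i) then 1 else u (Suc i) - u 0)" for i
      let ?g = "\<lambda>i j. two_block m (Suc n) ty u i j +
        (if m \<le> j \<and> j < n then - u 0 * two_block m (Suc n) ty u i (Suc j) else 0)"
      have "ndet (Suc n) (two_block m (Suc n) ty u) = ndet (Suc n) ?g"
        by (rule ndet_col_op[symmetric]) auto
      also have "\<dots> = (- 1) ^ n * ndet n (\<lambda>i j. ?g (Suc i) (if j < n then j else Suc j))"
      proof (rule ndet_first_row_unit[OF order.refl])
        fix j assume "j \<le> n"
        show "?g 0 j = of_bool (j = n)"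
        proof (cases "m \<le> j \<and> j < n")
          case True
          then have "n - j = Suc (n - Suc j)" by arith
          then show ?thesis using True by (simp add: two_block_def ty)
        qed (use \<open>j \<le> n\<close> m in \<open>auto simp: two_block_def ty\<close>)
      qed
      also have "ndet n (\<lambda>i j. ?g (Suc i) (if j < n then j else Suc j)) =
        ndet n (\<lambda>i j. s i * two_block m n (\<lambda>i. ty (Suc i)) (\<lambda>i. u (Suc i)) i j)"
      proof (rule ndet_cong)
        fix i j assume "i < n" "j < n"
        show "?g (Suc i) (if j < n then j else Suc j) = s i *
          two_block m n (\<lambda>i. ty (Suc i)) (\<lambda>i. u (Suc i)) i j"
        proof (cases "m \<le> j")
          case True
          have "n - j = Suc (n - Suc j)" using \<open>j < n\<close> by arith
          then show ?thesis using True \<open>j < n\<close> by (simp add: two_block_def s_def algebra_simps)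
        qed (use \<open>j < n\<close> in \<open>simp add: two_block_def s_def\<close>)
      qed
      also have "\<dots> = (\<Prod>i<n. s i) * ndet n (two_block m n (\<lambda>i. ty (Suc i)) (\<lambda>i. u (Suc i)))"
        by (rule ndet_row_scale)
      finally have dt: "ndet (Suc n) (two_block m (Suc n) ty u) = (- 1) ^ n * (\<Prod>i<n. s i) *
        ndet n (two_block m n (\<lambda>i. ty (Suc i)) (\<lambda>i. u (Suc i)))" by (simp add: mult.assoc)
      have sg: "(\<Prod>b<n. two_block_diff ty u 0 (Suc b)) = (- 1) ^ n * (\<Prod>i<n. s i)"
      proof -
        have "(\<Prod>b<n. two_block_diff ty u 0 (Suc b)) = (\<Prod>b<n. (- 1) * s b)"
          by (intro prod.cong refl) (simp add: two_block_diff_def ty s_def)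
        then show ?thesis by (simp only: prod.distrib prod_constant card_lessThan)
      qed
      show ?thesis unfolding dt IH[OF m] card_types_Suc prod_pairs_Suc sg vvS
        using ty by simp
    qed
  qed
qed

section \<open>The coefficients as products\<close>

text \<open>
  The cycle that moves the first column behind the following \<open>N - 1\<close> columns.
\<close>
definition cycle_back :: "nat \<Rightarrow> nat \<Rightarrow> nat" where
  "cycle_back N j = (if j = 0 then N - 1 else if j < N then j - 1 else j)"

lemma cycle_back_permutes:
  assumes "1 \<le> N" "N \<le> n"
  shows "cycle_back N permutes {0..<n}"
proof (rule bij_imp_permutes)
  show "bij_betw (cycle_back N) {0..<n} {0..<n}"
    by (rule bij_betw_byWitness[of _ "\<lambda>j. if j < N - 1 then j + 1 else if j = N - 1 then 0 else j"])
       (use assms in \<open>auto simp: cycle_back_def\<close>)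
qed (use assms in \<open>auto simp: cycle_back_def\<close>)

text \<open>
  A product over unordered pairs that is symmetrised is one over ordered pairs.
\<close>
lemma prod_ordered_pairs:
  fixes F :: "nat \<Rightarrow> nat \<Rightarrow> 'a::comm_monoid_mult"
  shows "(\<Prod>b<n. \<Prod>a<b. F a b * F b a) = (\<Prod>a<n. \<Prod>b\<in>{..<n} - {a}. F a b)"
proof (induction n)
  case (Suc n)
  have "(\<Prod>b\<in>{..<Suc n} - {a}. F a b) = F a n * (\<Prod>b\<in>{..<n} - {a}. F a b)" if "a < n" for a
  proof -
    have "{..<Suc n} - {a} = insert n ({..<n} - {a})" using that by auto
    then show ?thesis by simp
  qed
  moreover have "{..<Suc n} - {n} = {..<n}" by auto
  ultimately have "(\<Prod>a<Suc n. \<Prod>b\<in>{..<Suc n} - {a}. F a b) =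
     (\<Prod>a<n. F a n * (\<Prod>b\<in>{..<n} - {a}. F a b)) * (\<Prod>b<n. F n b)" by simp
  then show ?case unfolding prod.lessThan_Suc[of "\<lambda>b. \<Prod>a<b. F a b * F b a"] Suc
    by (simp add: prod.distrib mult_ac)
qed simp

lemma prod_shift1: "(\<Prod>a\<in>{1..n}. f a) = (\<Prod>i<n. f (Suc i))"
  by (rule prod.reindex_bij_witness[of _ Suc "\<lambda>i. i - 1"]) auto

lemma sum_shift1: "(\<Sum>a\<in>{1..n}. f a) = (\<Sum>i<n. f (Suc i))"
  by (rule sum.reindex_bij_witness[of _ Suc "\<lambda>i. i - 1"]) auto

context two_coloured
begin

text \<open>
  Row \<open>i\<close> of a matrix indexed from \<open>0\<close> belongs to variable \<open>Suc i\<close>. Moving a variable changes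
  the block of its row, and removes the shift \<open>r\<close> from its point.
\<close>
definition upper_type :: "nat set \<Rightarrow> nat \<Rightarrow> bool" where
  "upper_type I i \<longleftrightarrow> isx (Suc i) \<noteq> (Suc i \<in> I)"

definition row_point :: "(nat \<Rightarrow> 'a) \<Rightarrow> nat set \<Rightarrow> nat \<Rightarrow> 'a" where
  "row_point z I i = (if Suc i \<in> I then z (Suc i) else z (Suc i) + r)"

definition coloured_vandermonde :: "nat \<Rightarrow> (nat \<Rightarrow> 'a) \<Rightarrow> 'a" where
  "coloured_vandermonde n z = (\<Prod>b<n. \<Prod>a<b. if isx (Suc a) = isx (Suc b) then
    z (Suc a) - z (Suc b) else 1)"

text \<open>
  The sign \<open>-1\<close> for every moved \<open>x\<close>-variable is what remains of the signs of the row factors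
  and of the inversions, up to a sign that depends on the charge only.
\<close>
definition move_weight :: "nat \<Rightarrow> nat \<Rightarrow> 'a \<Rightarrow> 'a" where
  "move_weight \<delta> a x = (if isx a then - (x ^ \<delta>) else x ^ (1 - \<delta>))"

definition move_prod :: "nat \<Rightarrow> nat set \<Rightarrow> (nat \<Rightarrow> 'a) \<Rightarrow> 'a" where
  "move_prod n I z = (\<Prod>(a, b)\<in>{1..n} \<times> {1..n}. if a \<in> I \<and> b \<notin> I then
    move_factor a b (z a - z b) else 1)"

text \<open>
  The factor that has to be taken out of row \<open>i\<close> so that a row of powers remains.
\<close>
definition row_scale :: "nat \<Rightarrow> bool \<times> 'a \<Rightarrow> (nat \<Rightarrow> 'a) \<Rightarrow> nat set \<Rightarrow> nat \<Rightarrow> 'a" where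
  "row_scale \<delta> p z I i = (if Suc i \<in> I then (if isx (Suc i) then
    - (z (Suc i) ^ \<delta>) else - (z (Suc i) ^ (1 - \<delta>)))
     else keep_factor p (Suc i) (z (Suc i)))"

text \<open>
  Entries of the matrices that define the operators, split into the part without (\<open>keep\<close>) and
  the coefficient of (\<open>move\<close>) the shift; \<open>N\<close> is the number of \<open>x\<close>-variables.
\<close>
definition X_keep :: "nat \<Rightarrow> nat \<Rightarrow> 'a \<Rightarrow> (nat \<Rightarrow> 'a) \<Rightarrow> nat \<Rightarrow> nat \<Rightarrow> 'a" where
  "X_keep N n t z a b = (if a \<le> N then (if b \<le> N then (z a + t) * (z a + r) ^ (N - b) else 0)
     else (if b \<le> N then (z a + r) ^ (n - N + 1 - b) else (z a + r) ^ (n - N - (b - N))))"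

definition X_move :: "nat \<Rightarrow> nat \<Rightarrow> (nat \<Rightarrow> 'a) \<Rightarrow> nat \<Rightarrow> nat \<Rightarrow> 'a" where
  "X_move N n z a b = (if a \<le> N then (if b \<le> N then - (z a ^ (N +
    1 - b)) else - (z a ^ (N - (b - N))))
     else (if b \<le> N then - (z a ^ (n - N + 1 - b)) else 0))"

definition Y_keep :: "nat \<Rightarrow> nat \<Rightarrow> 'a \<Rightarrow> (nat \<Rightarrow> 'a) \<Rightarrow> nat \<Rightarrow> nat \<Rightarrow> 'a" where
  "Y_keep N n t z a b = (if a \<le> N then (if b \<le> N then (z a + r) ^ (N - b) else (z a +
    r) ^ (N - (b - N)))
     else (if b \<le> N then 0 else (z a + t) * (z a + r) ^ (n - N - (b - N))))"

definition Y_move :: "nat \<Rightarrow> nat \<Rightarrow> (nat \<Rightarrow> 'a) \<Rightarrow> nat \<Rightarrow> nat \<Rightarrow> 'a" where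
  "Y_move N n z a b = (if a \<le> N then (if b \<le> N then 0 else - (z a ^ (N - (b - N))))
     else (if b \<le> N then - (z a ^ (n - N + 1 - b)) else - (z a ^ (n - N + 1 - (b - N)))))"

context
  fixes N n \<delta> :: nat and z :: "nat \<Rightarrow> 'a"
  assumes N: "1 \<le> N" "N \<le> n" "N = n - N + \<delta>" "\<delta> \<le> 1"
    and colN: "\<And>a. 1 \<le> a \<Longrightarrow> a \<le> n \<Longrightarrow> isx a \<longleftrightarrow> a \<le> N"
    and dist: "\<And>a b. a \<in> {1..n} \<Longrightarrow> b \<in> {1..n} \<Longrightarrow> a \<noteq> b \<Longrightarrow> z a \<noteq> z b"
begin

lemma card_upper_type:
  assumes "I \<subseteq> {1..n}"
  shows "int (card {i. i < n \<and> upper_type I i}) = int N - charge I"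
proof -
  have "int (card {i. i < n \<and> upper_type I i}) = (\<Sum>i<n. of_bool (upper_type I i))"
    by (simp add: sum.If_cases Int_def)
  also have "\<dots> = (\<Sum>i<n. of_bool (Suc i \<le> N) - of_bool (Suc i \<in> I) * unit_charge (Suc i))"
    by (intro sum.cong refl) (auto simp: upper_type_def unit_charge_def colN)
  also have "\<dots> = (\<Sum>i<n. of_bool (Suc i \<le> N)) - (\<Sum>i<n. of_bool (Suc i \<in> I) * unit_charge (Suc i))"
    by (rule sum_subtractf)
  also have "(\<Sum>i<n. of_bool (Suc i \<le> N)) = int N"
  proof -
    have "(\<Sum>i<n. of_bool (Suc i \<le> N)) = int (card {i. i < n \<and> Suc i \<le> N})"
      by (simp add: sum.If_cases Int_def)
    also have "{i. i < n \<and> Suc i \<le> N} = {..<N}" using N by auto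
    finally show ?thesis by simp
  qed
  also have "(\<Sum>i<n. of_bool (Suc i \<in> I) * unit_charge (Suc i)) = (\<Sum>a\<in>{1..n}. of_bool (a \<in> I) *
    unit_charge a)"
    by (rule sum_shift1[symmetric])
  also have "\<dots> = charge I" unfolding charge_def
    using assms by (intro sum.mono_neutral_cong_right) auto
  finally show ?thesis .
qed

text \<open>
  The last two factors collect the signs: for a moved row there is one sign for every \<open>y\<close>-row
  other than itself.
\<close>
lemma two_block_diff_factor:
  assumes "a < b" "b < n"
  shows "two_block_diff (upper_type I) (row_point z I) a b =
    (if isx (Suc a) = isx (Suc b) then z (Suc a) - z (Suc b) else 1) *
    ((if Suc a \<in> I \<and> Suc b \<notin> I then move_factor (Suc a) (Suc b) (z (Suc a) - z (Suc b)) else 1) *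
     (if Suc b \<in> I \<and> Suc a \<notin> I then move_factor (Suc b) (Suc a) (z (Suc b) - z (Suc a)) else 1)) *
    ((if \<not> isx (Suc b) \<and> Suc a \<in> I then - 1 else 1) * (if \<not> isx (Suc a) \<and> Suc b \<in> I then
      - 1 else 1))"
proof -
  have c: "isx (Suc b) \<Longrightarrow> isx (Suc a)" using assms by (simp add: colN)
  have d: "z (Suc a) - z (Suc b) \<noteq> 0" using dist[of "Suc a" "Suc b"] assms by simp
  then have i: "(z (Suc a) - z (Suc b)) * inverse (z (Suc a) - z (Suc b)) = 1" by simp
  have j: "inverse (z (Suc b) - z (Suc a)) = - inverse (z (Suc a) - z (Suc b))"
    by (metis inverse_minus_eq minus_diff_eq)
  show ?thesis using c
    by (cases "isx (Suc a)"; cases "isx (Suc b)"; cases "Suc a \<in> I"; cases "Suc b \<in> I")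
       (simp_all add: two_block_diff_def upper_type_def row_point_def move_factor_def i j)
qed

lemma card_lower: "card {b. b < n \<and> \<not> isx (Suc b)} = n - N"
proof -
  have "{b. b < n \<and> \<not> isx (Suc b)} = {N..<n}" by (auto simp: colN)
  then show ?thesis by simp
qed

lemma prod_two_block_diff:
  "(\<Prod>b<n. \<Prod>a<b. two_block_diff (upper_type I) (row_point z I) a b) = coloured_vandermonde n z *
    move_prod n I z *
    (\<Prod>i<n. if Suc i \<in> I then (- 1) ^ (n - N - of_bool (\<not> isx (Suc i))) else 1)"
proof -
  define H where "H a b = (if a \<in> I \<and> b \<notin> I then move_factor a b (z a - z b) else 1)" for a b
  define F :: "nat \<Rightarrow> nat \<Rightarrow> 'a" where "F a b = (if \<not> isx (Suc b) \<and> Suc a \<in> I then - 1 else 1)"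
    for a b
  have "(\<Prod>b<n. \<Prod>a<b. two_block_diff (upper_type I) (row_point z I) a b) = (\<Prod>b<n. \<Prod>a<b.
     (if isx (Suc a) = isx (Suc b) then z (Suc a) - z (Suc b) else 1) *
     (H (Suc a) (Suc b) * H (Suc b) (Suc a)) * (F a b * F b a))"
    unfolding H_def F_def by (intro prod.cong refl two_block_diff_factor) auto
  also have "\<dots> = coloured_vandermonde n z * (\<Prod>b<n. \<Prod>a<b. H (Suc a) (Suc b) * H (Suc b) (Suc a)) *
     (\<Prod>b<n. \<Prod>a<b. F a b * F b a)"
    unfolding coloured_vandermonde_def by (simp only: prod.distrib mult_ac)
  also have "(\<Prod>b<n. \<Prod>a<b. H (Suc a) (Suc b) * H (Suc b) (Suc a)) =
      (\<Prod>a<n. \<Prod>b\<in>{..<n} - {a}. H (Suc a) (Suc b))"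
    by (rule prod_ordered_pairs)
  also have "\<dots> = (\<Prod>a<n. \<Prod>b<n. H (Suc a) (Suc b))"
    by (intro prod.cong refl prod.mono_neutral_left) (auto simp: H_def)
  also have "\<dots> = move_prod n I z"
    unfolding move_prod_def H_def[symmetric]
    by (simp only: prod.cartesian_product[symmetric] prod_shift1)
  also have "(\<Prod>b<n. \<Prod>a<b. F a b * F b a) = (\<Prod>a<n. \<Prod>b\<in>{..<n} - {a}. F a b)"
    by (rule prod_ordered_pairs)
  also have "\<dots> = (\<Prod>i<n. if Suc i \<in> I then (- 1) ^ (n - N - of_bool (\<not> isx (Suc i))) else 1)"
  proof (intro prod.cong refl)
    fix i assume i: "i \<in> {..<n}"
    show "(\<Prod>b\<in>{..<n} - {i}. F i b) = (if Suc i \<in> I then (- 1) ^ (n - N - of_bool (\<not> isx (Suc i)))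
      else 1)"
    proof (cases "Suc i \<in> I")
      case True
      have "(\<Prod>b\<in>{..<n} - {i}. F i b) = (\<Prod>b\<in>{..<n} - {i}. if \<not> isx (Suc b) then - 1 else 1)"
        using True by (simp add: F_def)
      also have "\<dots> = (- 1) ^ card (({..<n} - {i}) \<inter> {b. \<not> isx (Suc b)})"
        by (simp add: prod.If_cases)
      also have "({..<n} - {i}) \<inter> {b. \<not> isx (Suc b)} = {b. b < n \<and> \<not> isx (Suc b)} - {i}" by auto
      also have "card \<dots> = n - N - of_bool (\<not> isx (Suc i))"
        using card_lower i by (cases "isx (Suc i)") (auto simp: card_Diff_singleton_if)
      finally show ?thesis using True by simp
    qed (simp add: F_def)
  qed
  finally show ?thesis .
qed

text \<open>
  The number of rows of upper type is \<open>N\<close> minus the charge of \<open>I\<close>, so a first block of \<open>m\<close>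
  columns selects the charge \<open>N - m\<close>.
\<close>
lemma scaled_ndet_two_block:
  assumes I: "I \<subseteq> {1..n}" and m: "m \<le> N"
  shows "(\<Prod>i<n. row_scale \<delta> p z I i) * ndet n (two_block m n (upper_type I) (row_point z I)) =
    of_bool (charge I = int (N - m)) * ((- 1) ^ (n - N)) ^ nat (charge I) *
      coloured_vandermonde n z *
    ((\<Prod>a\<in>{1..n}. if a \<in> I then move_weight \<delta> a (z a) else keep_factor p a (z a)) * move_prod n I z)"
proof (cases "charge I = int (N - m)")
  case True
  have "int (card {i. i < n \<and> upper_type I i}) = int m" unfolding card_upper_type[OF I] True using
    m by simp
  then have dt: "ndet n (two_block m n (upper_type I) (row_point z I)) =
    (\<Prod>b<n. \<Prod>a<b. two_block_diff (upper_type I) (row_point z I) a b)"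
    using m N by (subst ndet_two_block) auto
  have finI: "finite I" using I by (rule finite_subset) simp
  have "(\<Prod>i<n. row_scale \<delta> p z I i) *
      (\<Prod>i<n. if Suc i \<in> I then (- 1) ^ (n - N - of_bool (\<not> isx (Suc i))) else 1) =
    (\<Prod>i<n. (if Suc i \<in> I then move_weight \<delta> (Suc i) (z (Suc i)) else keep_factor p (Suc i) (z (Suc
      i))) *
      (if Suc i \<in> I then (- 1) ^ (n - N) else 1))"
    unfolding prod.distrib[symmetric]
  proof (intro prod.cong refl)
    fix i assume i: "i \<in> {..<n}"
    have "n - N = Suc (n - N - 1)" if "\<not> isx (Suc i)"
      using that i by (simp add: colN)
    then have "(- 1 :: 'a) ^ (n - N) = - ((- 1) ^ (n - N - 1))" if "\<not> isx (Suc i)"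
      using that by (metis mult_minus1 power_Suc)
    then show "row_scale \<delta> p z I i * (if Suc i \<in> I then (- 1) ^ (n - N - of_bool (\<not> isx (Suc i)))
      else 1) =
      (if Suc i \<in> I then move_weight \<delta> (Suc i) (z (Suc i)) else keep_factor p (Suc i) (z (Suc i))) *
      (if Suc i \<in> I then (- 1) ^ (n - N) else 1)"
      by (cases "isx (Suc i)") (simp_all add: row_scale_def move_weight_def)
  qed
  also have "\<dots> = (\<Prod>a\<in>{1..n}. (if a \<in> I then move_weight \<delta> a (z a) else keep_factor p a (z a))) *
      (\<Prod>a\<in>{1..n}. if a \<in> I then (- 1) ^ (n - N) else 1)"
    unfolding prod_shift1 prod.distrib ..
  also have "(\<Prod>a\<in>{1..n}. if a \<in> I then (- 1) ^ (n - N) else 1 :: 'a) = (\<Prod>a\<in>I. (- 1) ^ (n - N))"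
    using I by (intro prod.mono_neutral_cong_right) auto
  also have "\<dots> = ((- 1) ^ (n - N)) ^ card I" by simp
  also have "((- 1) ^ (n - N)) ^ card I = (((- 1) ^ (n - N)) ^ nat (charge I) :: 'a)"
  proof -
    have "charge I + 2 * int (card {a\<in>I. \<not> isx a}) = (\<Sum>a\<in>I. unit_charge a + 2 * of_bool (\<not> isx a))"
      using finI by (simp add: charge_def sum.distrib sum_distrib_left[symmetric] sum.If_cases
        Int_def conj_commute)
    also have "\<dots> = (\<Sum>a\<in>I. 1)" by (intro sum.cong) (auto simp: unit_charge_def)
    finally have "int (card I) = charge I + 2 * int (card {a\<in>I. \<not> isx a})" by simp
    moreover have "0 \<le> charge I" using True by simp
    ultimately have "card I = nat (charge I) + 2 * card {a\<in>I. \<not> isx a}" by linarith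
    then have "((- 1) ^ (n - N)) ^ card I = ((- 1) ^ (n - N)) ^ nat (charge I) *
        ((((- 1) ^ (n - N)) ^ 2) ^ card {a\<in>I. \<not> isx a} :: 'a)"
      by (simp only: power_add power_mult)
    also have "((- 1) ^ (n - N)) ^ 2 = (1 :: 'a)" by (simp flip: power_mult)
    finally show ?thesis by simp
  qed
  finally show ?thesis unfolding dt prod_two_block_diff using True by (simp add: mult_ac)
next
  case False
  have "int (card {i. i < n \<and> upper_type I i}) \<noteq> int m"
    unfolding card_upper_type[OF I] using False m by linarith
  then have "ndet n (two_block m n (upper_type I) (row_point z I)) = 0"
    using m N by (subst ndet_two_block) auto
  then show ?thesis using False by simp
qed

text \<open>
  Subtracting column \<open>j - N\<close> from column \<open>j \<ge> N\<close> removes from the right block what its entries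
  share with the left block.
\<close>
lemma ndet_Y:
  assumes I: "I \<subseteq> {1..n}"
  shows "ndet n (\<lambda>i j. if Suc i \<in> I then Y_move N n z (Suc i) (Suc j) else Y_keep N n t z (Suc i)
    (Suc j)) =
    coloured_vandermonde n z * op_coeff (move_weight \<delta>) \<epsilon> {1..n} (False, t) I z"
proof -
  let ?M = "\<lambda>i j. row_scale \<delta> (False, t) z I i * two_block N n (upper_type I) (row_point z I) i j"
  have "ndet n (\<lambda>i j. if Suc i \<in> I then Y_move N n z (Suc i) (Suc j) else Y_keep N n t z (Suc i)
    (Suc j)) =
    ndet n (\<lambda>i j. ?M i j + (if N \<le> j then 1 * ?M i (j - N) else 0))"
  proof (rule ndet_cong)
    fix i j assume ij: "i < n" "j < n"
    have e: "x ^ p * x ^ q = x ^ s" if "p + q = s" for x :: 'a and p q s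
      using that by (simp flip: power_add)
    have c: "isx (Suc i) \<longleftrightarrow> i < N" using ij by (simp add: colN Suc_le_eq)
    show "(if Suc i \<in> I then Y_move N n z (Suc i) (Suc j) else Y_keep N n t z (Suc i) (Suc j)) =
      ?M i j + (if N \<le> j then 1 * ?M i (j - N) else 0)"
      using ij N by (cases "i < N"; cases "j < N"; cases "Suc i \<in> I")
       (simp_all add: Y_move_def Y_keep_def row_scale_def two_block_def upper_type_def
         row_point_def keep_factor_def c Suc_le_eq e Suc_diff_le,
        (intro conjI impI arg_cong[of _ _ "\<lambda>k. z (Suc i) ^ k"]; arith)+)
  qed
  also have "\<dots> = ndet n ?M" by (rule ndet_col_op) (use N in auto)
  also have "\<dots> = (\<Prod>i<n. row_scale \<delta> (False, t) z I i) * ndet n (two_block N n (upper_type I)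
    (row_point z I))"
    by (rule ndet_row_scale)
  also have "\<dots> = coloured_vandermonde n z * op_coeff (move_weight \<delta>) \<epsilon> {1..n} (False, t) I z"
    unfolding scaled_ndet_two_block[OF I order.refl] op_coeff_def move_prod_def
    by (cases "charge I = 0") auto
  finally show ?thesis .
qed

text \<open>
  With columns counted from \<open>0\<close>, subtract column \<open>N + j - 1\<close> from column \<open>j\<close> for \<open>0 < j < N\<close>.
  In the rows of the second type this makes the left block zero except for its first column.
  That column is a sum: one summand completes the left block, the other one the right block,
  whence the two charges.
\<close>
lemma ndet_X:
  assumes I: "I \<subseteq> {1..n}"
  shows "ndet n (\<lambda>i j. if Suc i \<in> I then X_move N n z (Suc i) (Suc j) else X_keep N n t z (Suc i)
    (Suc j)) =
    coloured_vandermonde n z * op_coeff (move_weight \<delta>) ((- 1) ^ (n - N) *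
      signof (cycle_back N)) {1..n} (True, t) I z"
proof -
  let ?b = "\<lambda>m. two_block m n (upper_type I) (row_point z I)" and ?s = "row_scale \<delta> (True, t) z I"
  let ?M = "\<lambda>i j. if j = 0 then ?b N i 0 + ?b (N - 1) i (N - 1) else ?b N i j"
  have "ndet n (\<lambda>i j. if Suc i \<in> I then X_move N n z (Suc i) (Suc j) else X_keep N n t z (Suc i)
    (Suc j)) =
    ndet n (\<lambda>i j. ?s i * (?M i j + (if 1 \<le> j \<and> j < N then 1 * ?M i (N + j - 1) else 0)))"
  proof (rule ndet_cong)
    fix i j assume ij: "i < n" "j < n"
    have e: "x ^ p * x ^ q = x ^ s" if "p + q = s" for x :: 'a and p q s
      using that by (simp flip: power_add)
    have c: "isx (Suc i) \<longleftrightarrow> i < N" using ij by (simp add: colN Suc_le_eq)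
    consider "j = 0" | "1 \<le> j" "j < N" | "N \<le> j" "j \<noteq> 0" by linarith
    then show "(if Suc i \<in> I then X_move N n z (Suc i) (Suc j) else X_keep N n t z (Suc i) (Suc
      j)) =
      ?s i * (?M i j + (if 1 \<le> j \<and> j < N then 1 * ?M i (N + j - 1) else 0))"
      using ij N by cases (cases "i < N"; cases "Suc i \<in> I";
        simp add: X_move_def X_keep_def row_scale_def two_block_def upper_type_def row_point_def
          keep_factor_def c Suc_le_eq e Suc_diff_le;
        (intro conjI impI arg_cong[of _ _ "\<lambda>k. z (Suc i) ^ k"] arg_cong[of _ _ "\<lambda>k. (z (Suc i) +
          r) ^ k"]; arith)?)+
  qed
  also have "\<dots> = (\<Prod>i<n. ?s i) * ndet n (\<lambda>i j. ?M i j + (if 1 \<le> j \<and> j < N then 1 * ?M i (N +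
    j - 1) else 0))"
    by (rule ndet_row_scale)
  also have "ndet n (\<lambda>i j. ?M i j + (if 1 \<le> j \<and> j < N then 1 * ?M i (N + j - 1) else 0)) =
    ndet n ?M"
    by (rule ndet_col_op) (use N in auto)
  also have "ndet n ?M = ndet n (\<lambda>i j. if j = 0 then ?b N i 0 else ?b N i j) +
      ndet n (\<lambda>i j. if j = 0 then ?b (N - 1) i (N - 1) else ?b N i j)"
    by (rule ndet_first_col_add) (use N in auto)
  also have "ndet n (\<lambda>i j. if j = 0 then ?b N i 0 else ?b N i j) = ndet n (?b N)"
    by (rule ndet_cong) simp
  also have "ndet n (\<lambda>i j. if j = 0 then ?b (N - 1) i (N - 1) else ?b N i j) =
      ndet n (\<lambda>i j. ?b (N - 1) i (cycle_back N j))"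
    by (rule ndet_cong) (use N in \<open>auto simp: cycle_back_def two_block_def\<close>)
  also have "\<dots> = signof (cycle_back N) * ndet n (?b (N - 1))"
    by (rule ndet_col_permute) (rule cycle_back_permutes[OF N(1,2)])
  also have "(\<Prod>i<n. ?s i) * (ndet n (?b N) + signof (cycle_back N) * ndet n (?b (N - 1))) =
      (\<Prod>i<n. ?s i) * ndet n (?b N) + signof (cycle_back N) * ((\<Prod>i<n. ?s i) * ndet n (?b (N - 1)))"
    by (simp add: algebra_simps)
  also have "\<dots> = coloured_vandermonde n z * op_coeff (move_weight \<delta>) ((- 1) ^ (n - N) *
    signof (cycle_back N)) {1..n} (True, t) I z"
  proof -
    have N1: "N - 1 \<le> N" "N - (N - 1) = 1" using N by auto
    consider "charge I = 0" | "charge I = 1" | "\<not> (0 \<le> charge I \<and> charge I \<le> 1)" by linarith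
    then show ?thesis
      unfolding scaled_ndet_two_block[OF I order.refl] scaled_ndet_two_block[OF I N1(1)] N1(2)
        op_coeff_def move_prod_def
      by cases auto
  qed
  finally show ?thesis .
qed

end
end

section \<open>Difference operators as twisted products\<close>

text \<open>
  The symmetry of the sums over splittings holds in characteristic zero and is applied in the
  field of rational functions.
\<close>
instance fract :: ("{idom, ring_char_0}") field_char_0
  by standard (auto simp: inj_def of_nat_fract eq_fract)

lemma pshift_commute: "pshift c i (pshift d j p) = pshift d j (pshift c i p)"
  unfolding pshift_def psubst_psubst
  by (rule arg_cong[of _ _ "\<lambda>s. psubst s p"])
     (auto simp: fun_eq_iff psubst_add psubst_pvar psubst_pconst ac_simps)

lemma T_commute: "T i * T j = T j * T i"
proof -
  have "shift i (shift j f) = shift j (shift i f)" for f :: "'a ratfun"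
    by (cases f) (simp add: shift_Fract pshift_commute)
  then show ?thesis
    by (simp add: app_endo_inject[symmetric] fun_eq_iff times_endo.rep_eq app_T)
qed

lemma app_endo_add: "app_endo D (x + y) = app_endo D x + app_endo D y"
  using app_endo[of D] by simp

lemma endo_eqI: "(\<And>f. app_endo D f = app_endo E f) \<Longrightarrow> D = E"
  by (simp add: app_endo_inject[symmetric] fun_eq_iff)

lemma mult_op_hom:
  "mult_op (f * g) = mult_op f * mult_op g" "mult_op (f + g) = mult_op f + mult_op g"
  "mult_op 0 = 0" "mult_op 1 = 1" "mult_op (- f) = - mult_op f" "mult_op (f - g) =
    mult_op f - mult_op g"
  by (rule endo_eqI, simp add: mult_op.rep_eq times_endo.rep_eq plus_endo.rep_eq zero_endo.rep_eq
      one_endo.rep_eq uminus_endo.rep_eq minus_endo.rep_eq algebra_simps)+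

lemma mult_op_sum: "mult_op (sum f A) = (\<Sum>x\<in>A. mult_op (f x))"
  by (induction A rule: infinite_finite_induct) (simp_all add: mult_op_hom)

text \<open>
  Operators that are ring endomorphisms, such as products of shifts. They can be moved past a
  multiplication operator by acting on its factor.
\<close>
definition hom_op :: "'a::field endo \<Rightarrow> bool" where
  "hom_op D \<longleftrightarrow> app_endo D 1 = 1 \<and> (\<forall>f g. app_endo D (f * g) = app_endo D f * app_endo D g)"

lemma hom_op_1: "hom_op 1"
  by (simp add: hom_op_def one_endo.rep_eq)

lemma hom_op_times: "hom_op D \<Longrightarrow> hom_op E \<Longrightarrow> hom_op (D * E)"
  by (simp add: hom_op_def times_endo.rep_eq)

lemma hom_op_power: "hom_op D \<Longrightarrow> hom_op (D ^ k)"
  by (induction k) (simp_all add: hom_op_1 hom_op_times)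

lemma rconst_1: "rconst 1 = 1"
  by (simp add: rconst_def pconst_simps One_fract_def)

lemma hom_op_T: "hom_op (T i)"
  using shift_rconst[of i 1] by (simp add: hom_op_def app_T shift_mult rconst_1)

lemma hom_op_mult_op: "hom_op D \<Longrightarrow> D * mult_op f = mult_op (app_endo D f) * D"
  by (rule endo_eqI) (simp add: hom_op_def mult_op.rep_eq times_endo.rep_eq)

context
  fixes D :: "'a::field endo" assumes D: "hom_op D"
begin

lemma hom_op_simps:
  "app_endo D 1 = 1" "app_endo D (f * g) = app_endo D f * app_endo D g"
  "app_endo D (f + g) = app_endo D f + app_endo D g" "app_endo D 0 = 0"
  "app_endo D (- f) = - app_endo D f" "app_endo D (f - g) = app_endo D f - app_endo D g"
proof -
  show 0: "app_endo D 0 = 0" by (metis app_endo_add add.right_neutral add_left_cancel)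
  show m: "app_endo D (- f) = - app_endo D f" for f
    using app_endo_add[of D f "- f"] 0 by (simp add: eq_neg_iff_add_eq_0 add.commute)
  show "app_endo D (f - g) = app_endo D f - app_endo D g"
    using app_endo_add[of D f "- g"] m by simp
qed (use D in \<open>auto simp: hom_op_def app_endo_add\<close>)

lemma hom_op_inverse: "app_endo D (inverse f) = inverse (app_endo D f)"
proof (cases "f = 0")
  case False
  then have "app_endo D f * app_endo D (inverse f) = 1"
    by (simp flip: hom_op_simps(2) add: hom_op_simps(1))
  then show ?thesis by (simp add: inverse_unique)
qed (simp add: hom_op_simps)

lemma hom_op_power_app: "app_endo D (f ^ k) = app_endo D f ^ k"
  by (induction k) (simp_all add: hom_op_simps)

lemma hom_op_prod: "app_endo D (prod f A) = (\<Prod>x\<in>A. app_endo D (f x))"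
  by (induction A rule: infinite_finite_induct) (simp_all add: hom_op_simps)

lemma hom_op_of_bool: "app_endo D (of_bool P) = of_bool P"
  by (cases P) (simp_all add: hom_op_simps)

lemma hom_op_of_nat: "app_endo D (of_nat k) = of_nat k"
  by (induction k) (simp_all add: hom_op_simps)

end

definition Tpow :: "(nat \<Rightarrow> nat) \<Rightarrow> nat \<Rightarrow> (nat \<Rightarrow> nat) \<Rightarrow> 'k::field_char_0 oper" where
  "Tpow \<nu> n m = prod_list (map (\<lambda>a. T (\<nu> a) ^ m a) [1..<n + 1])"

lemma Tpow_0: "Tpow \<nu> 0 m = 1" and Tpow_Suc: "Tpow \<nu> (Suc n) m = Tpow \<nu> n m *
  T (\<nu> (Suc n)) ^ m (Suc n)"
  by (simp_all add: Tpow_def)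

lemma T_power_Tpow_commute:
  "(T i :: 'k::field_char_0 oper) ^ j * Tpow \<nu> n m = Tpow \<nu> n m * T i ^ j"
proof (induction n)
  case (Suc n)
  have c: "(T i :: 'k oper) ^ j * T (\<nu> (Suc n)) ^ m (Suc n) = T (\<nu> (Suc n)) ^ m (Suc n) * T i ^ j"
    by (intro power_commuting_commutes power_commuting_commutes[symmetric] T_commute)
  have "(T i :: 'k oper) ^ j * Tpow \<nu> (Suc n) m = (T i ^ j * Tpow \<nu> n m) *
    T (\<nu> (Suc n)) ^ m (Suc n)"
    by (simp only: Tpow_Suc mult.assoc)
  also have "\<dots> = Tpow \<nu> n m * (T i ^ j * T (\<nu> (Suc n)) ^ m (Suc n))"
    by (simp only: Suc mult.assoc)
  also have "\<dots> = Tpow \<nu> (Suc n) m * T i ^ j"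
    by (simp only: c Tpow_Suc mult.assoc)
  finally show ?case .
qed (simp add: Tpow_0)

lemma Tpow_add:
  "(Tpow \<nu> n m :: 'k::field_char_0 oper) * Tpow \<nu> n m' = Tpow \<nu> n (\<lambda>a. m a + m' a)"
proof (induction n)
  case (Suc n)
  have "(Tpow \<nu> (Suc n) m :: 'k oper) * Tpow \<nu> (Suc n) m' =
    Tpow \<nu> n m * (T (\<nu> (Suc n)) ^ m (Suc n) * Tpow \<nu> n m') * T (\<nu> (Suc n)) ^ m' (Suc n)"
    by (simp add: Tpow_Suc mult.assoc)
  also have "\<dots> = (Tpow \<nu> n m * Tpow \<nu> n m') * (T (\<nu> (Suc n)) ^ m (Suc n) *
    T (\<nu> (Suc n)) ^ m' (Suc n))"
    by (simp add: T_power_Tpow_commute mult.assoc)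
  finally show ?case by (simp add: Suc Tpow_Suc power_add)
qed (simp add: Tpow_0)

lemma hom_op_Tpow: "hom_op (Tpow \<nu> n m)"
  by (induction n) (simp_all add: Tpow_0 Tpow_Suc hom_op_1 hom_op_times hom_op_power hom_op_T)

lemma T_power_rconst: "app_endo (T i ^ k) (rconst c) = rconst c"
  by (induction k) (simp_all add: one_endo.rep_eq times_endo.rep_eq app_T shift_rconst)

lemma Tpow_rconst: "app_endo (Tpow \<nu> n m) (rconst c) = rconst c"
  by (induction n) (simp_all add: Tpow_0 Tpow_Suc one_endo.rep_eq times_endo.rep_eq T_power_rconst)

lemma T_power_zvar: "app_endo (T i ^ k) (zvar v :: 'k::field_char_0 ratfun) =
  zvar v - of_nat (if i = v then k else 0)"
proof (induction k)
  case (Suc k)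
  have "app_endo (T i ^ Suc k) (zvar v :: 'k ratfun) = app_endo (T i) (app_endo (T i ^ k) (zvar v))"
    by (simp add: times_endo.rep_eq)
  also have "\<dots> = app_endo (T i) (zvar v) - of_nat (if i = v then k else 0)"
    unfolding Suc by (simp add: hom_op_simps[OF hom_op_T] hom_op_of_nat[OF hom_op_T])
  finally show ?case by (cases "i = v") (simp_all add: app_T shift_zvar)
qed (simp add: one_endo.rep_eq)

lemma Tpow_zvar: "app_endo (Tpow \<nu> n m) (zvar v :: 'k::field_char_0 ratfun) =
  zvar v - of_nat (\<Sum>a=1..n. if \<nu> a = v then m a else 0)"
proof (induction n)
  case (Suc n)
  have "app_endo (Tpow \<nu> (Suc n) m) (zvar v :: 'k ratfun) =
    app_endo (Tpow \<nu> n m) (zvar v) - of_nat (if \<nu> (Suc n) = v then m (Suc n) else 0)"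
    by (simp add: Tpow_Suc times_endo.rep_eq T_power_zvar hom_op_simps[OF hom_op_Tpow]
      hom_op_of_nat[OF hom_op_Tpow])
  then show ?case by (simp add: Suc)
qed (simp add: Tpow_0 one_endo.rep_eq)

lemma Tpow_zvar_inj:
  assumes "inj_on \<nu> {1..n}" "a \<in> {1..n}"
  shows "app_endo (Tpow \<nu> n m) (zvar (\<nu> a)) = zvar (\<nu> a) - of_nat (m a)"
proof -
  have "(\<Sum>b=1..n. if \<nu> b = \<nu> a then m b else 0) = (\<Sum>b=1..n. if a = b then m b else 0)"
    using assms by (intro sum.cong refl if_cong) (auto dest: inj_onD)
  then show ?thesis using assms by (simp add: Tpow_zvar)
qed

text \<open>
  Compare the coefficients of the monomials of degree one.
\<close>
lemma int_indep_zvar: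
  assumes "inj_on \<nu> K" "finite K"
  shows "int_indep K (\<lambda>a. zvar (\<nu> a) :: 'k::field_char_0 ratfun)"
  unfolding int_indep_def
proof (intro allI impI ballI)
  fix m :: "nat \<Rightarrow> int" and a
  assume "(\<Sum>a\<in>K. of_int (m a) * zvar (\<nu> a)) \<in> (\<int> :: 'k ratfun set)" and a: "a \<in> K"
  then obtain j where j: "(\<Sum>a\<in>K. of_int (m a) * zvar (\<nu> a)) = (of_int j :: 'k ratfun)"
    by (auto elim: Ints_cases)
  have inj1: "Poly_Mapping.single u (1::nat) = Poly_Mapping.single v 1 \<longleftrightarrow> u = v" for u v :: nat
    by (metis lookup_single_eq lookup_single_not_eq zero_neq_one)
  have ne0: "Poly_Mapping.single u (1::nat) \<noteq> 0" for u :: nat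
    by (metis lookup_single_eq lookup_zero zero_neq_one)
  have F: "of_int i = Fract (of_int i :: 'k mpoly) 1" for i
    by (cases i) (simp_all add: Fract_of_nat_eq[symmetric] minus_fract One_fract_def)
  have S: "Fract (sum f A) 1 = (\<Sum>x\<in>A. Fract (f x) 1)" for f :: "nat \<Rightarrow> 'k mpoly" and A
  proof (induction A rule: infinite_finite_induct)
    case (insert x A)
    from insert.hyps show ?case by (simp add: insert.IH[symmetric])
  qed (simp_all add: Zero_fract_def)
  have "Fract (\<Sum>a\<in>K. of_int (m a) * pvar (\<nu> a)) 1 = Fract (of_int j :: 'k mpoly) 1"
    unfolding S using j by (simp add: F zvar_def)
  then have "(\<Sum>a\<in>K. of_int (m a) * pvar (\<nu> a)) = (of_int j :: 'k mpoly)"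
    by (simp add: eq_fract)
  then have "Poly_Mapping.lookup (\<Sum>a\<in>K. of_int (m a) * pvar (\<nu> a)) (Poly_Mapping.single (\<nu> a) 1) =
      Poly_Mapping.lookup (of_int j :: 'k mpoly) (Poly_Mapping.single (\<nu> a) 1)" by simp
  also have "\<dots> = 0" by (simp add: lookup_of_int ne0[simplified])
  also have "of_int (m b) * pvar (\<nu> b) = Poly_Mapping.single (Poly_Mapping.single (\<nu> b) 1) (of_int
    (m b) :: 'k)" for b
    unfolding single_of_int[symmetric] pvar_def by (simp add: mult_single del: single_of_int)
  then have "Poly_Mapping.lookup (\<Sum>a\<in>K. of_int (m a) * pvar (\<nu> a)) (Poly_Mapping.single (\<nu> a) 1) =
     (\<Sum>b\<in>K. if a = b then of_int (m b) else 0 :: 'k)"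
    unfolding lookup_sum using assms a
    by (intro sum.cong refl) (auto simp: lookup_single when_def inj1[simplified] dest: inj_onD)
  finally have "(of_int (m a) :: 'k) = 0" using assms a by simp
  then show "m a = 0" by simp
qed

definition shift_sum :: "(nat \<Rightarrow> nat) \<Rightarrow> nat \<Rightarrow> (nat set \<Rightarrow> 'k::field_char_0 ratfun) \<Rightarrow> 'k oper" where
  "shift_sum \<nu> n c = (\<Sum>I\<in>Pow {1..n}. mult_op (c I) * Tpow \<nu> n (\<lambda>a. of_bool (a \<in> I)))"

lemma shift_sum_mult:
  "shift_sum \<nu> n c * shift_sum \<nu> n d = (\<Sum>I\<in>Pow {1..n}. \<Sum>J\<in>Pow {1..n}.
     mult_op (c I * app_endo (Tpow \<nu> n (\<lambda>a. of_bool (a \<in> I))) (d J)) *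
     Tpow \<nu> n (\<lambda>a. of_bool (a \<in> I) + of_bool (a \<in> J)))"
  unfolding shift_sum_def sum_product
proof (intro sum.cong refl)
  fix I J
  let ?I = "Tpow \<nu> n (\<lambda>a. of_bool (a \<in> I))" and ?J = "Tpow \<nu> n (\<lambda>a. of_bool (a \<in> J))"
  have "mult_op (c I) * ?I * (mult_op (d J) * ?J) = mult_op (c I) * (?I * mult_op (d J)) * ?J"
    by (simp only: mult.assoc)
  also have "\<dots> = mult_op (c I * app_endo ?I (d J)) * (?I * ?J)"
    unfolding hom_op_mult_op[OF hom_op_Tpow] by (simp only: mult.assoc mult_op_hom)
  finally show "mult_op (c I) * ?I * (mult_op (d J) * ?J) =
    mult_op (c I * app_endo ?I (d J)) * Tpow \<nu> n (\<lambda>a. of_bool (a \<in> I) + of_bool (a \<in> J))"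
    unfolding Tpow_add .
qed

text \<open>
  A pair of sets is given by its intersection, its symmetric difference and the splitting of
  the latter.
\<close>
lemma sum_pairs_by_overlap:
  assumes "finite V"
  shows "(\<Sum>I\<in>Pow V. \<Sum>J\<in>Pow V. F I J) =
    (\<Sum>(M, K)\<in>{(M, K). M \<subseteq> V \<and> K \<subseteq> V \<and> M \<inter> K = {}}. \<Sum>S\<in>Pow K. F (M \<union> S) (M \<union> (K - S)))"
proof -
  have fin: "finite {(M, K). M \<subseteq> V \<and> K \<subseteq> V \<and> M \<inter> K = {}}"
    by (rule finite_subset[of _ "Pow V \<times> Pow V"]) (use assms in auto)
  have "(\<Sum>I\<in>Pow V. \<Sum>J\<in>Pow V. F I J) = (\<Sum>(I, J)\<in>Pow V \<times> Pow V. F I J)"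
    by (simp add: sum.cartesian_product)
  also have "\<dots> = (\<Sum>(N, S)\<in>(SIGMA N:{(M, K). M \<subseteq> V \<and> K \<subseteq> V \<and> M \<inter> K = {}}. Pow (snd N)).
      F (fst N \<union> S) (fst N \<union> (snd N - S)))"
  proof (rule sum.reindex_bij_witness[of _ "\<lambda>(N, S). (fst N \<union> S, fst N \<union> (snd N - S))"
          "\<lambda>(I, J). ((I \<inter> J, (I - J) \<union> (J - I)), I - J)"], goal_cases)
    case (1 p)
    then show ?case by (cases p) auto
  next
    case (2 p)
    then show ?case by (cases p) auto
  next
    case (3 q)
    obtain M K S where q: "q = ((M, K), S)" by (metis prod.exhaust)
    have "S \<subseteq> K" "M \<inter> K = {}" using 3 q by auto
    then have "(M \<union> S) \<inter> (M \<union> (K - S)) = M" "(M \<union> S) - (M \<union> (K - S)) = S"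
      "(M \<union> (K - S)) - (M \<union> S) = K - S" "S \<union> (K - S) = K" by blast+
    then show ?case by (simp add: q)
  next
    case (4 q)
    obtain M K S where q: "q = ((M, K), S)" by (metis prod.exhaust)
    then show ?case using 4 by auto
  next
    case (5 p)
    obtain I J where p: "p = (I, J)" by (cases p)
    have "I \<inter> J \<union> (I - J) = I" "I \<inter> J \<union> ((I - J) \<union> (J - I) - (I - J)) = J" by blast+
    then show ?case by (simp add: p)
  qed
  also have "\<dots> = (\<Sum>N\<in>{(M, K). M \<subseteq> V \<and> K \<subseteq> V \<and> M \<inter> K = {}}. \<Sum>S\<in>Pow (snd N).
      F (fst N \<union> S) (fst N \<union> (snd N - S)))"
    by (rule sum.Sigma[symmetric]) (use fin assms in \<open>auto intro: finite_subset\<close>)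
  finally show ?thesis by (simp add: case_prod_beta)
qed

context two_coloured
begin

lemma op_coeff_cong:
  assumes "I \<subseteq> V" "\<And>a. a \<in> V \<Longrightarrow> z a = z' a"
  shows "op_coeff w \<epsilon> V p I z = op_coeff w \<epsilon> V p I z'"
  unfolding op_coeff_def using assms by (intro arg_cong2[of _ _ _ _ "(*)"] prod.cong refl) auto

lemma hom_op_op_coeff:
  assumes D: "hom_op D" "app_endo D r = r" "app_endo D \<epsilon> = \<epsilon>" "app_endo D (snd p) = snd p"
    and w: "\<And>a x. app_endo D (w a x) = w a (app_endo D x)"
  shows "app_endo D (op_coeff w \<epsilon> V p I z) = op_coeff w \<epsilon> V p I (\<lambda>a. app_endo D (z a))"
proof -
  have g: "app_endo D (keep_factor p a x) = keep_factor p a (app_endo D x)" for a x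
    by (simp add: keep_factor_def hom_op_simps[OF D(1)] D)
  have h: "app_endo D (move_factor a b d) = move_factor a b (app_endo D d)" for a b d
    by (simp add: move_factor_def hom_op_simps[OF D(1)] hom_op_inverse[OF D(1)] D)
  show ?thesis unfolding op_coeff_def
    by (simp add: hom_op_simps[OF D(1)] hom_op_of_bool[OF D(1)] hom_op_power_app[OF D(1)]
      hom_op_prod[OF D(1)]
        D w g h case_prod_beta if_distrib[of "app_endo D"] cong: if_cong)
qed

end

text \<open>
  In both products the coefficient for given \<open>M\<close> and \<open>K\<close> is a sum over the splittings of \<open>K\<close>,
  and these sums agree by \<open>sum_op_coeff_mult\<close>.
\<close>
lemma shift_sum_op_coeff_commute:
  fixes r \<epsilon> :: "'k::field_char_0 ratfun" and \<nu> :: "nat \<Rightarrow> nat" and isx :: "nat \<Rightarrow> bool"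
  assumes \<nu>: "inj_on \<nu> {1..n}"
    and inv: "\<And>m. app_endo (Tpow \<nu> n m) r = r" "\<And>m. app_endo (Tpow \<nu> n m) \<epsilon> = \<epsilon>"
      "\<And>m. app_endo (Tpow \<nu> n m) (snd p1) = snd p1" "\<And>m. app_endo (Tpow \<nu> n m) (snd p2) = snd p2"
    and w: "\<And>m a x. app_endo (Tpow \<nu> n m) (w a x) = w a (app_endo (Tpow \<nu> n m) x)"
  defines "D \<equiv> \<lambda>p. shift_sum \<nu> n (\<lambda>I. two_coloured.op_coeff isx r w \<epsilon> {1..n} p I (\<lambda>a. zvar (\<nu> a)))"
  shows "D p1 * D p2 = D p2 * D p1"
proof -
  interpret two_coloured isx r .
  let ?z = "\<lambda>a. zvar (\<nu> a) :: 'k ratfun" and ?V = "{1..n}"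
  let ?P = "{(M, K). M \<subseteq> ?V \<and> K \<subseteq> ?V \<and> M \<inter> K = {}}"
  have key: "D p * D p' = (\<Sum>(M, K)\<in>?P.
      mult_op (\<Sum>S\<in>Pow K. op_coeff w \<epsilon> ?V p (M \<union> S) ?z *
          op_coeff w \<epsilon> ?V p' (M \<union> (K - S)) (\<lambda>a. ?z a - of_bool (a \<in> M \<union> S))) *
      Tpow \<nu> n (\<lambda>a. 2 * of_bool (a \<in> M) + of_bool (a \<in> K)))"
    if p: "\<And>m. app_endo (Tpow \<nu> n m) (snd p') = snd p'" for p p'
  proof -
    have "app_endo (Tpow \<nu> n (\<lambda>a. of_bool (a \<in> I))) (op_coeff w \<epsilon> ?V p' J ?z) =
        op_coeff w \<epsilon> ?V p' J (\<lambda>a. ?z a - of_bool (a \<in> I))" if "J \<subseteq> ?V" for I J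
    proof -
      let ?D = "Tpow \<nu> n (\<lambda>a. of_bool (a \<in> I)) :: 'k oper"
      have "app_endo ?D (op_coeff w \<epsilon> ?V p' J ?z) = op_coeff w \<epsilon> ?V p' J (\<lambda>a. app_endo ?D (?z a))"
        by (rule hom_op_op_coeff) (simp_all only: hom_op_Tpow inv p w)
      also have "\<dots> = op_coeff w \<epsilon> ?V p' J (\<lambda>a. ?z a - of_bool (a \<in> I))"
        by (rule op_coeff_cong[OF that]) (simp add: Tpow_zvar_inj[OF \<nu>])
      finally show ?thesis .
    qed
    then have "D p * D p' = (\<Sum>I\<in>Pow ?V. \<Sum>J\<in>Pow ?V.
        mult_op (op_coeff w \<epsilon> ?V p I ?z * op_coeff w \<epsilon> ?V p' J (\<lambda>a. ?z a - of_bool (a \<in> I))) *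
        Tpow \<nu> n (\<lambda>a. of_bool (a \<in> I) + of_bool (a \<in> J)))"
      unfolding D_def shift_sum_mult by (intro sum.cong refl) simp
    also have "\<dots> = (\<Sum>(M, K)\<in>?P. \<Sum>S\<in>Pow K.
        mult_op (op_coeff w \<epsilon> ?V p (M \<union> S) ?z *
          op_coeff w \<epsilon> ?V p' (M \<union> (K - S)) (\<lambda>a. ?z a - of_bool (a \<in> M \<union> S))) *
        Tpow \<nu> n (\<lambda>a. of_bool (a \<in> M \<union> S) + of_bool (a \<in> M \<union> (K - S))))"
      by (rule sum_pairs_by_overlap) simp
    also have "\<dots> = (\<Sum>(M, K)\<in>?P.
      mult_op (\<Sum>S\<in>Pow K. op_coeff w \<epsilon> ?V p (M \<union> S) ?z *
          op_coeff w \<epsilon> ?V p' (M \<union> (K - S)) (\<lambda>a. ?z a - of_bool (a \<in> M \<union> S))) *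
      Tpow \<nu> n (\<lambda>a. 2 * of_bool (a \<in> M) + of_bool (a \<in> K)))"
    proof (intro sum.cong refl, clarify)
      fix M K :: "nat set" assume MK: "M \<inter> K = {}"
      have "(\<lambda>a. of_bool (a \<in> M \<union> S) + of_bool (a \<in> M \<union> (K - S)) :: nat) =
          (\<lambda>a. 2 * of_bool (a \<in> M) + of_bool (a \<in> K))" if "S \<subseteq> K" for S
        using MK that by (auto simp: fun_eq_iff)
      then show "(\<Sum>S\<in>Pow K. mult_op (op_coeff w \<epsilon> ?V p (M \<union> S) ?z *
          op_coeff w \<epsilon> ?V p' (M \<union> (K - S)) (\<lambda>a. ?z a - of_bool (a \<in> M \<union> S))) *
          Tpow \<nu> n (\<lambda>a. of_bool (a \<in> M \<union> S) + of_bool (a \<in> M \<union> (K - S)))) =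
        mult_op (\<Sum>S\<in>Pow K. op_coeff w \<epsilon> ?V p (M \<union> S) ?z *
          op_coeff w \<epsilon> ?V p' (M \<union> (K - S)) (\<lambda>a. ?z a - of_bool (a \<in> M \<union> S))) *
          Tpow \<nu> n (\<lambda>a. 2 * of_bool (a \<in> M) + of_bool (a \<in> K))"
        unfolding mult_op_sum sum_distrib_right by (intro sum.cong refl) simp
    qed
    finally show ?thesis .
  qed
  show ?thesis unfolding key[OF inv(4)] key[OF inv(3)]
  proof (intro sum.cong refl, clarify)
    fix M K :: "nat set" assume "M \<subseteq> ?V" "K \<subseteq> ?V" "M \<inter> K = {}"
    then show "mult_op (\<Sum>S\<in>Pow K. op_coeff w \<epsilon> ?V p1 (M \<union> S) ?z *
          op_coeff w \<epsilon> ?V p2 (M \<union> (K - S)) (\<lambda>a. ?z a - of_bool (a \<in> M \<union> S))) *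
          Tpow \<nu> n (\<lambda>a. 2 * of_bool (a \<in> M) + of_bool (a \<in> K)) =
        mult_op (\<Sum>S\<in>Pow K. op_coeff w \<epsilon> ?V p2 (M \<union> S) ?z *
          op_coeff w \<epsilon> ?V p1 (M \<union> (K - S)) (\<lambda>a. ?z a - of_bool (a \<in> M \<union> S))) *
          Tpow \<nu> n (\<lambda>a. 2 * of_bool (a \<in> M) + of_bool (a \<in> K))"
      by (subst sum_op_coeff_mult) (auto intro!: int_indep_zvar inj_on_subset[OF \<nu>]
        finite_subset[of K ?V])
  qed
qed

section \<open>Expansion of row determinants\<close>

text \<open>
  Polynomials in \<open>t\<close> over the commutative field act by multiplication. This embedding allows
  the determinants to be computed in the commutative ring \<open>'a poly\<close>.
\<close>
definition poly_op :: "'a::field poly \<Rightarrow> 'a endo tpoly" where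
  "poly_op p = (\<Sum>i\<le>degree p. Poly_Mapping.single i (mult_op (coeff p i)))"

lemma lookup_poly_op: "Poly_Mapping.lookup (poly_op p) i = mult_op (coeff p i)"
proof -
  have "Poly_Mapping.lookup (poly_op p) i = (\<Sum>j\<le>degree p. if i = j then mult_op (coeff p j) else 0)"
    unfolding poly_op_def lookup_sum by (intro sum.cong refl) (simp add: lookup_single when_def)
  also have "\<dots> = mult_op (coeff p i)" by (simp add: coeff_eq_0 mult_op_hom)
  finally show ?thesis .
qed

lemma poly_op_add: "poly_op (p + q) = poly_op p + poly_op q"
  by (rule poly_mapping_eqI) (simp add: lookup_poly_op lookup_add mult_op_hom)

lemma poly_op_0: "poly_op 0 = 0"
  by (rule poly_mapping_eqI) (simp add: lookup_poly_op mult_op_hom)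

lemma poly_op_sum: "poly_op (sum f A) = (\<Sum>x\<in>A. poly_op (f x))"
  by (induction A rule: infinite_finite_induct) (simp_all add: poly_op_0 poly_op_add)

lemma poly_op_monom: "poly_op (monom a k) = Poly_Mapping.single k (mult_op a)"
  by (rule poly_mapping_eqI) (simp add: lookup_poly_op lookup_single when_def mult_op_hom)

lemma poly_op_mult: "poly_op (p * q) = poly_op p * poly_op q"
proof -
  have "poly_op (p * q) = poly_op ((\<Sum>i\<le>degree p. monom (coeff p i) i) *
    (\<Sum>i\<le>degree q. monom (coeff q i) i))"
    by (simp only: poly_as_sum_of_monoms)
  also have "\<dots> = (\<Sum>i\<le>degree p. \<Sum>j\<le>degree q.
      Poly_Mapping.single (i + j) (mult_op (coeff p i * coeff q j)))"
    by (simp add: sum_product poly_op_sum mult_monom poly_op_monom)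
  also have "\<dots> = poly_op p * poly_op q"
    by (simp add: poly_op_def[of p] poly_op_def[of q] sum_product mult_single mult_op_hom)
  finally show ?thesis .
qed

lemma poly_op_const: "poly_op [:a:] = tconst (mult_op a)"
  using poly_op_monom[of a 0] by (simp add: monom_0)

lemma poly_op_1: "poly_op 1 = 1"
  using poly_op_const[of 1] by (simp add: one_pCons mult_op_hom)

lemma poly_op_uminus: "poly_op (- p) = - poly_op p"
  by (rule poly_mapping_eqI) (simp add: lookup_poly_op mult_op_hom)

lemma poly_op_diff: "poly_op (p - q) = poly_op p - poly_op q"
  using poly_op_add[of p "- q"] by (simp add: poly_op_uminus)

lemma poly_op_of_int: "poly_op (of_int k) = of_int k"
proof -
  have "poly_op (of_nat j) = of_nat j" for j by (induction j) (simp_all add: poly_op_0 poly_op_1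
    poly_op_add)
  then show ?thesis by (cases k) (simp_all add: poly_op_uminus poly_op_diff poly_op_1)
qed

lemma poly_op_linear: "poly_op [:a, 1:] = tconst (mult_op a) + tvar"
proof -
  have "[:a, 1:] = [:a:] + monom 1 1" by (simp add: monom_altdef)
  then show ?thesis by (simp only: poly_op_add poly_op_const poly_op_monom mult_op_hom)
qed

lemma poly_op_smult: "poly_op (Polynomial.smult a p) = tconst (mult_op a) * poly_op p"
  using poly_op_mult[of "[:a:]" p] by (simp add: poly_op_const)

lemma lookup_poly_op_tconst: "Poly_Mapping.lookup (poly_op p * tconst D) i = mult_op (coeff p i) *
  D"
proof -
  have "poly_op p * tconst D = (\<Sum>i\<le>degree p. Poly_Mapping.single i (mult_op (coeff p i) * D))"
    by (simp add: poly_op_def sum_distrib_right mult_single)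
  then have "Poly_Mapping.lookup (poly_op p * tconst D) i =
      (\<Sum>j\<le>degree p. if i = j then mult_op (coeff p j) * D else 0)"
    by (simp add: lookup_sum lookup_single when_def eq_commute)
  then show ?thesis by (simp add: coeff_eq_0 mult_op_hom)
qed

lemma poly_op_tconst_commute:
  assumes "hom_op D" "\<And>i. app_endo D (coeff p i) = coeff p i"
  shows "tconst D * poly_op p = poly_op p * tconst D"
  unfolding poly_op_def sum_distrib_right sum_distrib_left
  by (intro sum.cong refl) (simp add: mult_single hom_op_mult_op[OF assms(1)] assms(2))

lemma Tpow_cong: "(\<And>a. a \<in> {1..n} \<Longrightarrow> m a = m' a) \<Longrightarrow> Tpow \<nu> n m = Tpow \<nu> n m'"
  by (induction n) (simp_all add: Tpow_0 Tpow_Suc)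

text \<open>
  Shifts of earlier rows do not act on the entries of a later row, so that all coefficients
  can be collected on the left.
\<close>
lemma prod_rows:
  fixes \<alpha> \<beta> :: "nat \<Rightarrow> 'k::field_char_0 ratfun poly"
  assumes inv: "\<And>m a k i. m < a \<Longrightarrow> a \<le> n \<Longrightarrow> app_endo (Tpow \<nu> m k) (coeff (\<alpha> a) i) = coeff (\<alpha> a) i"
     "\<And>m a k i. m < a \<Longrightarrow> a \<le> n \<Longrightarrow> app_endo (Tpow \<nu> m k) (coeff (\<beta> a) i) = coeff (\<beta> a) i"
  shows "prod_list (map (\<lambda>a. poly_op (\<alpha> a) + poly_op (\<beta> a) * tconst (T (\<nu> a))) [1..<n + 1]) =
    (\<Sum>I\<in>Pow {1..n}. poly_op (\<Prod>a\<in>{1..n}. if a \<in> I then \<beta> a else \<alpha> a) *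
      tconst (Tpow \<nu> n (\<lambda>a. of_bool (a \<in> I))))"
  using inv
proof (induction n)
  case 0
  then show ?case by (simp add: poly_op_1 Tpow_0)
next
  case (Suc n)
  let ?A = "\<lambda>I. \<Prod>a\<in>{1..n}. if a \<in> I then \<beta> a else \<alpha> a"
  let ?T = "\<lambda>I. Tpow \<nu> n (\<lambda>a. of_bool (a \<in> I)) :: 'k oper"
  let ?n = "Suc n"
  have V: "{1..?n} = insert ?n {1..n}" by auto
  have step: "poly_op (?A I) * tconst (?T I) * (poly_op (\<alpha> ?n) + poly_op (\<beta> ?n) *
    tconst (T (\<nu> ?n))) =
    (\<Sum>s\<in>UNIV. poly_op (\<Prod>a\<in>{1..?n}. if a \<in> insert_if s ?n I then \<beta> a else \<alpha> a) *
       tconst (Tpow \<nu> ?n (\<lambda>a. of_bool (a \<in> insert_if s ?n I))))" if I: "I \<in> Pow {1..n}" for I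
  proof -
    have nI: "?n \<notin> I" using I by auto
    have A: "(\<Prod>a\<in>{1..?n}. if a \<in> insert_if s ?n I then \<beta> a else \<alpha> a) = ?A I * (if s then
      \<beta> ?n else \<alpha> ?n)" for s
    proof -
      have "(\<Prod>a\<in>{1..n}. if a \<in> insert_if s ?n I then \<beta> a else \<alpha> a) = ?A I"
        by (intro prod.cong refl) (auto simp: insert_if_def)
      then show ?thesis using nI unfolding V by (simp add: insert_if_def mult.commute)
    qed
    have P: "Tpow \<nu> ?n (\<lambda>a. of_bool (a \<in> insert_if s ?n I)) = ?T I * (if s then T (\<nu> ?n) else 1)"
      for s
    proof -
      have "Tpow \<nu> n (\<lambda>a. of_bool (a \<in> insert_if s ?n I)) = ?T I"
        by (rule Tpow_cong) (auto simp: insert_if_def)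
      then show ?thesis using nI by (simp add: Tpow_Suc insert_if_def)
    qed
    have c: "tconst (?T I) * poly_op (\<alpha> ?n) = poly_op (\<alpha> ?n) * tconst (?T I)"
       "tconst (?T I) * poly_op (\<beta> ?n) = poly_op (\<beta> ?n) * tconst (?T I)"
      by (rule poly_op_tconst_commute[OF hom_op_Tpow]; rule Suc.prems; simp)+
    have tc: "tconst (X * Y) = tconst X * tconst Y" for X Y :: "'k oper" by (simp add: mult_single)
    have "poly_op (?A I) * tconst (?T I) * (poly_op (\<alpha> ?n) + poly_op (\<beta> ?n) * tconst (T (\<nu> ?n))) =
      poly_op (?A I) * (tconst (?T I) * poly_op (\<alpha> ?n)) + poly_op (?A I) * (tconst (?T I) *
        poly_op (\<beta> ?n)) * tconst (T (\<nu> ?n))"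
      by (simp only: distrib_left mult.assoc)
    also have "\<dots> = poly_op (?A I * \<alpha> ?n) * tconst (?T I * 1) + poly_op (?A I * \<beta> ?n) *
      tconst (?T I * T (\<nu> ?n))"
      unfolding c poly_op_mult tc[of "?T I" "T (\<nu> ?n)"] by (simp only: mult.assoc mult_1_right)
    finally show ?thesis unfolding sum_bool A P by (simp add: add.commute)
  qed
  have "prod_list (map (\<lambda>a. poly_op (\<alpha> a) + poly_op (\<beta> a) * tconst (T (\<nu> a))) [1..<?n + 1]) =
    prod_list (map (\<lambda>a. poly_op (\<alpha> a) + poly_op (\<beta> a) * tconst (T (\<nu> a))) [1..<n + 1]) *
      (poly_op (\<alpha> ?n) + poly_op (\<beta> ?n) * tconst (T (\<nu> ?n)))" by simp
  also have "prod_list (map (\<lambda>a. poly_op (\<alpha> a) + poly_op (\<beta> a) * tconst (T (\<nu> a))) [1..<n + 1]) =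
    (\<Sum>I\<in>Pow {1..n}. poly_op (?A I) * tconst (?T I))"
    by (rule Suc.IH) (use Suc.prems in auto)
  also have "(\<Sum>I\<in>Pow {1..n}. poly_op (?A I) * tconst (?T I)) * (poly_op (\<alpha> ?n) + poly_op (\<beta> ?n) *
    tconst (T (\<nu> ?n))) =
    (\<Sum>I\<in>Pow {1..n}. \<Sum>s\<in>UNIV. poly_op (\<Prod>a\<in>{1..?n}. if a \<in> insert_if s ?n I then \<beta> a else \<alpha> a) *
       tconst (Tpow \<nu> ?n (\<lambda>a. of_bool (a \<in> insert_if s ?n I))))"
    unfolding sum_distrib_right by (intro sum.cong refl step)
  also have "\<dots> = (\<Sum>I\<in>Pow {1..?n}. poly_op (\<Prod>a\<in>{1..?n}. if a \<in> I then \<beta> a else \<alpha> a) *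
      tconst (Tpow \<nu> ?n (\<lambda>a. of_bool (a \<in> I))))"
    unfolding V by (rule sum_Pow_insert[symmetric]) auto
  finally show ?case .
qed

lemma bij_imp_permutes_fixing: "bij p \<Longrightarrow> (\<And>i. i \<notin> S \<Longrightarrow> p i = i) \<Longrightarrow> p permutes S"
  by (simp add: permutes_def bij_iff)

text \<open>
  Permutations of \<open>{1..n}\<close> and of \<open>{0..<n}\<close> correspond by conjugation with a cycle of
  \<open>{0..n}\<close>, which preserves signs.
\<close>
lemma Leibniz_ndet_shift:
  fixes f :: "nat \<Rightarrow> nat \<Rightarrow> 'a::comm_ring_1"
  shows "(\<Sum>p | p permutes {1..n}. signof p * (\<Prod>a\<in>{1..n}. f a (p a))) =
    ndet n (\<lambda>i j. f (Suc i) (Suc j))"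
proof -
  define b where "b i = (if i < n then Suc i else if i = n then 0 else i)" for i
  define c where "c i = (if i = 0 then n else if i \<le> n then i - 1 else i)" for i
  have bc: "b (c i) = i" "c (b i) = i" for i by (auto simp: b_def c_def)
  have bij: "bij b" by (rule bij_betw_byWitness[of _ c]) (auto simp: bc)
  then have b_perm: "b permutes {..n}" by (intro bij_imp_permutes_fixing) (auto simp: b_def)
  have invb: "Hilbert_Choice.inv b = c" by (rule inv_equality) (auto simp: bc)
  have pb: "permutation b" using b_perm by (auto simp: permutation_permutes)
  have conj: "b \<circ> q \<circ> c permutes {1..n}" if q: "q permutes {0..<n}" for q
  proof (rule bij_imp_permutes_fixing)
    show "bij (b \<circ> q \<circ> c)"
      using bij permutes_bij[OF q] by (metis bij_comp bij_imp_bij_inv invb)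
    show "(b \<circ> q \<circ> c) i = i" if "i \<notin> {1..n}" for i
    proof -
      have "c i \<notin> {0..<n}" using that by (auto simp: c_def)
      then show ?thesis using permutes_not_in[OF q] by (simp add: bc)
    qed
  qed
  have conj': "c \<circ> p \<circ> b permutes {0..<n}" if p: "p permutes {1..n}" for p
  proof (rule bij_imp_permutes_fixing)
    show "bij (c \<circ> p \<circ> b)"
      using bij permutes_bij[OF p] by (metis bij_comp bij_imp_bij_inv invb)
    show "(c \<circ> p \<circ> b) i = i" if "i \<notin> {0..<n}" for i
    proof -
      have "b i \<notin> {1..n}" using that by (auto simp: b_def)
      then show ?thesis using permutes_not_in[OF p] by (simp add: bc)
    qed
  qed
  show ?thesis unfolding ndet_Leibniz
  proof (rule sum.reindex_bij_witness[of _ "\<lambda>q. b \<circ> q \<circ> c" "\<lambda>p. c \<circ> p \<circ> b"])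
    fix p assume "p \<in> {p. p permutes {1..n}}"
    then have p: "p permutes {1..n}" by simp
    show "b \<circ> (c \<circ> p \<circ> b) \<circ> c = p" by (auto simp: fun_eq_iff bc)
    show "c \<circ> p \<circ> b \<in> {p. p permutes {0..<n}}" using conj'[OF p] by simp
    have pp: "permutation p" using p by (auto simp: permutation_permutes)
    have pc: "permutation c" using permutation_inverse[OF pb] invb by simp
    have "sign (c \<circ> p \<circ> b) = sign c * sign p * sign b"
      using pp pb pc by (simp add: sign_compose permutation_compose)
    also have "sign c = sign b" using sign_inverse[OF pb] invb by simp
    also have "sign b * sign p * sign b = sign p * (sign b * sign b)" by (simp only: mult_ac)
    also have "\<dots> = sign p" by (simp add: sign_idempotent)
    finally have s: "sign (c \<circ> p \<circ> b) = sign p" .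
    have "(\<Prod>i = 0..<n. f (Suc i) (Suc ((c \<circ> p \<circ> b) i))) = (\<Prod>a\<in>{1..n}. f a (p a))"
    proof (rule prod.reindex_bij_witness[of _ "\<lambda>a. a - 1" Suc])
      fix i assume i: "i \<in> {0..<n}"
      then have "p (Suc i) \<in> {1..n}" using permutes_in_image[OF p, of "Suc i"] by simp
      then show "f (Suc i) (p (Suc i)) = f (Suc i) (Suc ((c \<circ> p \<circ> b) i))"
        using i by (simp add: b_def c_def)
    qed auto
    then show "signof (c \<circ> p \<circ> b) * (\<Prod>i = 0..<n. f (Suc i) (Suc ((c \<circ> p \<circ> b) i))) =
      signof p * (\<Prod>a\<in>{1..n}. f a (p a))" unfolding s by simp
  next
    fix q assume "q \<in> {p. p permutes {0..<n}}"
    then show "c \<circ> (b \<circ> q \<circ> c) \<circ> b = q" "b \<circ> q \<circ> c \<in> {p. p permutes {1..n}}"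
      using conj by (auto simp: fun_eq_iff bc)
  qed
qed

lemma rowdet_expansion:
  fixes \<alpha> \<beta> :: "nat \<Rightarrow> nat \<Rightarrow> 'k::field_char_0 ratfun poly"
  assumes A: "\<And>a b. a \<in> {1..n} \<Longrightarrow> b \<in> {1..n} \<Longrightarrow> A a b = poly_op (\<alpha> a b) + poly_op (\<beta> a b) *
    tconst (T (\<nu> a))"
    and inv: "\<And>m a b k i. m < a \<Longrightarrow> a \<le> n \<Longrightarrow> app_endo (Tpow \<nu> m k) (coeff (\<alpha> a b) i) = coeff (\<alpha> a b) i"
     "\<And>m a b k i. m < a \<Longrightarrow> a \<le> n \<Longrightarrow> app_endo (Tpow \<nu> m k) (coeff (\<beta> a b) i) = coeff (\<beta> a b) i"
  shows "rowdet n A = (\<Sum>I\<in>Pow {1..n}.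
    poly_op (ndet n (\<lambda>i j. if Suc i \<in> I then \<beta> (Suc i) (Suc j) else \<alpha> (Suc i) (Suc j))) *
    tconst (Tpow \<nu> n (\<lambda>a. of_bool (a \<in> I))))"
proof -
  let ?T = "\<lambda>I. tconst (Tpow \<nu> n (\<lambda>a. of_bool (a \<in> I)) :: 'k oper)"
  have "rowdet n A = (\<Sum>p | p permutes {1..n}. of_int (sign p) *
     (\<Sum>I\<in>Pow {1..n}. poly_op (\<Prod>a\<in>{1..n}. if a \<in> I then \<beta> a (p a) else \<alpha> a (p a)) * ?T I))"
    unfolding rowdet_def
  proof (intro sum.cong refl)
    fix p assume "p \<in> {p. p permutes {1..n}}"
    then have p: "p permutes {1..n}" by simp
    have m: "map (\<lambda>i. A i (p i)) [1..<n + 1] =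
      map (\<lambda>a. poly_op (\<alpha> a (p a)) + poly_op (\<beta> a (p a)) * tconst (T (\<nu> a))) [1..<n + 1]"
      using A permutes_in_image[OF p] by (intro map_cong refl) auto
    have "prod_list (map (\<lambda>i. A i (p i)) [1..<n + 1]) =
      (\<Sum>I\<in>Pow {1..n}. poly_op (\<Prod>a\<in>{1..n}. if a \<in> I then \<beta> a (p a) else \<alpha> a (p a)) * ?T I)"
      unfolding m by (rule prod_rows) (rule inv; assumption)+
    then show "of_int (sign p) * prod_list (map (\<lambda>i. A i (p i)) [1..<n + 1]) = of_int (sign p) *
     (\<Sum>I\<in>Pow {1..n}. poly_op (\<Prod>a\<in>{1..n}. if a \<in> I then \<beta> a (p a) else \<alpha> a (p a)) * ?T I)"
       by (simp only:)
  qed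
  also have "\<dots> = (\<Sum>p | p permutes {1..n}. \<Sum>I\<in>Pow {1..n}.
      poly_op (signof p * (\<Prod>a\<in>{1..n}. if a \<in> I then \<beta> a (p a) else \<alpha> a (p a))) * ?T I)"
    unfolding sum_distrib_left poly_op_mult poly_op_of_int mult.assoc ..
  also have "\<dots> = (\<Sum>I\<in>Pow {1..n}. \<Sum>p | p permutes {1..n}.
      poly_op (signof p * (\<Prod>a\<in>{1..n}. if a \<in> I then \<beta> a (p a) else \<alpha> a (p a))) * ?T I)"
    by (rule sum.swap)
  also have "\<dots> = (\<Sum>I\<in>Pow {1..n}. poly_op (\<Sum>p | p permutes {1..n}.
      signof p * (\<Prod>a\<in>{1..n}. if a \<in> I then \<beta> a (p a) else \<alpha> a (p a))) * ?T I)"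
    unfolding poly_op_sum sum_distrib_right ..
  finally show ?thesis
    unfolding Leibniz_ndet_shift[of "\<lambda>a b. if a \<in> I then \<beta> a b else \<alpha> a b" n for I] .
qed

section \<open>Rows, variables and coefficients of \<open>t\<close>\<close>

lemma nupp_eq: "nupp n = (n + 1) div 2" and nlow_eq: "nlow n = n div 2"
proof -
  show "nlow n = n div 2" by (simp add: nlow_def floor_divide_of_nat_eq[of n 2, simplified])
  show "nupp n = (n + 1) div 2"
  proof (cases "even n")
    case True
    then obtain k where "n = 2 * k" by (elim evenE)
    then show ?thesis by (simp add: nupp_def)
  next
    case False
    then obtain k where k: "n = 2 * k + 1" by (elim oddE)
    have "\<lceil>real n / 2\<rceil> = int k + 1" by (rule ceiling_unique) (simp_all add: k)
    then show ?thesis by (simp add: nupp_def k nat_add_distrib)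
  qed
qed

text \<open>
  Row \<open>a\<close> belongs to the variable with this index; \<open>var_row\<close> is the inverse map.
\<close>
definition row_var :: "nat \<Rightarrow> nat \<Rightarrow> nat" where
  "row_var n a = (if a \<le> nupp n then 2 * a - 1 else 2 * (a - nupp n))"

definition var_row :: "nat \<Rightarrow> nat \<Rightarrow> nat" where
  "var_row n v = (if odd v then (v + 1) div 2 else nupp n + v div 2)"

lemma var_row_row_var: "a \<in> {1..n} \<Longrightarrow> var_row n (row_var n a) = a"
  by (auto simp: var_row_def row_var_def)

lemma row_var_var_row: "v \<in> {1..n} \<Longrightarrow> row_var n (var_row n v) = v"
  by (auto simp: var_row_def row_var_def nupp_eq elim!: oddE evenE)

lemma row_var_range: "a \<in> {1..n} \<Longrightarrow> row_var n a \<in> {1..n}"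
  by (auto simp: row_var_def nupp_eq)

lemma var_row_range: "v \<in> {1..n} \<Longrightarrow> var_row n v \<in> {1..n}"
  by (auto simp: var_row_def nupp_eq elim!: oddE evenE)

lemma var_row_le_nupp: "v \<in> {1..n} \<Longrightarrow> var_row n v \<le> nupp n \<longleftrightarrow> odd v"
  using div_le_mono[of "v + 1" "n + 1" 2] by (auto simp: var_row_def nupp_eq elim!: evenE)

lemma row_var_inj: "inj_on (row_var n) {1..n}"
  by (rule inj_on_inverseI[of _ "var_row n"]) (rule var_row_row_var)

lemma zvar_eq_iff: "zvar i = (zvar j :: 'k::field_char_0 ratfun) \<longleftrightarrow> i = j"
proof
  assume eq: "zvar i = (zvar j :: 'k ratfun)"
  show "i = j"
  proof (rule ccontr)
    assume "i \<noteq> j"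
    moreover have "int_indep {i, j} (\<lambda>a. zvar a :: 'k ratfun)" by (rule int_indep_zvar) auto
    ultimately have "zvar i - (zvar j :: 'k ratfun) \<notin> \<int>"
      by (intro int_indep_diff[of "{i, j}" zvar]) auto
    then show False using eq by simp
  qed
qed simp

lemma phi_nonzero: "phi n \<noteq> (0 :: 'k::field_char_0 ratfun)"
proof -
  have "finite {(i, j). 1 \<le> i \<and> i < j \<and> j \<le> n \<and> even (j - i)}"
    by (rule finite_subset[of _ "{1..n} \<times> {1..n}"]) auto
  then show ?thesis by (auto simp: phi_def prod_zero_iff zvar_eq_iff)
qed

text \<open>
  On the rows of one kind \<open>row_var\<close> is increasing, and two indices of variables belong to rows
  of the same kind iff their difference is even.
\<close>
lemma phi_coloured_vandermonde:
  "phi n = (\<Prod>b<n. \<Prod>a<b. if (Suc a \<le> nupp n) = (Suc b \<le> nupp n)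
     then zvar (row_var n (Suc a)) - zvar (row_var n (Suc b)) else (1 :: 'k::field_char_0
       ratfun))" (is "_ = ?r")
proof -
  define S where "S = {p \<in> {..<n} \<times> {..<n}. fst p < snd p \<and>
    (Suc (fst p) \<le> nupp n \<longleftrightarrow> Suc (snd p) \<le> nupp n)}"
  have "phi n = (\<Prod>p\<in>S. zvar (row_var n (Suc (fst p))) - zvar (row_var n (Suc (snd p))) :: 'k
    ratfun)"
    unfolding phi_def
  proof (rule prod.reindex_bij_witness[of _ "\<lambda>p. (row_var n (Suc (fst p)), row_var n (Suc (snd p)))"
        "\<lambda>p. (var_row n (fst p) - 1, var_row n (snd p) - 1)"], goal_cases)
    case (1 p)
    then have "fst p \<in> {1..n}" "snd p \<in> {1..n}" by auto
    then show ?case using var_row_range[of "fst p" n] var_row_range[of "snd p" n] by (simp add: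
      row_var_var_row)
  next
    case (2 p)
    then obtain i j where p: "p = (i, j)" and ij: "1 \<le> i" "i < j" "j \<le> n" "even (j - i)" by auto
    have m: "var_row n i \<in> {1..n}" "var_row n j \<in> {1..n}"
      using ij var_row_range[of i n] var_row_range[of j n] by simp_all
    have par: "odd i \<longleftrightarrow> odd j" using ij by auto
    have lt: "var_row n i < var_row n j"
    proof (cases "odd i")
      case True
      then show ?thesis using par ij by (auto simp: var_row_def elim!: oddE)
    next
      case False
      then show ?thesis using par ij by (auto simp: var_row_def elim!: evenE)
    qed
    have "var_row n i \<le> nupp n \<longleftrightarrow> odd i" "var_row n j \<le> nupp n \<longleftrightarrow> odd j"
      using ij var_row_le_nupp[of i n] var_row_le_nupp[of j n] by simp_all
    then show ?case using m lt par unfolding p S_def by auto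
  next
    case (3 q)
    then have "Suc (fst q) \<in> {1..n}" "Suc (snd q) \<in> {1..n}" by (auto simp: S_def)
    then show ?case by (simp add: var_row_row_var)
  next
    case (4 q)
    then have q: "Suc (fst q) \<in> {1..n}" "Suc (snd q) \<in> {1..n}" "fst q < snd q"
      "Suc (fst q) \<le> nupp n \<longleftrightarrow> Suc (snd q) \<le> nupp n" by (auto simp: S_def)
    have "row_var n (Suc (fst q)) < row_var n (Suc (snd q))"
      "even (row_var n (Suc (snd q)) - row_var n (Suc (fst q)))"
      using q(3,4) by (auto simp: row_var_def)
    then show ?case using row_var_range[OF q(1)] row_var_range[OF q(2)] by auto
  next
    case (5 p)
    then obtain i j where p: "p = (i, j)" and ij: "i \<in> {1..n}" "j \<in> {1..n}" by auto
    then show ?case using var_row_range[OF ij(1)] var_row_range[OF ij(2)] by (simp add: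
      row_var_var_row)
  qed
  also have "\<dots> = (\<Prod>p\<in>{p \<in> {..<n} \<times> {..<n}. fst p < snd p}. if (Suc (fst p) \<le> nupp n) =
    (Suc (snd p) \<le> nupp n)
     then zvar (row_var n (Suc (fst p))) - zvar (row_var n (Suc (snd p))) else 1)"
    unfolding S_def by (rule prod.mono_neutral_cong_left) auto
  also have "\<dots> = (\<Prod>(b, a)\<in>(SIGMA b:{..<n}. {..<b}). if (Suc a \<le> nupp n) = (Suc b \<le> nupp n)
     then zvar (row_var n (Suc a)) - zvar (row_var n (Suc b)) else 1)"
    by (rule prod.reindex_bij_witness[of _ prod.swap prod.swap]) auto
  also have "\<dots> = ?r" by (rule prod.Sigma[symmetric]) auto
  finally show ?thesis .
qed

lemma rconst_inj: "inj (rconst :: 'k::field_char_0 \<Rightarrow> _)"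
proof (rule injI)
  fix a b :: 'k assume "rconst a = rconst b"
  then have "pconst a = pconst b" by (simp add: rconst_def eq_fract)
  then show "a = b" unfolding pconst_def by (metis lookup_single_eq)
qed

text \<open>
  The constants are infinitely many points, and only finitely many can be roots of a nonzero
  polynomial.
\<close>
lemma vanishing_coeffs:
  assumes "\<And>\<tau> :: 'k::field_char_0. (\<Sum>m\<le>M. rconst \<tau> ^ m * c m) = 0" "m \<le> M"
  shows "c m = 0"
proof -
  define p where "p = (\<Sum>m\<le>M. monom (c m) m)"
  have "poly p (rconst \<tau>) = 0" for \<tau> :: 'k
    using assms(1)[of \<tau>] by (simp add: p_def poly_sum poly_monom mult.commute)
  then have "range (rconst :: 'k \<Rightarrow> _) \<subseteq> {x. poly p x = 0}" by auto
  moreover have "infinite (range (rconst :: 'k \<Rightarrow> _))"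
    using rconst_inj infinite_UNIV_char_0 finite_imageD by blast
  ultimately have "infinite {x. poly p x = 0}" using finite_subset by blast
  then have "p = 0" using poly_roots_finite by blast
  moreover have "coeff p m = c m"
    using assms(2) by (simp add: p_def coeff_sum)
  ultimately show ?thesis by simp
qed

lemma shift_sum_rconst: "shift_sum \<nu> n c * mult_op (rconst a) = mult_op (rconst a) *
  shift_sum \<nu> n c"
  unfolding shift_sum_def sum_distrib_left sum_distrib_right
proof (intro sum.cong refl)
  fix I
  let ?D = "Tpow \<nu> n (\<lambda>a. of_bool (a \<in> I))"
  have "mult_op (c I) * ?D * mult_op (rconst a) = mult_op (c I) * (mult_op (rconst a) * ?D)"
    using hom_op_mult_op[OF hom_op_Tpow, of \<nu> n "\<lambda>a. of_bool (a \<in> I)" "rconst a"]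
    by (simp only: mult.assoc Tpow_rconst)
  also have "\<dots> = mult_op (c I * rconst a) * ?D" by (simp only: mult_op_hom mult.assoc)
  also have "\<dots> = mult_op (rconst a) * (mult_op (c I) * ?D)"
    by (simp only: mult.commute[of "c I"] mult_op_hom mult.assoc)
  finally show "mult_op (c I) * ?D * mult_op (rconst a) = mult_op (rconst a) * (mult_op (c I) *
    ?D)" .
qed

lemma rconst_mult: "rconst (a * b) = rconst a * rconst b"
  by (simp add: rconst_def pconst_simps)

lemma rconst_power: "rconst (a ^ k) = rconst a ^ k"
  by (induction k) (simp_all add: rconst_1 rconst_mult)

lemma app_endo_sum: "app_endo (sum F A) f = (\<Sum>x\<in>A. app_endo (F x) f)"
  by (induction A rule: infinite_finite_induct) (simp_all add: zero_endo.rep_eq plus_endo.rep_eq)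

lemma shift_sum_poly:
  assumes "\<And>I. I \<subseteq> {1..n} \<Longrightarrow> degree (c I) \<le> M"
  shows "shift_sum \<nu> n (\<lambda>I. poly (c I) (rconst \<tau>)) =
    (\<Sum>m\<le>M. mult_op (rconst (\<tau> ^ m)) * shift_sum \<nu> n (\<lambda>I. coeff (c I) m))"
proof -
  have "poly (c I) (rconst \<tau>) = (\<Sum>m\<le>M. rconst (\<tau> ^ m) * coeff (c I) m)" if "I \<subseteq> {1..n}" for I
  proof -
    have "poly (c I) (rconst \<tau>) = (\<Sum>m\<le>degree (c I). rconst (\<tau> ^ m) * coeff (c I) m)"
      by (simp add: poly_altdef rconst_power mult.commute)
    also have "\<dots> = (\<Sum>m\<le>M. rconst (\<tau> ^ m) * coeff (c I) m)"
      using assms[OF that] by (intro sum.mono_neutral_left) (auto simp: coeff_eq_0)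
    finally show ?thesis .
  qed
  then have "shift_sum \<nu> n (\<lambda>I. poly (c I) (rconst \<tau>)) = (\<Sum>I\<in>Pow {1..n}. \<Sum>m\<le>M.
      mult_op (rconst (\<tau> ^ m)) * (mult_op (coeff (c I) m) * Tpow \<nu> n (\<lambda>a. of_bool (a \<in> I))))"
    unfolding shift_sum_def
    by (intro sum.cong refl) (simp add: mult_op_sum mult_op_hom sum_distrib_right mult.assoc)
  also have "\<dots> = (\<Sum>m\<le>M. mult_op (rconst (\<tau> ^ m)) * shift_sum \<nu> n (\<lambda>I. coeff (c I) m))"
    unfolding shift_sum_def sum_distrib_left by (rule sum.swap)
  finally show ?thesis .
qed

text \<open>
  The commutator at \<open>(\<tau>, \<sigma>)\<close>, applied to a function, is a polynomial in \<open>\<tau>\<close> and \<open>\<sigma>\<close> whose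
  coefficients are the commutators in question.
\<close>
lemma shift_sum_coeffs_commute:
  fixes c d :: "nat set \<Rightarrow> 'k::field_char_0 ratfun poly"
  assumes comm: "\<And>\<tau> \<sigma>. shift_sum \<nu> n (\<lambda>I. poly (c I) (rconst \<tau>)) *
    shift_sum \<nu> n (\<lambda>I. poly (d I) (rconst \<sigma>)) =
     shift_sum \<nu> n (\<lambda>I. poly (d I) (rconst \<sigma>)) * shift_sum \<nu> n (\<lambda>I. poly (c I) (rconst \<tau>))"
  shows "shift_sum \<nu> n (\<lambda>I. coeff (c I) i) * shift_sum \<nu> n (\<lambda>I. coeff (d I) j) =
    shift_sum \<nu> n (\<lambda>I. coeff (d I) j) * shift_sum \<nu> n (\<lambda>I. coeff (c I) i)"
proof -
  \<comment> \<open>a common bound for all degrees and for the two indices\<close>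
  define M where "M = i + j + (\<Sum>I\<in>Pow {1..n}. degree (c I) + degree (d I))"
  have M: "degree (c I) \<le> M" "degree (d I) \<le> M" if "I \<subseteq> {1..n}" for I
  proof -
    have "degree (c I) + degree (d I) \<le> (\<Sum>I\<in>Pow {1..n}. degree (c I) + degree (d I))"
      using that by (intro member_le_sum) auto
    then show "degree (c I) \<le> M" "degree (d I) \<le> M" by (auto simp: M_def)
  qed
  define E F where "E m = shift_sum \<nu> n (\<lambda>I. coeff (c I) m)" and "F m =
    shift_sum \<nu> n (\<lambda>I. coeff (d I) m)" for m
  have EF: "E m * mult_op (rconst a) = mult_op (rconst a) * E m"
    "F m * mult_op (rconst a) = mult_op (rconst a) * F m" for m a
    unfolding E_def F_def by (rule shift_sum_rconst)+
  have mm: "mult_op (rconst a) * A * (mult_op (rconst b) * B) = mult_op (rconst a * rconst b) *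
    (A * B)"
    if "A * mult_op (rconst b) = mult_op (rconst b) * A" for a b and A B :: "'k oper"
  proof -
    have "mult_op (rconst a) * A * (mult_op (rconst b) * B) = mult_op (rconst a) * (A *
      mult_op (rconst b)) * B"
      by (simp only: mult.assoc)
    then show ?thesis unfolding that by (simp only: mult_op_hom mult.assoc)
  qed
  have cE: "shift_sum \<nu> n (\<lambda>I. poly (c I) (rconst \<tau>)) = (\<Sum>m\<le>M. mult_op (rconst (\<tau> ^ m)) * E m)"
    for \<tau>
    unfolding E_def by (rule shift_sum_poly) (rule M(1))
  have dF: "shift_sum \<nu> n (\<lambda>I. poly (d I) (rconst \<tau>)) = (\<Sum>m\<le>M. mult_op (rconst (\<tau> ^ m)) * F m)"
    for \<tau>
    unfolding F_def by (rule shift_sum_poly) (rule M(2))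
  define G where "G f m m' = app_endo (E m * F m' - F m' * E m) f" for f m m'
  have "(\<Sum>m\<le>M. rconst \<tau> ^ m * (\<Sum>m'\<le>M. rconst \<sigma> ^ m' * G f m m')) = 0" for \<tau> \<sigma> f
  proof -
    have "(\<Sum>m\<le>M. \<Sum>m'\<le>M. mult_op (rconst (\<tau> ^ m) * rconst (\<sigma> ^ m')) * (E m * F m' - F m' * E m)) =
      (\<Sum>m\<le>M. mult_op (rconst (\<tau> ^ m)) * E m) * (\<Sum>m\<le>M. mult_op (rconst (\<sigma> ^ m)) * F m) -
      (\<Sum>m\<le>M. mult_op (rconst (\<sigma> ^ m)) * F m) * (\<Sum>m\<le>M. mult_op (rconst (\<tau> ^ m)) * E m)"
    proof -
      have "(\<Sum>m\<le>M. mult_op (rconst (\<sigma> ^ m)) * F m) * (\<Sum>m\<le>M. mult_op (rconst (\<tau> ^ m)) * E m) =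
        (\<Sum>m\<le>M. \<Sum>m'\<le>M. mult_op (rconst (\<tau> ^ m) * rconst (\<sigma> ^ m')) * (F m' * E m))"
        unfolding sum_product mm[OF EF(2)] by (subst sum.swap) (simp only: mult.commute)
      moreover have "(\<Sum>m\<le>M. mult_op (rconst (\<tau> ^ m)) * E m) * (\<Sum>m\<le>M. mult_op (rconst (\<sigma> ^ m)) *
        F m) =
        (\<Sum>m\<le>M. \<Sum>m'\<le>M. mult_op (rconst (\<tau> ^ m) * rconst (\<sigma> ^ m')) * (E m * F m'))"
        unfolding sum_product mm[OF EF(1)] ..
      ultimately show ?thesis by (simp add: right_diff_distrib sum_subtractf)
    qed
    also have "\<dots> = 0"
      using comm[of \<tau> \<sigma>] unfolding cE dF by simp
    finally have "app_endo (\<Sum>m\<le>M. \<Sum>m'\<le>M. mult_op (rconst (\<tau> ^ m) * rconst (\<sigma> ^ m')) *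
      (E m * F m' - F m' * E m)) f = 0" by (simp add: zero_endo.rep_eq)
    then show ?thesis
      unfolding app_endo_sum times_endo.rep_eq[of "mult_op _"] mult_op.rep_eq G_def[symmetric]
      by (simp add: rconst_power sum_distrib_left mult.assoc)
  qed
  then have "(\<Sum>m'\<le>M. rconst \<sigma> ^ m' * G f i m') = 0" for \<sigma> f
    by (rule vanishing_coeffs[where M = M and c = "\<lambda>m. \<Sum>m'\<le>M. rconst \<sigma> ^ m' * G f m m'"]) (simp
      add: M_def)
  then have "G f i j = 0" for f
    by (rule vanishing_coeffs[where M = M and c = "G f i"]) (simp add: M_def)
  then have "E i * F j - F j * E i = 0"
    by (intro endo_eqI) (simp add: G_def zero_endo.rep_eq)
  then show ?thesis by (simp add: E_def F_def)
qed

section \<open>The coefficient field and the leading coefficients\<close>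

lemma mpolys_add: "p \<in> mpolys n \<Longrightarrow> q \<in> mpolys n \<Longrightarrow> p + q \<in> mpolys n"
  using Poly_Mapping.keys_add[of p q] by (auto simp: mpolys_def)

lemma mpolys_uminus: "p \<in> mpolys n \<Longrightarrow> - p \<in> mpolys n"
  by (simp add: mpolys_def)

lemma mpolys_mult:
  assumes "p \<in> mpolys n" "q \<in> mpolys n"
  shows "p * q \<in> mpolys n"
  unfolding mpolys_def mem_Collect_eq
proof
  fix m assume "m \<in> Poly_Mapping.keys (p * q)"
  then obtain a b where m: "m = a + b" "a \<in> Poly_Mapping.keys p" "b \<in> Poly_Mapping.keys q"
    using keys_mult[of p q] by blast
  then show "Poly_Mapping.keys m \<subseteq> {1..n}"
    using assms Poly_Mapping.keys_add[of a b] unfolding mpolys_def by blast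
qed

lemma mpolys_pconst: "pconst a \<in> mpolys n"
  by (simp add: mpolys_def pconst_def)

lemma mpolys_pvar: "v \<in> {1..n} \<Longrightarrow> pvar v \<in> mpolys n"
  by (simp add: mpolys_def pvar_def)

lemma mpolys_0: "0 \<in> mpolys n" and mpolys_1: "1 \<in> mpolys n"
  using mpolys_pconst[of 0 n] mpolys_pconst[of 1 n] by (simp_all add: pconst_simps)

lemma ratfuns_I: "p \<in> mpolys n \<Longrightarrow> q \<in> mpolys n \<Longrightarrow> q \<noteq> 0 \<Longrightarrow> Fract p q \<in> ratfuns n"
  by (auto simp: ratfuns_def)

lemma ratfuns_rconst: "rconst a \<in> ratfuns n"
  unfolding rconst_def by (intro ratfuns_I mpolys_pconst mpolys_1) simp

lemma ratfuns_zvar: "v \<in> {1..n} \<Longrightarrow> zvar v \<in> ratfuns n"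
  unfolding zvar_def by (intro ratfuns_I mpolys_pvar mpolys_1) simp_all

lemma ratfuns_1: "1 \<in> ratfuns n" and ratfuns_0: "0 \<in> ratfuns n"
  unfolding One_fract_def Zero_fract_def by (intro ratfuns_I mpolys_0 mpolys_1; simp)+

lemma ratfuns_add:
  assumes "f \<in> ratfuns n" "h \<in> ratfuns n"
  shows "f + h \<in> ratfuns n"
proof -
  obtain p q p' q' where "f = Fract p q" "h = Fract p' q'" "p \<in> mpolys n" "q \<in> mpolys n" "q \<noteq> 0"
    "p' \<in> mpolys n" "q' \<in> mpolys n" "q' \<noteq> 0" using assms by (auto simp: ratfuns_def)
  then show ?thesis by (auto intro!: ratfuns_I mpolys_add mpolys_mult)
qed

lemma ratfuns_mult:
  assumes "f \<in> ratfuns n" "h \<in> ratfuns n"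
  shows "f * h \<in> ratfuns n"
proof -
  obtain p q p' q' where "f = Fract p q" "h = Fract p' q'" "p \<in> mpolys n" "q \<in> mpolys n" "q \<noteq> 0"
    "p' \<in> mpolys n" "q' \<in> mpolys n" "q' \<noteq> 0" using assms by (auto simp: ratfuns_def)
  then show ?thesis by (auto intro!: ratfuns_I mpolys_mult)
qed

lemma ratfuns_uminus:
  assumes "f \<in> ratfuns n"
  shows "- f \<in> ratfuns n"
proof -
  obtain p q where "f = Fract p q" "p \<in> mpolys n" "q \<in> mpolys n" "q \<noteq> 0"
    using assms by (auto simp: ratfuns_def)
  then show ?thesis by (auto intro!: ratfuns_I mpolys_uminus)
qed

lemma ratfuns_diff: "f \<in> ratfuns n \<Longrightarrow> h \<in> ratfuns n \<Longrightarrow> f - h \<in> ratfuns n"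
  using ratfuns_add[of f n "- h"] ratfuns_uminus[of h n] by simp

lemma ratfuns_inverse:
  assumes "f \<in> ratfuns n"
  shows "inverse f \<in> ratfuns n"
proof -
  obtain p q where f: "f = Fract p q" and pq: "p \<in> mpolys n" "q \<in> mpolys n" "q \<noteq> 0"
    using assms by (auto simp: ratfuns_def)
  show ?thesis
  proof (cases "p = 0")
    case True
    then have "f = 0" using f by (simp add: fract_collapse)
    then show ?thesis by (simp add: ratfuns_0)
  next
    case False
    then show ?thesis unfolding f using pq by (auto intro!: ratfuns_I)
  qed
qed

lemma ratfuns_power: "f \<in> ratfuns n \<Longrightarrow> f ^ k \<in> ratfuns n"
  by (induction k) (simp_all add: ratfuns_1 ratfuns_mult)

lemma ratfuns_prod: "(\<And>x. x \<in> A \<Longrightarrow> f x \<in> ratfuns n) \<Longrightarrow> prod f A \<in> ratfuns n"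
  by (induction A rule: infinite_finite_induct) (simp_all add: ratfuns_1 ratfuns_mult)

lemma ratfuns_sum: "(\<And>x. x \<in> A \<Longrightarrow> f x \<in> ratfuns n) \<Longrightarrow> sum f A \<in> ratfuns n"
  by (induction A rule: infinite_finite_induct) (simp_all add: ratfuns_0 ratfuns_add)

lemma ratfuns_of_int: "of_int k \<in> ratfuns n"
proof -
  have "of_nat j \<in> ratfuns n" for j by (induction j) (simp_all add: ratfuns_0 ratfuns_1 ratfuns_add)
  then show ?thesis by (cases k) (auto intro: ratfuns_diff ratfuns_uminus ratfuns_1)
qed

lemma ratfuns_coeff_prod:
  "(\<And>x i. x \<in> A \<Longrightarrow> coeff (f x) i \<in> ratfuns n) \<Longrightarrow> coeff (prod f A) i \<in> ratfuns n"
proof (induction A arbitrary: i rule: infinite_finite_induct)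
  case (insert x A)
  then show ?case by (auto simp: coeff_mult intro!: ratfuns_sum ratfuns_mult)
qed (auto simp: ratfuns_0 ratfuns_1)

text \<open>
  The set \<open>I\<close> is recovered from the word that lists its variables in the order of the rows.
\<close>
lemma difference_operator_shift_sum:
  fixes c :: "nat set \<Rightarrow> 'k::field_char_0 ratfun"
  assumes \<nu>: "inj_on \<nu> {1..n}" "\<nu> ` {1..n} \<subseteq> {1..n}"
    and c: "\<And>I. I \<subseteq> {1..n} \<Longrightarrow> c I \<in> ratfuns n"
  shows "difference_operator n (shift_sum \<nu> n c)"
proof -
  define word where "word I = map \<nu> (filter (\<lambda>a. a \<in> I) [1..<n + 1])" for I
  have set_word: "set (word I) = \<nu> ` I" if "I \<subseteq> {1..n}" for I
  proof -
    have "set (filter (\<lambda>a. a \<in> I) [1..<n + 1]) = I" using that by (auto simp del: upt_Suc)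
    then show ?thesis by (simp add: word_def del: upt_Suc)
  qed
  have inj: "inj_on word (Pow {1..n})"
  proof (rule inj_onI)
    fix I J assume IJ: "I \<in> Pow {1..n}" "J \<in> Pow {1..n}" "word I = word J"
    then have "\<nu> ` I = \<nu> ` J" using set_word[of I] set_word[of J] by auto
    then show "I = J" using IJ inj_on_image_eq_iff[OF \<nu>(1), of I J] by auto
  qed
  define d where "d w = c (inv_into (Pow {1..n}) word w)" for w
  have d: "d (word I) = c I" if "I \<in> Pow {1..n}" for I
    using inv_into_f_f[OF inj that] by (simp add: d_def)
  have T: "prod_list (map T (map \<nu> (filter (\<lambda>a. a \<in> I) [1..<m + 1]))) =
    Tpow \<nu> m (\<lambda>a. of_bool (a \<in> I))" for I m
    by (induction m) (simp_all add: Tpow_0 Tpow_Suc)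
  have "shift_sum \<nu> n c = (\<Sum>I\<in>Pow {1..n}. mult_op (d (word I)) * prod_list (map T (word I)))"
  proof -
    have "prod_list (map T (word I)) = (Tpow \<nu> n (\<lambda>a. of_bool (a \<in> I)) :: 'k oper)" for I
      unfolding word_def by (rule T)
    then show ?thesis unfolding shift_sum_def by (intro sum.cong refl) (simp only: d)
  qed
  also have "\<dots> = (\<Sum>w\<in>word ` Pow {1..n}. mult_op (d w) * prod_list (map T w))"
    by (subst sum.reindex[OF inj]) simp
  finally have "shift_sum \<nu> n c = (\<Sum>w\<in>word ` Pow {1..n}. mult_op (d w) * prod_list (map T w))" .
  moreover have "word ` Pow {1..n} \<subseteq> lists {1..n}"
  proof (rule image_subsetI)
    fix I assume "I \<in> Pow {1..n}"
    then have "set (word I) \<subseteq> \<nu> ` {1..n}" using set_word[of I] image_mono[of I "{1..n}" \<nu>] by simp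
    then show "word I \<in> lists {1..n}" using \<nu>(2) by (simp add: lists_eq_set)
  qed
  moreover have "\<forall>w\<in>word ` Pow {1..n}. d w \<in> ratfuns n" using d c by (simp add: Pow_def)
  moreover have "finite (word ` Pow {1..n})" by simp
  ultimately show ?thesis unfolding difference_operator_def by blast
qed

lemma tpoly_monic_expansion:
  fixes F :: "'a::ring_1 tpoly"
  assumes "\<And>m. m \<ge> N \<Longrightarrow> Poly_Mapping.lookup F m = of_bool (m = N)"
  shows "F = tvar ^ N + (\<Sum>i=1..N. tconst (Poly_Mapping.lookup F (N - i)) * tvar ^ (N - i))"
proof (rule poly_mapping_eqI)
  fix m
  have t: "(tvar :: 'a tpoly) ^ k = Poly_Mapping.single k 1" for k
    by (induction k) (simp_all add: mult_single)
  have "Poly_Mapping.lookup (\<Sum>i=1..N. tconst (Poly_Mapping.lookup F (N - i)) * tvar ^ (N - i)) m =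
     (\<Sum>i=1..N. if m = N - i then Poly_Mapping.lookup F m else 0)"
    unfolding lookup_sum t by (intro sum.cong refl) (simp add: mult_single lookup_single when_def)
  also have "\<dots> = (\<Sum>i=1..N. if i = N - m \<and> m < N then Poly_Mapping.lookup F m else 0)"
    by (intro sum.cong refl) auto
  also have "\<dots> = (if m < N then Poly_Mapping.lookup F m else 0)"
    by (cases "m < N") auto
  finally have S: "Poly_Mapping.lookup (\<Sum>i=1..N. tconst (Poly_Mapping.lookup F (N - i)) *
    tvar ^ (N - i)) m =
    (if m < N then Poly_Mapping.lookup F m else 0)" .
  show "Poly_Mapping.lookup F m = Poly_Mapping.lookup
      (tvar ^ N + (\<Sum>i=1..N. tconst (Poly_Mapping.lookup F (N - i)) * tvar ^ (N - i))) m"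
    unfolding lookup_add S unfolding t using assms[of m] by (auto simp: lookup_single when_def)
qed

context two_coloured
begin

definition op_coeff_poly :: "(nat \<Rightarrow> 'a \<Rightarrow> 'a) \<Rightarrow> 'a \<Rightarrow> nat set \<Rightarrow> bool \<Rightarrow> (nat \<Rightarrow> 'a) \<Rightarrow> nat set \<Rightarrow>
  'a poly" where
  "op_coeff_poly w \<epsilon> V \<chi> z I = Polynomial.smult (of_bool (0 \<le> charge I \<and> charge I \<le> of_bool \<chi>) *
    \<epsilon> ^ nat (charge I) *
     (\<Prod>a\<in>V. if a \<in> I then w a (z a) else 1) *
     (\<Prod>(a, b)\<in>V \<times> V. if a \<in> I \<and> b \<notin> I then move_factor a b (z a - z b) else 1))
     (\<Prod>a\<in>V. if a \<notin> I \<and> isx a = \<chi> then [:z a, 1:] else 1)"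

lemma eval_op_coeff_poly: "poly (op_coeff_poly w \<epsilon> V \<chi> z I) t = op_coeff w \<epsilon> V (\<chi>, t) I z"
proof -
  have "(\<Prod>a\<in>V. if a \<in> I then w a (z a) else keep_factor (\<chi>, t) a (z a)) =
    (\<Prod>a\<in>V. if a \<in> I then w a (z a) else 1) * (\<Prod>a\<in>V. poly (if a \<notin> I \<and> isx a = \<chi> then
      [:z a, 1:] else 1) t)"
    unfolding prod.distrib[symmetric] by (intro prod.cong refl) (simp add: keep_factor_def)
  then show ?thesis by (simp add: op_coeff_def op_coeff_poly_def poly_prod mult_ac)
qed

text \<open>
  A nonempty set \<open>I\<close> of admissible charge contains a variable of the kind \<open>\<chi>\<close>, whose linear
  factor is then missing.
\<close>
lemma op_coeff_poly_leading:
  assumes V: "finite V" "I \<subseteq> V" and m: "m \<ge> card {a\<in>V. isx a = \<chi>}"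
  shows "coeff (op_coeff_poly w \<epsilon> V \<chi> z I) m = of_bool (I = {} \<and> m = card {a\<in>V. isx a = \<chi>})"
proof -
  define S where "S = {a\<in>V. a \<notin> I \<and> isx a = \<chi>}"
  define Q where "Q = (\<Prod>a\<in>V. if a \<notin> I \<and> isx a = \<chi> then [:z a, 1:] else 1)"
  have Q: "Q = (\<Prod>a\<in>S. [:z a, 1:])" unfolding Q_def S_def
    using V by (intro prod.mono_neutral_cong_right) auto
  have degQ: "degree Q = card S" unfolding Q
    by (subst degree_prod_eq_sum_degree) auto
  have leadQ: "coeff Q (card S) = 1" unfolding degQ[symmetric] unfolding Q
    by (simp only: lead_coeff_prod) simp
  show ?thesis
  proof (cases "I = {}")
    case True
    have "op_coeff_poly w \<epsilon> V \<chi> z I = Q" unfolding op_coeff_poly_def Q_def[symmetric] by (simp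
      add: True charge_def)
    moreover have "S = {a\<in>V. isx a = \<chi>}" by (simp add: S_def True)
    ultimately show ?thesis using True m degQ leadQ by (auto simp: coeff_eq_0)
  next
    case False
    have finI: "finite I" using V by (auto intro: finite_subset)
    show ?thesis
    proof (cases "0 \<le> charge I \<and> charge I \<le> of_bool \<chi>")
      case True
      have "\<exists>a\<in>I. isx a = \<chi>"
      proof (rule ccontr)
        assume "\<not> (\<exists>a\<in>I. isx a = \<chi>)"
        then have "charge I = (\<Sum>a\<in>I. if \<chi> then - 1 else 1)"
          unfolding charge_def by (intro sum.cong) (auto simp: unit_charge_def)
        also have "\<dots> = (if \<chi> then - int (card I) else int (card I))" by simp
        finally show False using True False finI by (auto simp: card_eq_0_iff split: if_splits)
      qed
      then have "S \<subset> {a\<in>V. isx a = \<chi>}" using V by (auto simp: S_def)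
      then have "card S < card {a\<in>V. isx a = \<chi>}" using V by (intro psubset_card_mono) auto
      then have "coeff Q m = 0" using degQ m by (simp add: coeff_eq_0)
      then show ?thesis using False by (simp add: op_coeff_poly_def Q_def[symmetric])
    next
      case nal: False
      then show ?thesis using False by (simp add: op_coeff_poly_def)
    qed
  qed
qed

end

lemma ratfuns_op_coeff_poly:
  fixes r \<epsilon> :: "'k::field_char_0 ratfun" and isx :: "nat \<Rightarrow> bool"
  assumes "r \<in> ratfuns n" "\<epsilon> \<in> ratfuns n" "\<And>a. a \<in> V \<Longrightarrow> z a \<in> ratfuns n"
    "\<And>a x. x \<in> ratfuns n \<Longrightarrow> w a x \<in> ratfuns n"
  shows "coeff (two_coloured.op_coeff_poly isx r w \<epsilon> V \<chi> z I) m \<in> ratfuns n"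
proof -
  interpret two_coloured isx r .
  have h: "move_factor a b d \<in> ratfuns n" if "d \<in> ratfuns n" for a b d
    using that assms(1) by (auto simp: move_factor_def intro!: ratfuns_inverse ratfuns_uminus
      ratfuns_diff)
  have lin: "coeff [:x, 1:] i \<in> ratfuns n" if "x \<in> ratfuns n" for x i
    using that by (auto simp: coeff_pCons ratfuns_0 ratfuns_1 split: nat.splits)
  show ?thesis unfolding op_coeff_poly_def coeff_smult
    using assms
    by (intro ratfuns_mult ratfuns_coeff_prod ratfuns_prod ratfuns_power)
       (auto intro!: h lin ratfuns_diff simp: ratfuns_0 ratfuns_1 of_bool_def)
qed

section \<open>The two families of operators\<close>

context two_coloured
begin

definition X_keep_poly :: "nat \<Rightarrow> nat \<Rightarrow> (nat \<Rightarrow> 'a) \<Rightarrow> nat \<Rightarrow> nat \<Rightarrow> 'a poly" where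
  "X_keep_poly N n z a b = (if a \<le> N \<and> b \<le> N then [:z a, 1:] *
    [:(z a + r) ^ (N - b):] else [:X_keep N n 0 z a b:])"

definition Y_keep_poly :: "nat \<Rightarrow> nat \<Rightarrow> (nat \<Rightarrow> 'a) \<Rightarrow> nat \<Rightarrow> nat \<Rightarrow> 'a poly" where
  "Y_keep_poly N n z a b = (if \<not> a \<le> N \<and> \<not> b \<le> N then [:z a, 1:] * [:(z a + r) ^ (n - N - (b - N)):]
     else [:Y_keep N n 0 z a b:])"

lemma poly_X_keep_poly: "poly (X_keep_poly N n z a b) t = X_keep N n t z a b"
  by (simp add: X_keep_poly_def X_keep_def algebra_simps)

lemma poly_Y_keep_poly: "poly (Y_keep_poly N n z a b) t = Y_keep N n t z a b"
  by (simp add: Y_keep_poly_def Y_keep_def algebra_simps)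

lemma hom_op_entries:
  assumes D: "hom_op D" and z: "app_endo D (z a) = z a" and r: "app_endo D r = r"
  shows "app_endo D (coeff (X_keep_poly N n z a b) i) = coeff (X_keep_poly N n z a b) i"
    "app_endo D (coeff (Y_keep_poly N n z a b) i) = coeff (Y_keep_poly N n z a b) i"
    "app_endo D (coeff [:X_move N n z a b:] i) = coeff [:X_move N n z a b:] i"
    "app_endo D (coeff [:Y_move N n z a b:] i) = coeff [:Y_move N n z a b:] i"
  by (simp_all add: X_keep_poly_def Y_keep_poly_def X_keep_def Y_keep_def X_move_def Y_move_def
    coeff_pCons z r
      hom_op_simps[OF D] hom_op_power_app[OF D] split: nat.splits)

end

lemma Tpow_zero: "Tpow \<nu> n (\<lambda>a. 0) = 1"
  by (induction n) (simp_all add: Tpow_0 Tpow_Suc)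

context
  fixes r :: "'k::field_char_0" and n :: nat
begin

abbreviation (input) row_zvar :: "nat \<Rightarrow> 'k ratfun" where "row_zvar \<equiv> \<lambda>a. zvar (row_var n a)"

interpretation two_coloured "\<lambda>a. a \<le> nupp n" "rconst r" .

lemma frakX_entry:
  assumes "a \<in> {1..n}" "b \<in> {1..n}"
  shows "frakX r n a b = poly_op (X_keep_poly (nupp n) n row_zvar a b) +
    poly_op [:X_move (nupp n) n row_zvar a b:] * tconst (T (row_var n a))"
proof -
  have l: "n - nupp n = nlow n" by (simp add: nupp_eq nlow_eq)
  have tc: "tconst (X * Y) = tconst X * tconst Y" "tconst (X + Y) = tconst X + tconst Y"
    "tconst (- X) = - tconst X" "tconst (0 :: 'k oper) = 0" for X Y :: "'k oper"
    by (simp_all add: mult_single single_add single_uminus)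
  show ?thesis
    by (cases "a \<le> nupp n"; cases "b \<le> nupp n")
       (simp_all only: frakX_def block_def X11_def X12_def X21_def X22_def X_keep_poly_def
         X_keep_def X_move_def
          Tx_def Ty_def xvar_def yvar_def row_var_def l if_True if_False simp_thms
          poly_op_mult poly_op_linear poly_op_const mult_op_hom tc mult_minus_left mult_zero_left
          diff_conv_add_uminus add_0_left add_0_right minus_zero)
qed

lemma frakY_entry:
  assumes "a \<in> {1..n}" "b \<in> {1..n}"
  shows "frakY r n a b = poly_op (Y_keep_poly (nupp n) n row_zvar a b) +
    poly_op [:Y_move (nupp n) n row_zvar a b:] * tconst (T (row_var n a))"
proof -
  have l: "n - nupp n = nlow n" by (simp add: nupp_eq nlow_eq)
  have tc: "tconst (X * Y) = tconst X * tconst Y" "tconst (X + Y) = tconst X + tconst Y"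
    "tconst (- X) = - tconst X" "tconst (0 :: 'k oper) = 0" for X Y :: "'k oper"
    by (simp_all add: mult_single single_add single_uminus)
  show ?thesis
    by (cases "a \<le> nupp n"; cases "b \<le> nupp n")
       (simp_all only: frakY_def block_def Y11_def Y12_def Y21_def Y22_def Y_keep_poly_def
         Y_keep_def Y_move_def
          Tx_def Ty_def xvar_def yvar_def row_var_def l if_True if_False simp_thms
          poly_op_mult poly_op_linear poly_op_const mult_op_hom tc mult_minus_left mult_zero_left
          diff_conv_add_uminus add_0_left add_0_right minus_zero)
qed

definition charge_sign :: "'k ratfun" where
  "charge_sign = (- 1) ^ (n - nupp n) * of_int (sign (cycle_back (nupp n)))"

definition coeff_poly :: "bool \<Rightarrow> nat set \<Rightarrow> 'k ratfun poly" where
  "coeff_poly \<chi> = op_coeff_poly (move_weight (nupp n - nlow n)) charge_sign {1..n} \<chi> row_zvar"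

lemma row_zvar_fixed:
  assumes "m < a" "a \<le> n"
  shows "app_endo (Tpow (row_var n) m k) (row_zvar a) = row_zvar a"
proof -
  have "row_var n c \<noteq> row_var n a" if "c \<in> {1..m}" for c
    using inj_onD[OF row_var_inj, of n c a] that assms by auto
  then have "(\<Sum>c=1..m. if row_var n c = row_var n a then k c else 0) = 0"
    by (intro sum.neutral) auto
  then show ?thesis by (simp only: Tpow_zvar of_nat_0 diff_0_right)
qed

lemma coloured_vandermonde_phi: "coloured_vandermonde n row_zvar = phi n"
  by (simp add: coloured_vandermonde_def phi_coloured_vandermonde)

text \<open>
  Polynomials over an infinite field are determined by their values, so the determinants need
  only be known for fixed values of \<open>t\<close>.
\<close>
lemma scaled_rowdet:
  assumes A: "\<And>a b. a \<in> {1..n} \<Longrightarrow> b \<in> {1..n} \<Longrightarrow> A a b = poly_op (\<alpha> a b) + poly_op (\<beta> a b) *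
    tconst (T (row_var n a))"
    and inv: "\<And>m a b k i. m < a \<Longrightarrow> a \<le> n \<Longrightarrow> app_endo (Tpow (row_var n) m k) (coeff (\<alpha> a b) i) =
      coeff (\<alpha> a b) i"
     "\<And>m a b k i. m < a \<Longrightarrow> a \<le> n \<Longrightarrow> app_endo (Tpow (row_var n) m k) (coeff (\<beta> a b) i) =
       coeff (\<beta> a b) i"
    and dt: "\<And>I t. I \<subseteq> {1..n} \<Longrightarrow> ndet n (\<lambda>i j. poly (if Suc i \<in> I then
      \<beta> (Suc i) (Suc j) else \<alpha> (Suc i) (Suc j)) t) =
      phi n * poly (coeff_poly \<chi> I) t"
  shows "Poly_Mapping.lookup (tconst (mult_op (inverse (phi n))) * rowdet n A) m =
    shift_sum (row_var n) n (\<lambda>I. coeff (coeff_poly \<chi> I) m)"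
proof -
  let ?F = "\<lambda>I. ndet n (\<lambda>i j. if Suc i \<in> I then \<beta> (Suc i) (Suc j) else \<alpha> (Suc i) (Suc j))"
  have c: "Polynomial.smult (inverse (phi n)) (?F I) = coeff_poly \<chi> I" if "I \<subseteq> {1..n}" for I
  proof -
    have "poly (Polynomial.smult (inverse (phi n)) (?F I)) t = poly (coeff_poly \<chi> I) t" for t
      using phi_nonzero[of n, where ?'k = 'k] by (simp add: poly_ndet dt[OF that])
    then show ?thesis by (simp add: poly_eq_poly_eq_iff[symmetric] fun_eq_iff)
  qed
  have "tconst (mult_op (inverse (phi n))) * rowdet n A = (\<Sum>I\<in>Pow {1..n}.
      poly_op (Polynomial.smult (inverse (phi n)) (?F I)) *
        tconst (Tpow (row_var n) n (\<lambda>a. of_bool (a \<in> I))))"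
  proof -
    have rd: "rowdet n A = (\<Sum>I\<in>Pow {1..n}. poly_op (?F I) *
      tconst (Tpow (row_var n) n (\<lambda>a. of_bool (a \<in> I))))"
      by (rule rowdet_expansion) (rule A inv; assumption)+
    show ?thesis unfolding rd poly_op_smult sum_distrib_left mult.assoc ..
  qed
  also have "\<dots> = (\<Sum>I\<in>Pow {1..n}. poly_op (coeff_poly \<chi> I) *
    tconst (Tpow (row_var n) n (\<lambda>a. of_bool (a \<in> I))))"
    by (intro sum.cong refl) (simp only: c Pow_iff)
  finally show ?thesis by (simp only: lookup_sum lookup_poly_op_tconst shift_sum_def)
qed

context
  assumes n: "n \<ge> 1"
begin

lemma block_sizes: "1 \<le> nupp n" "nupp n \<le> n" "nupp n = n - nupp n + (nupp n - nlow n)"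
  "nupp n - nlow n \<le> 1"
  using n by (auto simp: nupp_eq nlow_eq)

lemma row_zvar_distinct: "a \<in> {1..n} \<Longrightarrow> b \<in> {1..n} \<Longrightarrow> a \<noteq> b \<Longrightarrow> row_zvar a \<noteq> row_zvar b"
  using inj_onD[OF row_var_inj] by (auto simp: zvar_eq_iff)

lemma lookup_X_t: "Poly_Mapping.lookup (X_t r n) m = shift_sum (row_var n) n (\<lambda>I. coeff
  (coeff_poly True I) m)"
  unfolding X_t_def
proof (rule scaled_rowdet)
  fix I t assume I: "I \<subseteq> {1..n}"
  have "ndet n (\<lambda>i j. poly (if Suc i \<in> I then [:X_move (nupp n) n row_zvar (Suc i) (Suc j):] else
    X_keep_poly (nupp n) n row_zvar (Suc i) (Suc j)) t) =
    ndet n (\<lambda>i j. if Suc i \<in> I then X_move (nupp n) n row_zvar (Suc i) (Suc j) else X_keep (nupp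
      n) n t row_zvar (Suc i) (Suc j))"
    by (rule ndet_cong) (simp add: poly_X_keep_poly)
  also have "\<dots> = coloured_vandermonde n row_zvar * op_coeff (move_weight (nupp n - nlow n))
    charge_sign {1..n} (True, t) I row_zvar"
    unfolding charge_sign_def by (rule ndet_X[OF block_sizes _ row_zvar_distinct I]) auto
  finally show "ndet n (\<lambda>i j. poly (if Suc i \<in> I then [:X_move (nupp n) n row_zvar (Suc i) (Suc
    j):] else X_keep_poly (nupp n) n row_zvar (Suc i) (Suc j)) t) =
    phi n * poly (coeff_poly True I) t" by (simp add: coloured_vandermonde_phi coeff_poly_def
      eval_op_coeff_poly)
qed (rule frakX_entry hom_op_entries hom_op_Tpow row_zvar_fixed Tpow_rconst; assumption?)+

lemma lookup_Y_t: "Poly_Mapping.lookup (Y_t r n) m = shift_sum (row_var n) n (\<lambda>I. coeff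
  (coeff_poly False I) m)"
  unfolding Y_t_def
proof (rule scaled_rowdet)
  fix I t assume I: "I \<subseteq> {1..n}"
  have "ndet n (\<lambda>i j. poly (if Suc i \<in> I then [:Y_move (nupp n) n row_zvar (Suc i) (Suc j):] else
    Y_keep_poly (nupp n) n row_zvar (Suc i) (Suc j)) t) =
    ndet n (\<lambda>i j. if Suc i \<in> I then Y_move (nupp n) n row_zvar (Suc i) (Suc j) else Y_keep (nupp
      n) n t row_zvar (Suc i) (Suc j))"
    by (rule ndet_cong) (simp add: poly_Y_keep_poly)
  also have "\<dots> = coloured_vandermonde n row_zvar * op_coeff (move_weight (nupp n - nlow n))
    charge_sign {1..n} (False, t) I row_zvar"
    by (rule ndet_Y[OF block_sizes _ row_zvar_distinct I]) auto
  finally show "ndet n (\<lambda>i j. poly (if Suc i \<in> I then [:Y_move (nupp n) n row_zvar (Suc i) (Suc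
    j):] else Y_keep_poly (nupp n) n row_zvar (Suc i) (Suc j)) t) =
    phi n * poly (coeff_poly False I) t" by (simp add: coloured_vandermonde_phi coeff_poly_def
      eval_op_coeff_poly)
qed (rule frakY_entry hom_op_entries hom_op_Tpow row_zvar_fixed Tpow_rconst; assumption?)+

end

lemma shift_sum_coeff_poly_commute:
  "shift_sum (row_var n) n (\<lambda>I. coeff (coeff_poly \<chi> I) i) *
    shift_sum (row_var n) n (\<lambda>I. coeff (coeff_poly \<chi>' I) j) =
   shift_sum (row_var n) n (\<lambda>I. coeff (coeff_poly \<chi>' I) j) *
     shift_sum (row_var n) n (\<lambda>I. coeff (coeff_poly \<chi> I) i)"
proof (rule shift_sum_coeffs_commute)
  fix \<tau> \<sigma> :: 'k
  have w: "app_endo D (move_weight \<delta> a x) = move_weight \<delta> a (app_endo D x)" if "hom_op D"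
    for D \<delta> a x
    by (simp add: move_weight_def hom_op_simps[OF that] hom_op_power_app[OF that])
  have e: "app_endo D charge_sign = charge_sign" if "hom_op D" for D
    by (simp add: charge_sign_def sign_def hom_op_simps[OF that] hom_op_power_app[OF that])
  show "shift_sum (row_var n) n (\<lambda>I. poly (coeff_poly \<chi> I) (rconst \<tau>)) *
    shift_sum (row_var n) n (\<lambda>I. poly (coeff_poly \<chi>' I) (rconst \<sigma>)) =
    shift_sum (row_var n) n (\<lambda>I. poly (coeff_poly \<chi>' I) (rconst \<sigma>)) *
      shift_sum (row_var n) n (\<lambda>I. poly (coeff_poly \<chi> I) (rconst \<tau>))"
    unfolding coeff_poly_def eval_op_coeff_poly
    by (rule shift_sum_op_coeff_commute[OF row_var_inj]) (simp_all add: Tpow_rconst w e hom_op_Tpow)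
qed

lemma shift_sum_coeff_poly_leading:
  assumes N: "N = card {a\<in>{1..n}. (a \<le> nupp n) = \<chi>}" "m \<ge> N"
  shows "shift_sum (row_var n) n (\<lambda>I. coeff (coeff_poly \<chi> I) m) = of_bool (m = N)"
proof -
  have "shift_sum (row_var n) n (\<lambda>I. coeff (coeff_poly \<chi> I) m) = (\<Sum>I\<in>Pow {1..n}. if I = {} then
    of_bool (m = N) else 0)"
    unfolding shift_sum_def
  proof (intro sum.cong refl)
    fix I assume I: "I \<in> Pow {1..n}"
    have "coeff (coeff_poly \<chi> I) m = of_bool (I = {} \<and> m = N)"
      unfolding coeff_poly_def N(1) by (rule op_coeff_poly_leading) (use I N in auto)
    moreover have "Tpow (row_var n) n (\<lambda>a. 0) = (1 :: 'k oper)" by (rule Tpow_zero)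
    ultimately show "mult_op (coeff (coeff_poly \<chi> I) m) * Tpow (row_var n) n (\<lambda>a. of_bool (a \<in> I)) =
      (if I = {} then of_bool (m = N) else 0)" by (auto simp: mult_op_hom)
  qed
  then show ?thesis by simp
qed

lemma difference_operator_coeff_poly: "difference_operator n (shift_sum (row_var n) n (\<lambda>I. coeff
  (coeff_poly \<chi> I) m))"
proof (rule difference_operator_shift_sum[OF row_var_inj])
  show "row_var n ` {1..n} \<subseteq> {1..n}" using row_var_range by blast
  show "coeff (coeff_poly \<chi> I) m \<in> ratfuns n" for I
    unfolding coeff_poly_def
  proof (rule ratfuns_op_coeff_poly)
    show "charge_sign \<in> ratfuns n" unfolding charge_sign_def
      by (intro ratfuns_mult ratfuns_power ratfuns_uminus ratfuns_1 ratfuns_of_int)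
    show "row_zvar a \<in> ratfuns n" if "a \<in> {1..n}" for a using row_var_range[OF that] by (rule
      ratfuns_zvar)
    show "move_weight (nupp n - nlow n) a x \<in> ratfuns n" if "x \<in> ratfuns n" for a x
      using that by (auto simp: move_weight_def intro!: ratfuns_uminus ratfuns_power)
  qed (rule ratfuns_rconst)
qed

end

theorem corollary4p6:
  fixes r :: "'k::field_char_0" and n :: nat
  assumes "n \<ge> 1"
    and "\<not> (\<exists>q::rat. q < 0 \<and> r = of_rat q)"
  shows "X_t r n = tvar ^ nupp n + (\<Sum>i=1..nupp n. tconst (X_coeff r n i) * tvar ^ (nupp n - i))
    \<and> Y_t r n = tvar ^ nlow n + (\<Sum>i=1..nlow n. tconst (Y_coeff r n i) * tvar ^ (nlow n - i))
    \<and> (\<forall>D \<in> X_coeff r n ` {1..nupp n} \<union> Y_coeff r n ` {1..nlow n}.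
         difference_operator n D)
    \<and> (\<forall>D \<in> X_coeff r n ` {1..nupp n} \<union> Y_coeff r n ` {1..nlow n}.
       \<forall>E \<in> X_coeff r n ` {1..nupp n} \<union> Y_coeff r n ` {1..nlow n}. D * E = E * D)"
proof -
  note X = lookup_X_t[OF assms(1), of r] and Y = lookup_Y_t[OF assms(1), of r]
  have "{a\<in>{1..n}. (a \<le> nupp n) = True} = {1..nupp n}" "{a\<in>{1..n}. (a \<le> nupp n) = False} =
    {nupp n + 1..n}"
    by (auto simp: nupp_eq)
  then have c: "nupp n = card {a\<in>{1..n}. (a \<le> nupp n) = True}" "nlow n =
    card {a\<in>{1..n}. (a \<le> nupp n) = False}"
    by (simp_all add: nupp_eq nlow_eq)
  have "X_t r n = tvar ^ nupp n + (\<Sum>i=1..nupp n. tconst (X_coeff r n i) * tvar ^ (nupp n - i))"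
    unfolding X_coeff_def by (rule tpoly_monic_expansion) (simp only: X
      shift_sum_coeff_poly_leading[OF c(1)])
  moreover have "Y_t r n = tvar ^ nlow n + (\<Sum>i=1..nlow n. tconst (Y_coeff r n i) *
    tvar ^ (nlow n - i))"
    unfolding Y_coeff_def by (rule tpoly_monic_expansion) (simp only: Y
      shift_sum_coeff_poly_leading[OF c(2)])
  moreover have rep: "\<exists>\<chi> m. D = shift_sum (row_var n) n (\<lambda>I. coeff (coeff_poly r n \<chi> I) m)"
    if "D \<in> X_coeff r n ` {1..nupp n} \<union> Y_coeff r n ` {1..nlow n}" for D
    using that by (auto simp: X_coeff_def Y_coeff_def X Y)
  have "difference_operator n D"
    if "D \<in> X_coeff r n ` {1..nupp n} \<union> Y_coeff r n ` {1..nlow n}" for D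
    using rep[OF that] difference_operator_coeff_poly[of n r] by blast
  moreover have "D * E = E * D"
    if D: "D \<in> X_coeff r n ` {1..nupp n} \<union> Y_coeff r n ` {1..nlow n}"
      and E: "E \<in> X_coeff r n ` {1..nupp n} \<union> Y_coeff r n ` {1..nlow n}" for D E
  proof -
    obtain \<chi> m \<chi>' m' where "D = shift_sum (row_var n) n (\<lambda>I. coeff (coeff_poly r n \<chi> I) m)"
      "E = shift_sum (row_var n) n (\<lambda>I. coeff (coeff_poly r n \<chi>' I) m')"
      using rep[OF D] rep[OF E] by blast
    then show ?thesis by (simp only: shift_sum_coeff_poly_commute)
  qed
  ultimately show ?thesis by blast
qed

end
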